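(* Let $\Omega\subset\mathbb{R}^n$ be a connected bounded extension domain for $W^{s,p}$ and let $V\in L^q(\Omega)$ with $q\in(1,\infty)\cap(\tfrac{n}{sp},\infty)$. Then the first eigenvalue $\lambda(V)$ is isolated, i.e. there is $\varepsilon>0$ such that $\lambda(V)$ is the only eigenvalue (for the potential $V$) in $(\lambda(V)-\varepsilon,\lambda(V)+\varepsilon)$.
   Context: Fix $n\ge 1$, $0<s<1<p<\infty$. For an open set $\Omega\subset\mathbb{R}^n$, $W^{s,p}(\Omega)$ is the space of $u\in L^p(\Omega)$ with $[u]_{s,p;\Omega}:=\left(\iint_{\Omega\times\Omega}\frac{|u(x)-u(y)|^p}{|x-y|^{n+sp}}\,dx\,dy\right)^{1/p}<\infty$, normed by $\|u\|_{s,p;\Omega}=(\|u\|_{L^p(\Omega)}^p+[u]_{s,p;\Omega}^p)^{1/p}$. When $\Omega=\mathbb{R}^n$ the set is omitted: $[u]_{s,p}$, $\|u\|_{s,p}$, $\|u\|_p$. An open set $\Omega$ is an extension domain for $W^{s,p}$ if there is $C=C(n,s,p,\Omega)>0$ such that every $u\in W^{s,p}(\Omega)$ has an extension $\tilde u\in W^{s,p}(\mathbb{R}^n)$ with $\tilde u=u$ on $\Omega$ and $\|\tilde u\|_{s,p}\le C\|u\|_{s,p;\Omega}$. $\widetilde W^{s,p}(\Omega)$ is the space of all $u\in W^{s,p}(\Omega)$ whose extension by zero outside $\Omega$ belongs to $W^{s,p}(\mathbb{R}^n)$, normed by the $W^{s,p}(\mathbb{R}^n)$ norm of the zero extension; such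 $u$ are always identified with their zero extension to $\mathbb{R}^n$. For $u,v\in W^{s,p}(\mathbb{R}^n)$ put $\mathcal{H}(u,v)=\frac12\iint_{\mathbb{R}^n\times\mathbb{R}^n}\frac{|u(x)-u(y)|^{p-2}(u(x)-u(y))(v(x)-v(y))}{|x-y|^{n+sp}}\,dx\,dy$. A number $\lambda\in\mathbb{R}$ is an eigenvalue (for the potential $V$) if there is a nontrivial $u\in\widetilde W^{s,p}(\Omega)$ (an eigenfunction associated to $\lambda$) with $\mathcal{H}(u,v)+\int_\Omega V|u|^{p-2}uv\,dx=\lambda\int_{\mathbb{R}^n}|u|^{p-2}uv\,dx$ for all $v\in\widetilde W^{s,p}(\Omega)$. $\lambda(V)=\inf\{\frac12[u]_{s,p}^p+\int_\Omega V|u|^p\,dx\colon u\in\widetilde W^{s,p}(\Omega),\ \|u\|_p=1\}$, which is the lowest eigenvalue. *)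

theory Defs
  imports "HOL-Analysis.Analysis"
begin

text \<open>
  Elements of Lebesgue and Sobolev spaces are represented by Lebesgue measurable functions, not by
  equivalence classes, and equality of such elements is equality almost everywhere.  A function on
  \<open>\<Omega>\<close> is a total function whose values outside \<open>\<Omega>\<close> are irrelevant.  The Bochner integral of a
  non-integrable function is 0 by convention, so finiteness is always stated through
  \<^const>\<open>integrable\<close>.
\<close>

definition Lp :: "real \<Rightarrow> (real^'n) set \<Rightarrow> ((real^'n) \<Rightarrow> real) set" where
  "Lp p \<Omega> = {u. u \<in> borel_measurable (lebesgue_on \<Omega>) \<and>
                integrable (lebesgue_on \<Omega>) (\<lambda>x. \<bar>u x\<bar> powr p)}"

definition Lp_norm :: "real \<Rightarrow> (real^'n) set \<Rightarrow> ((real^'n) \<Rightarrow> real) \<Rightarrow> real" where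
  "Lp_norm p \<Omega> u = (LINT x|lebesgue_on \<Omega>. \<bar>u x\<bar> powr p) powr (1 / p)"

text \<open>On the diagonal the integrands below take the value 0 (division by 0); the diagonal is a null set.\<close>

definition gagliardo_integrand ::
    "real \<Rightarrow> real \<Rightarrow> ((real^'n) \<Rightarrow> real) \<Rightarrow> (real^'n) \<times> (real^'n) \<Rightarrow> real" where
  "gagliardo_integrand s p u =
     (\<lambda>(x, y). \<bar>u x - u y\<bar> powr p / norm (x - y) powr (real CARD('n) + s * p))"

definition gagliardo ::
    "real \<Rightarrow> real \<Rightarrow> (real^'n) set \<Rightarrow> ((real^'n) \<Rightarrow> real) \<Rightarrow> real" where
  "gagliardo s p \<Omega> u =
     (LINT z|(lebesgue_on \<Omega> \<Otimes>\<^sub>M lebesgue_on \<Omega>). gagliardo_integrand s p u z) powr (1 / p)"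

definition Wsp :: "real \<Rightarrow> real \<Rightarrow> (real^'n) set \<Rightarrow> ((real^'n) \<Rightarrow> real) set" where
  "Wsp s p \<Omega> = {u \<in> Lp p \<Omega>.
     integrable (lebesgue_on \<Omega> \<Otimes>\<^sub>M lebesgue_on \<Omega>) (gagliardo_integrand s p u)}"

definition Wsp_norm ::
    "real \<Rightarrow> real \<Rightarrow> (real^'n) set \<Rightarrow> ((real^'n) \<Rightarrow> real) \<Rightarrow> real" where
  "Wsp_norm s p \<Omega> u = (Lp_norm p \<Omega> u powr p + gagliardo s p \<Omega> u powr p) powr (1 / p)"

definition extension_domain :: "real \<Rightarrow> real \<Rightarrow> (real^'n) set \<Rightarrow> bool" where
  "extension_domain s p \<Omega> \<longleftrightarrow> open \<Omega> \<and>
     (\<exists>C>0. \<forall>u\<in>Wsp s p \<Omega>. \<exists>u'\<in>Wsp s p UNIV.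
        (AE x in lebesgue_on \<Omega>. u' x = u x) \<and>
        Wsp_norm s p UNIV u' \<le> C * Wsp_norm s p \<Omega> u)"

definition zero_ext :: "(real^'n) set \<Rightarrow> ((real^'n) \<Rightarrow> real) \<Rightarrow> (real^'n) \<Rightarrow> real" where
  "zero_ext \<Omega> u = (\<lambda>x. if x \<in> \<Omega> then u x else 0)"

text \<open>The space \<open>W\<close>-tilde, whose elements are identified with their extensions by zero.\<close>

definition Wsp0 :: "real \<Rightarrow> real \<Rightarrow> (real^'n) set \<Rightarrow> ((real^'n) \<Rightarrow> real) set" where
  "Wsp0 s p \<Omega> = zero_ext \<Omega> ` {u \<in> Wsp s p \<Omega>. zero_ext \<Omega> u \<in> Wsp s p UNIV}"

definition H_form ::
    "real \<Rightarrow> real \<Rightarrow> ((real^'n) \<Rightarrow> real) \<Rightarrow> ((real^'n) \<Rightarrow> real) \<Rightarrow> real" where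
  "H_form s p u v = 1 / 2 *
     (LINT (x, y)|(lebesgue \<Otimes>\<^sub>M lebesgue).
        \<bar>u x - u y\<bar> powr (p - 2) * (u x - u y) * (v x - v y)
          / norm (x - y) powr (real CARD('n) + s * p))"

text \<open>
  For \<open>p < 2\<close> the expression \<open>\<bar>t\<bar> powr (p - 2) * t\<close> is 0 at \<open>t = 0\<close>, as intended.
\<close>

definition is_eigenfunction ::
    "real \<Rightarrow> real \<Rightarrow> (real^'n) set \<Rightarrow> ((real^'n) \<Rightarrow> real) \<Rightarrow> real \<Rightarrow> ((real^'n) \<Rightarrow> real) \<Rightarrow> bool" where
  "is_eigenfunction s p \<Omega> V \<mu> u \<longleftrightarrow>
     u \<in> Wsp0 s p \<Omega> \<and> \<not> (AE x in lebesgue. u x = 0) \<and>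
     (\<forall>v\<in>Wsp0 s p \<Omega>.
        H_form s p u v + (LINT x|lebesgue_on \<Omega>. V x * \<bar>u x\<bar> powr (p - 2) * u x * v x)
          = \<mu> * (LINT x|lebesgue. \<bar>u x\<bar> powr (p - 2) * u x * v x))"

definition is_eigenvalue ::
    "real \<Rightarrow> real \<Rightarrow> (real^'n) set \<Rightarrow> ((real^'n) \<Rightarrow> real) \<Rightarrow> real \<Rightarrow> bool" where
  "is_eigenvalue s p \<Omega> V \<mu> \<longleftrightarrow> (\<exists>u. is_eigenfunction s p \<Omega> V \<mu> u)"

definition first_eigenvalue ::
    "real \<Rightarrow> real \<Rightarrow> (real^'n) set \<Rightarrow> ((real^'n) \<Rightarrow> real) \<Rightarrow> real" where
  "first_eigenvalue s p \<Omega> V =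
     Inf {1 / 2 * gagliardo s p UNIV u powr p + (LINT x|lebesgue_on \<Omega>. V x * \<bar>u x\<bar> powr p)
          | u. u \<in> Wsp0 s p \<Omega> \<and> Lp_norm p UNIV u = 1}"

end

theory Submission
  imports Defs "HOL-Complex_Analysis.Great_Picard" "HOL-Probability.Probability_Measure"
begin

text \<open>
  Write \<open>E(u)\<close> for the energy \<open>[u]\<^sup>p / 2 + \<integral>V|u|\<^sup>p\<close> and \<open>\<lambda>\<close> for its infimum over admissible functions
  with \<open>\<integral>|u|\<^sup>p = 1\<close>.

  \<^bold>\<open>Analytic input.\<close>  Comparing \<open>u\<close> with its averages over dyadic cubes of side \<open>2\<^bsup>-j\<^esup>\<close> costs
  \<open>O(2\<^bsup>-jsp\<^esup> [u]\<^sup>p)\<close> in the integral of the \<open>p\<close>-th power (\<open>cell_avg_approx\<close>), while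
  the weight \<open>|V|\<close> costs at most a factor \<open>O(2\<^bsup>jn/q\<^esup>)\<close> on functions that are constant on such cubes
  (\<open>cell_weighted_le\<close>).  Since \<open>sp > n/q\<close>, telescoping over \<open>j\<close> gives
  \<open>\<integral>|V||u|\<^sup>p \<le> \<epsilon>[u]\<^sup>p + C\<^sub>\<epsilon>\<integral>|u|\<^sup>p\<close> for every \<open>\<epsilon> > 0\<close> (\<open>potential_bound\<close>), which takes
  the place of the Sobolev embedding.  The same averages give compactness: on a bounded set they are governed
  by countably many numbers, to which a diagonal argument applies (\<open>W0_compact\<close>).
  Hence every minimizing sequence has a subsequence converging almost everywhere to a minimizer
  (\<open>minimizing_sequence\<close>), and a minimizer is an eigenfunction for \<open>\<lambda>\<close>
  (\<open>minimizer_weak_solution\<close>).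

  \<^bold>\<open>Isolation.\<close>  No eigenvalue lies below \<open>\<lambda>\<close>.  An eigenfunction without change of sign belongs to \<open>\<lambda>\<close>,
  by testing the equation as in the Picone inequality (\<open>nonneg_solution_le_first\<close>).  If there
  were eigenvalues \<open>\<mu>\<^sub>k > \<lambda>\<close> with limit \<open>\<lambda>\<close>, their eigenfunctions \<open>u\<^sub>k\<close> would thus
  have nonzero positive and negative parts.  Testing the equation with these parts shows that both, once
  normalized, have energy at most \<open>\<mu>\<^sub>k\<close>, so they form two minimizing sequences.  Their limits \<open>f\<close>
  and \<open>g\<close> are nonnegative minimizers with \<open>fg = 0\<close> almost everywhere.  This is impossible
  (\<open>no_disjoint_minimizers\<close>): from \<open>|a - b|\<^sup>p < a\<^sup>p + b\<^sup>p\<close> for \<open>a, b > 0\<close>, the interaction between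
  the two supports gives \<open>E(f + g) < E(f) + E(g) = \<lambda>\<integral>|f + g|\<^sup>p\<close>.
\<close>

section \<open>Pointwise inequalities for powers\<close>

lemma powr_convex_nonneg:
  fixes p a b x y :: real
  assumes p: "1 \<le> p" and x: "0 \<le> x" and y: "0 \<le> y" and ab: "0 \<le> a" "0 \<le> b" "a + b = 1"
  shows "(a * x + b * y) powr p \<le> a * x powr p + b * y powr p"
proof -
  have sub: "(c * z) powr p \<le> c * z powr p" if "0 \<le> c" "c \<le> 1" "0 \<le> z" for c z :: real
  proof (cases "c = 0")
    case False
    have "c powr p \<le> c powr 1"
      using that p by (intro powr_mono') auto
    then have "c powr p * z powr p \<le> c * z powr p"
      using that False by (intro mult_right_mono) auto
    then show ?thesis
      using that by (simp add: powr_mult)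
  qed (use that in auto)
  have a: "a = 1 - b" using ab by simp
  consider "x = 0" | "y = 0" | "x > 0" "y > 0"
    using x y by fastforce
  then show ?thesis
  proof cases
    case 3
    then show ?thesis
      using convex_onD[OF powr_convex[OF p], of b x y] ab
      by (simp add: a)
  qed (use sub[of b y] sub[of a x] x y ab in auto)
qed

lemma convex_abs_powr:
  fixes p :: real
  assumes p: "1 \<le> p"
  shows "convex_on UNIV (\<lambda>x::real. \<bar>x\<bar> powr p)"
proof (rule convex_onI)
  fix t x y :: real
  assume t: "0 < t" "t < 1"
  have "\<bar>(1 - t) *\<^sub>R x + t *\<^sub>R y\<bar> powr p \<le> ((1 - t) * \<bar>x\<bar> + t * \<bar>y\<bar>) powr p"
    using t p by (intro powr_mono2) (auto intro!: order_trans[OF abs_triangle_ineq] simp: abs_mult)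
  also have "\<dots> \<le> (1 - t) * \<bar>x\<bar> powr p + t * \<bar>y\<bar> powr p"
    using t by (intro powr_convex_nonneg[OF p]) auto
  finally show "\<bar>(1 - t) *\<^sub>R x + t *\<^sub>R y\<bar> powr p \<le> (1 - t) * \<bar>x\<bar> powr p + t * \<bar>y\<bar> powr p" .
qed auto

lemma powr_add_le:
  fixes p a b :: real
  assumes "0 \<le> p" "0 \<le> a" "0 \<le> b"
  shows "(a + b) powr p \<le> 2 powr p * (a powr p + b powr p)"
proof -
  have "(a + b) powr p \<le> (2 * max a b) powr p"
    using assms by (intro powr_mono2) auto
  also have "\<dots> = 2 powr p * (max a b) powr p"
    using assms by (simp add: powr_mult)
  also have "\<dots> \<le> 2 powr p * (a powr p + b powr p)"
    by (intro mult_left_mono) (auto simp: max_def)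
  finally show ?thesis .
qed

lemma abs_powr_add_le:
  fixes p a b :: real
  assumes "0 \<le> p"
  shows "\<bar>a + b\<bar> powr p \<le> 2 powr p * (\<bar>a\<bar> powr p + \<bar>b\<bar> powr p)"
  by (rule order_trans[OF powr_mono2[OF assms _ abs_triangle_ineq] powr_add_le]) (use assms in auto)

lemma abs_powr_diff_le:
  fixes p a b :: real
  assumes "0 \<le> p"
  shows "\<bar>a - b\<bar> powr p \<le> 2 powr p * (\<bar>a\<bar> powr p + \<bar>b\<bar> powr p)"
  using abs_powr_add_le[OF assms, of a "-b"] by simp

lemma abs_powr_minus_two:
  fixes p t :: real
  shows "\<bar>t\<bar> powr (p - 2) * t * t = \<bar>t\<bar> powr p"
proof (cases "t = 0")
  case False
  have "\<bar>t\<bar> powr (p - 2) * t * t = \<bar>t\<bar> powr (p - 2) * \<bar>t\<bar> powr 2"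
    using False by (simp add: power2_eq_square mult.assoc)
  also have "\<dots> = \<bar>t\<bar> powr p"
    by (simp only: powr_add[symmetric]) simp
  finally show ?thesis .
qed auto

lemma abs_powr_abs_mult:
  fixes p t :: real
  shows "\<bar>t\<bar> powr (p - 2) * \<bar>t\<bar> = \<bar>t\<bar> powr (p - 1)"
proof (cases "t = 0")
  case False
  then have "\<bar>t\<bar> powr (p - 2) * \<bar>t\<bar> = \<bar>t\<bar> powr (p - 2) * \<bar>t\<bar> powr 1"
    by simp
  then show ?thesis by (simp only: powr_add[symmetric]) simp
qed auto

lemma abs_powr_has_real_derivative:
  fixes p a :: real
  assumes p: "1 < p"
  shows "((\<lambda>x. \<bar>x\<bar> powr p) has_real_derivative p * (\<bar>a\<bar> powr (p - 2) * a)) (at a)"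
proof (cases "a = 0")
  case True
  have "((\<lambda>h. \<bar>h\<bar> powr (p - 1)) \<longlongrightarrow> 0) (at 0)"
    using p tendsto_rabs[OF tendsto_ident_at, of 0 UNIV]
    by (intro tendsto_zero_powrI[where b = "p - 1"]) simp_all
  moreover have "\<bar>(\<bar>h\<bar> powr p) / h\<bar> = \<bar>h\<bar> powr (p - 1)" if "h \<noteq> 0" for h :: real
    using that by (simp add: powr_diff abs_divide)
  ultimately have "((\<lambda>h. \<bar>(\<bar>h\<bar> powr p) / h\<bar>) \<longlongrightarrow> 0) (at 0)"
    by (subst tendsto_cong[where g = "\<lambda>h. \<bar>h\<bar> powr (p - 1)"]) (auto simp: eventually_at_filter)
  then have "((\<lambda>h. (\<bar>h\<bar> powr p) / h) \<longlongrightarrow> 0) (at 0)"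
    by (rule tendsto_rabs_zero_cancel)
  then show ?thesis
    using True p by (simp add: DERIV_def)
next
  case False
  have "((\<lambda>x. \<bar>x\<bar>) has_real_derivative sgn a) (at a)"
  proof (cases "0 < a")
    case True
    then have "((\<lambda>x. x) has_real_derivative sgn a) (at a)"
      by simp
    then show ?thesis
      by (rule has_field_derivative_transform_within_open[where S = "{0<..}"]) (use True in auto)
  next
    case neg: False
    with False have "((\<lambda>x. - x) has_real_derivative sgn a) (at a)"
      by (auto intro!: derivative_eq_intros)
    then show ?thesis
      by (rule has_field_derivative_transform_within_open[where S = "{..<0}"]) (use neg False in auto)
  qed
  from DERIV_chain2[where f = "\<lambda>x. x powr p", OF has_real_derivative_powr this]
  have "((\<lambda>x. \<bar>x\<bar> powr p) has_real_derivative (p * \<bar>a\<bar> powr (p - 1) * sgn a)) (at a)"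
    using False by simp
  also have "p * \<bar>a\<bar> powr (p - 1) * sgn a = p * (\<bar>a\<bar> powr (p - 2) * a)"
  proof -
    have "\<bar>a\<bar> powr (p - 1) * sgn a = \<bar>a\<bar> powr (p - 2) * (\<bar>a\<bar> * sgn a)"
      using abs_powr_abs_mult[of a p] by (simp only: mult.assoc[symmetric])
    also have "\<bar>a\<bar> * sgn a = a" by (rule abs_mult_sgn)
    finally show ?thesis by simp
  qed
  finally show ?thesis .
qed

text \<open>The mean value theorem for \<open>\<bar>x\<bar>\<^sup>p\<close>, in a crude form that suffices for domination.\<close>

lemma abs_powr_increment_le:
  fixes p a b t :: real
  assumes p: "1 < p" and t: "0 < t" "t \<le> 1"
  shows "\<bar>\<bar>a + t * b\<bar> powr p - \<bar>a\<bar> powr p\<bar> \<le> t * (p * 2 powr p * (\<bar>a\<bar> powr p + \<bar>b\<bar> powr p))"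
proof -
  let ?M = "\<bar>a\<bar> + \<bar>b\<bar>"
  have *: "\<bar>p * (\<bar>x\<bar> powr (p - 2) * x)\<bar> \<le> p * ?M powr (p - 1)" if "x \<in> cball 0 ?M" for x
  proof -
    have "\<bar>p * (\<bar>x\<bar> powr (p - 2) * x)\<bar> = p * \<bar>x\<bar> powr (p - 1)"
      using p abs_powr_abs_mult[of x p] by (simp add: abs_mult)
    also have "\<dots> \<le> p * ?M powr (p - 1)"
      using p that by (intro mult_left_mono powr_mono2) auto
    finally show ?thesis .
  qed
  have "norm (\<bar>a + t * b\<bar> powr p - \<bar>a\<bar> powr p) \<le> (p * ?M powr (p - 1)) * norm ((a + t * b) - a)"
  proof (rule field_differentiable_bound[of "cball 0 ?M" "\<lambda>x. \<bar>x\<bar> powr p" "\<lambda>x. p * (\<bar>x\<bar> powr (p - 2) * x)"])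
    show "a + t * b \<in> cball 0 ?M"
    proof -
      have "\<bar>a + t * b\<bar> \<le> \<bar>a\<bar> + t * \<bar>b\<bar>"
        using abs_triangle_ineq[of a "t * b"] t by (simp add: abs_mult)
      also have "\<dots> \<le> ?M"
        using t mult_left_le_one_le[of "\<bar>b\<bar>" t] by simp
      finally show ?thesis by simp
    qed
  qed (use * in \<open>auto intro!: DERIV_subset[OF abs_powr_has_real_derivative[OF p]]\<close>)
  also have "\<dots> = t * (p * (?M powr (p - 1) * \<bar>b\<bar>))"
    using t by (simp add: abs_mult)
  also have "\<dots> \<le> t * (p * (?M powr (p - 1) * ?M))"
    using t p by (intro mult_left_mono) auto
  also have "?M powr (p - 1) * ?M = ?M powr p"
    by (cases "?M = 0") (auto simp: powr_diff)
  also have "t * (p * ?M powr p) \<le> t * (p * (2 powr p * (\<bar>a\<bar> powr p + \<bar>b\<bar> powr p)))"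
    using t p by (intro mult_left_mono powr_add_le) auto
  finally show ?thesis by (simp add: mult.assoc)
qed

lemma abs_powr_product_le:
  fixes p a b :: real
  assumes p: "1 < p"
  shows "\<bar>\<bar>a\<bar> powr (p - 2) * a * b\<bar> \<le> \<bar>a\<bar> powr p + \<bar>b\<bar> powr p"
proof -
  let ?m = "max \<bar>a\<bar> \<bar>b\<bar>"
  have "\<bar>\<bar>a\<bar> powr (p - 2) * a * b\<bar> = \<bar>a\<bar> powr (p - 1) * \<bar>b\<bar>"
    using abs_powr_abs_mult[of a p] by (simp add: abs_mult)
  also have "\<dots> \<le> ?m powr (p - 1) * ?m"
    using p by (intro mult_mono powr_mono2) auto
  also have "\<dots> = ?m powr p"
    by (cases "?m = 0") (auto simp: powr_diff)
  also have "\<dots> \<le> \<bar>a\<bar> powr p + \<bar>b\<bar> powr p"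
    by (auto simp: max_def)
  finally show ?thesis .
qed

lemma positive_part_le:
  fixes p a b :: real
  assumes p: "1 < p"
  shows "\<bar>max a 0 - max b 0\<bar> powr p \<le> \<bar>a - b\<bar> powr (p - 2) * (a - b) * (max a 0 - max b 0)"
proof -
  let ?d = "max a 0 - max b 0"
  have "\<bar>?d\<bar> powr p = \<bar>?d\<bar> powr (p - 1) * \<bar>?d\<bar>"
    by (cases "?d = 0") (auto simp: powr_diff)
  also have "\<dots> \<le> \<bar>a - b\<bar> powr (p - 1) * \<bar>?d\<bar>"
    using p by (intro mult_right_mono powr_mono2) auto
  also have "\<dots> = \<bar>a - b\<bar> powr (p - 2) * (\<bar>a - b\<bar> * \<bar>?d\<bar>)"
    using abs_powr_abs_mult[of "a - b" p] by simp
  also have "\<bar>a - b\<bar> * \<bar>?d\<bar> = (a - b) * ?d"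
    by (auto simp: max_def abs_if algebra_simps)
  finally show ?thesis by (simp add: mult.assoc)
qed

text \<open>The discrete Picone inequality for \<open>b \<le> a\<close>: with \<open>t = b / a\<close> it is convexity of the power applied to
  \<open>c \<le> |c - d| + d = (1 - t) (|c - d| / (1 - t)) + t (d / t)\<close>.\<close>

lemma picone_aux:
  fixes p a b c d :: real
  assumes p: "1 < p" and ab: "0 < b" "b \<le> a" and cd: "0 \<le> c" "0 \<le> d"
  shows "\<bar>a - b\<bar> powr (p - 2) * (a - b) * (c powr p / a powr (p - 1) - d powr p / b powr (p - 1))
           \<le> \<bar>c - d\<bar> powr p"
proof (cases "a = b")
  case False
  then have ab': "b < a" "0 < a" using ab by auto
  define t where "t = b / a"
  have t: "0 < t" "t < 1" "b = t * a" using ab ab' by (auto simp: t_def)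
  have "c powr p \<le> ((1 - t) * (\<bar>c - d\<bar> / (1 - t)) + t * (d / t)) powr p"
    using t cd p by (intro powr_mono2) auto
  also have "\<dots> \<le> (1 - t) * (\<bar>c - d\<bar> / (1 - t)) powr p + t * (d / t) powr p"
    using t cd p by (intro powr_convex_nonneg) auto
  also have "(1 - t) * (\<bar>c - d\<bar> / (1 - t)) powr p = \<bar>c - d\<bar> powr p / (1 - t) powr (p - 1)"
    using t by (simp add: powr_divide powr_diff)
  also have "t * (d / t) powr p = d powr p / t powr (p - 1)"
    using t cd by (simp add: powr_divide powr_diff)
  finally have "c powr p - d powr p / t powr (p - 1) \<le> \<bar>c - d\<bar> powr p / (1 - t) powr (p - 1)"
    by simp
  then have "(1 - t) powr (p - 1) * (c powr p - d powr p / t powr (p - 1)) \<le> \<bar>c - d\<bar> powr p"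
    using t by (simp add: pos_le_divide_eq mult.commute)
  moreover have "\<bar>a - b\<bar> powr (p - 2) * (a - b) = (1 - t) powr (p - 1) * a powr (p - 1)"
  proof -
    have "a - b = (1 - t) * a" using t by (simp add: algebra_simps)
    then have "(a - b) powr (p - 1) = (1 - t) powr (p - 1) * a powr (p - 1)"
      by (simp only: powr_mult)
    then show ?thesis
      using abs_powr_abs_mult[of "a - b" p] ab' by simp
  qed
  moreover have "a powr (p - 1) * (c powr p / a powr (p - 1) - d powr p / b powr (p - 1))
      = c powr p - d powr p / t powr (p - 1)"
  proof -
    have "b powr (p - 1) = t powr (p - 1) * a powr (p - 1)"
      unfolding t(3) by (rule powr_mult)
    moreover have "a powr (p - 1) \<noteq> 0" "t powr (p - 1) \<noteq> 0" using ab' t by auto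
    ultimately show ?thesis by (simp add: right_diff_distrib)
  qed
  ultimately show ?thesis
    by (simp only: mult.assoc)
qed auto

lemma picone_pointwise:
  fixes p a b c d :: real
  assumes p: "1 < p" and ab: "0 < a" "0 < b" and cd: "0 \<le> c" "0 \<le> d"
  shows "\<bar>a - b\<bar> powr (p - 2) * (a - b) * (c powr p / a powr (p - 1) - d powr p / b powr (p - 1))
           \<le> \<bar>c - d\<bar> powr p"
proof (cases "b \<le> a")
  case True
  then show ?thesis using picone_aux assms by blast
next
  case False
  have "\<bar>a - b\<bar> powr (p - 2) * (a - b) * (c powr p / a powr (p - 1) - d powr p / b powr (p - 1))
      = \<bar>b - a\<bar> powr (p - 2) * (b - a) * (d powr p / b powr (p - 1) - c powr p / a powr (p - 1))"
    by (simp add: abs_minus_commute algebra_simps)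
  also have "\<dots> \<le> \<bar>d - c\<bar> powr p" using picone_aux[of p a b d c] False assms by auto
  finally show ?thesis by (simp add: abs_minus_commute)
qed

text \<open>Here \<open>a, b\<close> and \<open>c, d\<close> stand for the values at two points of two nonnegative functions with disjoint
  supports.  The inequality is strict if the two points lie in different supports.\<close>

lemma disjoint_supports_le:
  fixes p a b c d :: real
  assumes p: "0 < p" and nn: "0 \<le> a" "0 \<le> b" "0 \<le> c" "0 \<le> d" and dis: "a * c = 0" "b * d = 0"
  shows "\<bar>(a + c) - (b + d)\<bar> powr p \<le> \<bar>a - b\<bar> powr p + \<bar>c - d\<bar> powr p"
    and "\<lbrakk>0 < a; 0 < d\<rbrakk> \<Longrightarrow> \<bar>(a + c) - (b + d)\<bar> powr p < \<bar>a - b\<bar> powr p + \<bar>c - d\<bar> powr p"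
proof -
  have 1: "\<bar>x - y\<bar> powr p < x powr p + y powr p" if "0 < x" "0 < y" for x y :: real
  proof -
    have "\<bar>x - y\<bar> powr p \<le> (max x y) powr p" using that p by (intro powr_mono2) auto
    also have "\<dots> < x powr p + y powr p" using that by (auto simp: max_def)
    finally show ?thesis .
  qed
  show "\<bar>(a + c) - (b + d)\<bar> powr p \<le> \<bar>a - b\<bar> powr p + \<bar>c - d\<bar> powr p"
  proof -
    consider "a = 0" "b = 0" | "c = 0" "d = 0" | "a = 0" "d = 0" "0 < b" "0 < c" | "c = 0" "b = 0" "0 < a" "0 < d"
      using dis nn by fastforce
    then show ?thesis
    proof cases
      case 3
      then show ?thesis using 1[of c b] by simp
    next
      case 4
      then show ?thesis using 1[of a d] by simp
    qed auto
  qed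
  show "\<bar>(a + c) - (b + d)\<bar> powr p < \<bar>a - b\<bar> powr p + \<bar>c - d\<bar> powr p" if "0 < a" "0 < d"
    using that dis 1[of a d] by auto
qed

lemma powr_diff_Lipschitz:
  fixes p M c d :: real
  assumes p: "1 < p" and cd: "0 \<le> c" "c \<le> M" "0 \<le> d" "d \<le> M"
  shows "\<bar>c powr p - d powr p\<bar> \<le> p * M powr (p - 1) * \<bar>c - d\<bar>"
proof -
  have "norm (\<bar>c\<bar> powr p - \<bar>d\<bar> powr p) \<le> (p * M powr (p - 1)) * norm (c - d)"
  proof (rule field_differentiable_bound[of "{0..M}" "\<lambda>x. \<bar>x\<bar> powr p" "\<lambda>x. p * (\<bar>x\<bar> powr (p - 2) * x)"])
    fix x assume x: "x \<in> {0..M}"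
    then show "norm (p * (\<bar>x\<bar> powr (p - 2) * x)) \<le> p * M powr (p - 1)"
      using p abs_powr_abs_mult[of x p] by (auto simp: abs_mult intro!: powr_mono2)
    show "((\<lambda>x. \<bar>x\<bar> powr p) has_real_derivative p * (\<bar>x\<bar> powr (p - 2) * x)) (at x within {0..M})"
      by (rule DERIV_subset[OF abs_powr_has_real_derivative[OF p]]) simp
  qed (use cd in auto)
  then show ?thesis using cd by simp
qed

lemma powr_neg_diff_Lipschitz:
  fixes p \<delta> a b :: real
  assumes p: "1 < p" and \<delta>: "0 < \<delta>" and ab: "\<delta> \<le> a" "\<delta> \<le> b"
  shows "\<bar>1 / a powr (p - 1) - 1 / b powr (p - 1)\<bar> \<le> (p - 1) / \<delta> powr p * \<bar>a - b\<bar>"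
proof -
  have "norm (a powr (1 - p) - b powr (1 - p)) \<le> ((p - 1) * \<delta> powr (- p)) * norm (a - b)"
  proof (rule field_differentiable_bound[of "{\<delta>..}" "\<lambda>x. x powr (1 - p)" "\<lambda>x. (1 - p) * x powr (1 - p - 1)"])
    fix x assume x: "x \<in> {\<delta>..}"
    then show "((\<lambda>x. x powr (1 - p)) has_real_derivative (1 - p) * x powr (1 - p - 1)) (at x within {\<delta>..})"
      using \<delta> by (intro DERIV_subset[OF has_real_derivative_powr]) auto
    have "x powr (- p) \<le> \<delta> powr (- p)"
      using x \<delta> p by (intro powr_mono2') auto
    then show "norm ((1 - p) * x powr (1 - p - 1)) \<le> (p - 1) * \<delta> powr (- p)"
      using p by (auto simp: abs_mult)
  qed (use ab in auto)
  moreover have "x powr (1 - p) = 1 / x powr (p - 1)" for x :: real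
    using powr_minus_divide[of x "p - 1"] by simp
  ultimately show ?thesis by (simp add: powr_minus_divide)
qed

section \<open>Integrals of powers\<close>

lemma sigma_finite_lebesgue: "sigma_finite_measure (lebesgue :: 'a::euclidean_space measure)"
proof
  obtain A :: "'a set set" where A: "countable A" "A \<subseteq> sets lborel" "\<Union>A = space lborel"
    "\<forall>a\<in>A. emeasure lborel a \<noteq> \<infinity>"
    using lborel.sigma_finite_countable by metis
  have "emeasure lebesgue a \<noteq> \<infinity>" if "a \<in> A" for a
    using A(2,4) that emeasure_completion[of a lborel] by auto
  moreover have "A \<subseteq> sets lebesgue"
    using A(2) by auto
  ultimately have "A \<subseteq> sets lebesgue" "\<forall>a\<in>A. emeasure lebesgue a \<noteq> \<infinity>"
    by auto
  with A show "\<exists>A. countable A \<and> A \<subseteq> sets lebesgue \<and> \<Union>A = space (lebesgue :: 'a measure) \<and>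
      (\<forall>a\<in>A. emeasure lebesgue a \<noteq> \<infinity>)"
    by (intro exI[of _ A]) auto
qed

interpretation leb: sigma_finite_measure "lebesgue :: 'a::euclidean_space measure"
  by (rule sigma_finite_lebesgue)

text \<open>The product of Lebesgue measure with itself, which is not the (complete) Lebesgue measure on pairs.\<close>

abbreviation leb2 :: "('a::euclidean_space \<times> 'a) measure" where
  "leb2 \<equiv> lebesgue \<Otimes>\<^sub>M lebesgue"

interpretation leb2: pair_sigma_finite "lebesgue :: 'a::euclidean_space measure" "lebesgue :: 'a measure" ..

lemma measurable_id_lebesgue [measurable]: "(\<lambda>x. x) \<in> borel_measurable (lebesgue :: 'a::euclidean_space measure)"
  by (rule measurable_completion) simp

lemma borel_measurable_fst_leb2: "fst \<in> borel_measurable (leb2 :: ('a::euclidean_space \<times> 'a) measure)"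
  using measurable_compose[OF measurable_fst measurable_id_lebesgue] by simp

lemma borel_measurable_snd_leb2: "snd \<in> borel_measurable (leb2 :: ('a::euclidean_space \<times> 'a) measure)"
  using measurable_compose[OF measurable_snd measurable_id_lebesgue] by simp

text \<open>An almost everywhere property holds at both components of almost every pair.\<close>

lemma AE_leb2I:
  assumes "AE x in (lebesgue :: 'a::euclidean_space measure). P x"
  shows "AE z in (leb2 :: ('a \<times> 'a) measure). P (fst z) \<and> P (snd z)"
proof -
  obtain N where N: "N \<in> null_sets lebesgue" "{x. \<not> P x} \<subseteq> N"
    using assms by (auto simp: eventually_ae_filter)
  have "N \<times> UNIV \<in> null_sets leb2" "UNIV \<times> N \<in> null_sets leb2"
    using N(1) leb.times_in_null_sets2[of N lebesgue UNIV] leb.times_in_null_sets1[of UNIV lebesgue N] by auto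
  then have "N \<times> UNIV \<union> UNIV \<times> N \<in> null_sets leb2"
    by (rule null_sets.Un)
  then show ?thesis
    by (rule AE_I') (use N(2) in auto)
qed

text \<open>The derivative of \<open>t \<mapsto> \<integral>|f + tg|\<^sup>p w\<close> at \<open>0\<close>, along \<open>t = 1/(n+1)\<close> only, which is all that the
  first variation of the energy needs.  The weight \<open>w\<close> may change sign.\<close>

lemma gateaux_integral:
  fixes f g w :: "'a \<Rightarrow> real"
  assumes p: "1 < p"
    and [measurable]: "f \<in> borel_measurable M" "g \<in> borel_measurable M" "w \<in> borel_measurable M"
    and f: "integrable M (\<lambda>x. \<bar>f x\<bar> powr p * w x)" and g: "integrable M (\<lambda>x. \<bar>g x\<bar> powr p * w x)"
  shows "integrable M (\<lambda>x. \<bar>f x\<bar> powr (p - 2) * f x * g x * w x)"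
    and "(\<lambda>n. ((LINT x|M. \<bar>f x + 1 / real (Suc n) * g x\<bar> powr p * w x) - (LINT x|M. \<bar>f x\<bar> powr p * w x))
            / (1 / real (Suc n)))
          \<longlonglongrightarrow> p * (LINT x|M. \<bar>f x\<bar> powr (p - 2) * f x * g x * w x)"
proof -
  have dom: "integrable M (\<lambda>x. C * (\<bar>\<bar>f x\<bar> powr p * w x\<bar> + \<bar>\<bar>g x\<bar> powr p * w x\<bar>))" for C
    using f g by auto
  have m: "m * \<bar>w x\<bar> \<le> C * (\<bar>\<bar>f x\<bar> powr p * w x\<bar> + \<bar>\<bar>g x\<bar> powr p * w x\<bar>)"
    if "m \<le> C * (\<bar>f x\<bar> powr p + \<bar>g x\<bar> powr p)" for m C x
    using mult_right_mono[OF that, of "\<bar>w x\<bar>"] by (simp add: abs_mult algebra_simps)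
  show int: "integrable M (\<lambda>x. \<bar>f x\<bar> powr (p - 2) * f x * g x * w x)"
  proof (rule Bochner_Integration.integrable_bound[OF dom[of 1]])
    show "AE x in M. norm (\<bar>f x\<bar> powr (p - 2) * f x * g x * w x)
        \<le> norm (1 * (\<bar>\<bar>f x\<bar> powr p * w x\<bar> + \<bar>\<bar>g x\<bar> powr p * w x\<bar>))"
    proof (rule AE_I2)
      fix x
      show "norm (\<bar>f x\<bar> powr (p - 2) * f x * g x * w x)
        \<le> norm (1 * (\<bar>\<bar>f x\<bar> powr p * w x\<bar> + \<bar>\<bar>g x\<bar> powr p * w x\<bar>))"
        using m[of "\<bar>\<bar>f x\<bar> powr (p - 2) * f x * g x\<bar>" 1 x] abs_powr_product_le[OF p, of "f x" "g x"]
        by (simp add: abs_mult)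
    qed
  qed measurable
  let ?t = "\<lambda>n. 1 / real (Suc n)"
  \<comment> \<open>The difference quotients are dominated, uniformly in \<open>n\<close>.\<close>
  let ?q = "\<lambda>n x. (\<bar>f x + ?t n * g x\<bar> powr p - \<bar>f x\<bar> powr p) / ?t n * w x"
  have q_le: "\<bar>?q n x\<bar> \<le> p * 2 powr p * (\<bar>\<bar>f x\<bar> powr p * w x\<bar> + \<bar>\<bar>g x\<bar> powr p * w x\<bar>)" for n x
  proof -
    have "\<bar>(\<bar>f x + ?t n * g x\<bar> powr p - \<bar>f x\<bar> powr p) / ?t n\<bar> \<le> p * 2 powr p * (\<bar>f x\<bar> powr p + \<bar>g x\<bar> powr p)"
      using abs_powr_increment_le[OF p, of "?t n" "f x" "g x"]
      by (simp add: abs_mult pos_le_divide_eq mult.commute del: of_nat_Suc)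
    from m[OF this] show ?thesis by (simp add: abs_mult)
  qed
  have lim: "(\<lambda>n. ?q n x) \<longlonglongrightarrow> p * (\<bar>f x\<bar> powr (p - 2) * f x * g x * w x)" for x
  proof -
    have "((\<lambda>t. \<bar>f x + t * g x\<bar> powr p) has_real_derivative (p * (\<bar>f x\<bar> powr (p - 2) * f x)) * g x) (at 0)"
    proof (rule DERIV_chain2[where f = "\<lambda>y. \<bar>y\<bar> powr p"])
      show "((\<lambda>y. \<bar>y\<bar> powr p) has_real_derivative p * (\<bar>f x\<bar> powr (p - 2) * f x)) (at (f x + 0 * g x))"
        using abs_powr_has_real_derivative[OF p, of "f x"] by simp
      show "((\<lambda>t. f x + t * g x) has_real_derivative g x) (at 0)"
        by (auto intro!: derivative_eq_intros)
    qed
    then have "((\<lambda>t. (\<bar>f x + t * g x\<bar> powr p - \<bar>f x\<bar> powr p) / t) \<longlongrightarrow> (p * (\<bar>f x\<bar> powr (p - 2) * f x)) * g x) (at 0)"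
      by (simp add: DERIV_def)
    moreover have "filterlim ?t (at 0) sequentially"
      using LIMSEQ_inverse_real_of_nat by (auto simp: filterlim_at inverse_eq_divide)
    ultimately have "(\<lambda>n. (\<bar>f x + ?t n * g x\<bar> powr p - \<bar>f x\<bar> powr p) / ?t n) \<longlonglongrightarrow> (p * (\<bar>f x\<bar> powr (p - 2) * f x)) * g x"
      by (rule filterlim_compose)
    from tendsto_mult_right[OF this, of "w x"] show ?thesis by (simp add: mult.assoc)
  qed
  have "(\<lambda>n. LINT x|M. ?q n x) \<longlonglongrightarrow> (LINT x|M. p * (\<bar>f x\<bar> powr (p - 2) * f x * g x * w x))"
    by (rule integral_dominated_convergence[OF _ _ dom[of "p * 2 powr p"]])
      (use lim q_le in \<open>auto simp del: of_nat_Suc\<close>)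
  moreover have "(LINT x|M. ?q n x) = ((LINT x|M. \<bar>f x + ?t n * g x\<bar> powr p * w x) - (LINT x|M. \<bar>f x\<bar> powr p * w x)) / ?t n" for n
  proof -
    have "integrable M (?q n)"
    proof (rule Bochner_Integration.integrable_bound[OF dom[of "p * 2 powr p"]])
      show "?q n \<in> borel_measurable M" by measurable
      show "AE x in M. norm (?q n x) \<le> norm (p * 2 powr p * (\<bar>\<bar>f x\<bar> powr p * w x\<bar> + \<bar>\<bar>g x\<bar> powr p * w x\<bar>))"
        unfolding real_norm_def by (rule AE_I2, rule order_trans[OF q_le abs_ge_self])
    qed
    then have "integrable M (\<lambda>x. ?t n * ?q n x + \<bar>f x\<bar> powr p * w x)"
      by (intro Bochner_Integration.integrable_add integrable_mult_right f)
    moreover have "?t n * ?q n x + \<bar>f x\<bar> powr p * w x = \<bar>f x + ?t n * g x\<bar> powr p * w x" for x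
      by (simp add: algebra_simps del: of_nat_Suc)
    ultimately have "integrable M (\<lambda>x. \<bar>f x + ?t n * g x\<bar> powr p * w x)"
      by simp
    with f have "(LINT x|M. (\<bar>f x + ?t n * g x\<bar> powr p * w x - \<bar>f x\<bar> powr p * w x) / ?t n)
      = ((LINT x|M. \<bar>f x + ?t n * g x\<bar> powr p * w x) - (LINT x|M. \<bar>f x\<bar> powr p * w x)) / ?t n"
      by (simp only: integral_divide_zero Bochner_Integration.integral_diff)
    moreover have "?q n x = (\<bar>f x + ?t n * g x\<bar> powr p * w x - \<bar>f x\<bar> powr p * w x) / ?t n" for x
      by (simp add: left_diff_distrib right_diff_distrib mult_ac del: of_nat_Suc)
    ultimately show ?thesis
      by (simp only:)
  qed
  ultimately show "(\<lambda>n. ((LINT x|M. \<bar>f x + 1 / real (Suc n) * g x\<bar> powr p * w x) - (LINT x|M. \<bar>f x\<bar> powr p * w x))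
            / (1 / real (Suc n)))
          \<longlonglongrightarrow> p * (LINT x|M. \<bar>f x\<bar> powr (p - 2) * f x * g x * w x)"
    by (simp only: integral_mult_right_zero)
qed

lemma fatou_integral:
  fixes f :: "nat \<Rightarrow> 'a \<Rightarrow> real"
  assumes [measurable]: "g \<in> borel_measurable M"
    and int: "\<And>n. integrable M (f n)" and nn: "\<And>n x. 0 \<le> f n x"
    and lim: "AE x in M. (\<lambda>n. f n x) \<longlonglongrightarrow> g x"
    and bound: "\<forall>\<^sub>F n in sequentially. (LINT x|M. f n x) \<le> C"
  shows "integrable M g" and "(LINT x|M. g x) \<le> C"
proof -
  have [measurable]: "f n \<in> borel_measurable M" for n
    using int by auto
  have g0: "AE x in M. 0 \<le> g x"
    using lim by eventually_elim (use nn in \<open>auto intro: LIMSEQ_le_const\<close>)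
  have C: "0 \<le> C"
  proof -
    obtain n where "(LINT x|M. f n x) \<le> C"
      using bound by (auto simp: eventually_sequentially)
    moreover have "0 \<le> (LINT x|M. f n x)"
      using nn by simp
    ultimately show ?thesis by simp
  qed
  have "(\<integral>\<^sup>+x. ennreal (g x) \<partial>M) = (\<integral>\<^sup>+x. liminf (\<lambda>n. ennreal (f n x)) \<partial>M)"
  proof (rule nn_integral_cong_AE)
    show "AE x in M. ennreal (g x) = liminf (\<lambda>n. ennreal (f n x))"
      using lim by eventually_elim (auto intro!: lim_imp_Liminf[symmetric] tendsto_ennrealI)
  qed
  also have "\<dots> \<le> liminf (\<lambda>n. \<integral>\<^sup>+x. ennreal (f n x) \<partial>M)"
    by (rule nn_integral_liminf) auto
  also have "\<dots> \<le> liminf (\<lambda>n::nat. ennreal C)"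
  proof (rule Liminf_mono)
    show "\<forall>\<^sub>F n in sequentially. (\<integral>\<^sup>+x. ennreal (f n x) \<partial>M) \<le> ennreal C"
      using bound by eventually_elim (subst nn_integral_eq_integral[OF int], auto simp: nn intro: ennreal_leI)
  qed
  finally have le: "(\<integral>\<^sup>+x. ennreal (g x) \<partial>M) \<le> ennreal C"
    by (simp add: Liminf_const)
  show "integrable M g"
  proof (rule integrableI_nonneg[OF _ g0])
    show "(\<integral>\<^sup>+x. ennreal (g x) \<partial>M) < \<infinity>"
      using le by (auto intro: order_le_less_trans)
  qed auto
  then show "(LINT x|M. g x) \<le> C"
    using le C by (simp add: nn_integral_eq_integral[OF _ g0])
qed

lemma jensen_abs_powr:
  fixes f w :: "'a \<Rightarrow> real"
  assumes p: "1 \<le> p"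
    and [measurable]: "f \<in> borel_measurable M" "w \<in> borel_measurable M"
    and w: "\<And>x. 0 \<le> w x" "(\<integral>\<^sup>+x. ennreal (w x) \<partial>M) = 1"
    and int: "integrable M (\<lambda>x. w x * \<bar>f x\<bar> powr p)"
  shows "integrable M (\<lambda>x. w x * f x)"
    and "\<bar>LINT x|M. w x * f x\<bar> powr p \<le> (LINT x|M. w x * \<bar>f x\<bar> powr p)"
proof -
  let ?D = "density M (\<lambda>x. ennreal (w x))"
  interpret D: prob_space ?D
    by (rule prob_spaceI) (use w in \<open>simp add: emeasure_density cong: nn_integral_cong\<close>)
  have i1: "integrable ?D (\<lambda>x. \<bar>f x\<bar> powr p)"
    using int w by (subst integrable_density) auto
  have "integrable ?D (\<lambda>x. 1 + \<bar>f x\<bar> powr p)"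
    using i1 by auto
  then have i2: "integrable ?D f"
  proof (rule Bochner_Integration.integrable_bound)
    have "\<bar>t\<bar> \<le> 1 + \<bar>t\<bar> powr p" for t :: real
    proof (cases "\<bar>t\<bar> \<le> 1")
      case False
      then have "\<bar>t\<bar> powr 1 \<le> \<bar>t\<bar> powr p"
        using p by (intro powr_mono) auto
      then show ?thesis using False by simp
    qed (auto intro: add_increasing2)
    then show "AE x in ?D. norm (f x) \<le> norm (1 + \<bar>f x\<bar> powr p)"
      by auto
  qed simp
  then show "integrable M (\<lambda>x. w x * f x)"
    using w by (subst (asm) integrable_density) auto
  have "\<bar>D.expectation f\<bar> powr p \<le> D.expectation (\<lambda>x. \<bar>f x\<bar> powr p)"
    by (rule D.jensens_inequality[where q = "\<lambda>t. \<bar>t\<bar> powr p" and I = UNIV])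
      (use i1 i2 convex_abs_powr[OF p] in auto)
  moreover have "D.expectation f = (LINT x|M. w x * f x)"
    using w by (subst integral_density) auto
  moreover have "D.expectation (\<lambda>x. \<bar>f x\<bar> powr p) = (LINT x|M. w x * \<bar>f x\<bar> powr p)"
    using w by (subst integral_density) auto
  ultimately show "\<bar>LINT x|M. w x * f x\<bar> powr p \<le> (LINT x|M. w x * \<bar>f x\<bar> powr p)"
    by simp
qed

text \<open>Convergence in the weighted \<open>p\<close>-th power mean carries over to the integrals of the \<open>p\<close>-th powers.  The
  weight may change sign.\<close>

lemma tendsto_integral_abs_powr:
  fixes u :: "nat \<Rightarrow> 'a \<Rightarrow> real"
  assumes p: "1 < p"
    and u: "\<And>k. integrable M (\<lambda>x. \<bar>u k x\<bar> powr p * w x)"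
    and f: "integrable M (\<lambda>x. \<bar>f x\<bar> powr p * w x)"
    and d: "\<And>k. integrable M (\<lambda>x. \<bar>u k x - f x\<bar> powr p * w x)"
    and lim: "(\<lambda>k. LINT x|M. \<bar>u k x - f x\<bar> powr p * \<bar>w x\<bar>) \<longlonglongrightarrow> 0"
  shows "(\<lambda>k. LINT x|M. \<bar>u k x\<bar> powr p * w x) \<longlonglongrightarrow> (LINT x|M. \<bar>f x\<bar> powr p * w x)"
proof (rule LIMSEQ_I)
  fix e :: real assume e: "0 < e"
  define F where "F = (LINT x|M. \<bar>f x\<bar> powr p * \<bar>w x\<bar>)"
  let ?d = "\<lambda>k. LINT x|M. \<bar>u k x - f x\<bar> powr p * \<bar>w x\<bar>"
  have abs: "integrable M (\<lambda>x. \<bar>g x\<bar> powr p * \<bar>w x\<bar>)" if "integrable M (\<lambda>x. \<bar>g x\<bar> powr p * w x)" for g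
    using integrable_abs[OF that] by (simp add: abs_mult)
  have F: "0 \<le> F" by (simp add: F_def)
  define C where "C = p * 2 powr p"
  have C: "0 < C" using p by (simp add: C_def)
  \<comment> \<open>Write \<open>u k = f + \<tau> ((u k - f) / \<tau>)\<close>: a small \<open>\<tau>\<close> makes the contribution of \<open>f\<close> small, and then a large \<open>k\<close> that of \<open>u k - f\<close>.\<close>
  define \<tau> where "\<tau> = min 1 (e / (2 * C * (F + 1)))"
  have \<tau>: "0 < \<tau>" "\<tau> \<le> 1"
  proof -
    have "0 < F + 1" using F by linarith
    then have "0 < e / (2 * C * (F + 1))"
      using e C by (intro divide_pos_pos mult_pos_pos) (assumption | simp)+
    then show "0 < \<tau>" "\<tau> \<le> 1" by (simp_all add: \<tau>_def)
  qed
  have "\<tau> \<le> e / (2 * C * (F + 1))" by (simp add: \<tau>_def)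
  then have "\<tau> * (2 * C * (F + 1)) \<le> e"
    using C F by (subst (asm) pos_le_divide_eq) auto
  moreover have "\<tau> * C * F < \<tau> * C * (F + 1)"
    using \<tau> C by simp
  ultimately have 1: "\<tau> * C * F < e / 2"
    by (simp add: algebra_simps)
  have "\<forall>\<^sub>F k in sequentially. ?d k < e / 2 / (\<tau> * C / \<tau> powr p)"
    using lim e \<tau> C by (intro order_tendstoD(2)) auto
  then obtain N where N: "\<And>k. N \<le> k \<Longrightarrow> ?d k < e / 2 / (\<tau> * C / \<tau> powr p)"
    by (auto simp: eventually_sequentially)
  have "norm ((LINT x|M. \<bar>u k x\<bar> powr p * w x) - (LINT x|M. \<bar>f x\<bar> powr p * w x)) < e" if k: "N \<le> k" for k
  proof -
    have pt: "\<bar>\<bar>u k x\<bar> powr p * w x - \<bar>f x\<bar> powr p * w x\<bar>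
      \<le> \<tau> * C * (\<bar>f x\<bar> powr p * \<bar>w x\<bar>) + \<tau> * C / \<tau> powr p * (\<bar>u k x - f x\<bar> powr p * \<bar>w x\<bar>)" for x
    proof -
      have "\<bar>\<bar>f x + \<tau> * ((u k x - f x) / \<tau>)\<bar> powr p - \<bar>f x\<bar> powr p\<bar>
        \<le> \<tau> * (C * (\<bar>f x\<bar> powr p + \<bar>(u k x - f x) / \<tau>\<bar> powr p))"
        unfolding C_def by (rule abs_powr_increment_le[OF p \<tau>])
      then have "\<bar>\<bar>u k x\<bar> powr p - \<bar>f x\<bar> powr p\<bar> \<le> \<tau> * (C * (\<bar>f x\<bar> powr p + \<bar>u k x - f x\<bar> powr p / \<tau> powr p))"
        using \<tau> by (simp add: powr_divide abs_divide)
      then have "\<bar>\<bar>u k x\<bar> powr p - \<bar>f x\<bar> powr p\<bar> * \<bar>w x\<bar>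
          \<le> \<tau> * (C * (\<bar>f x\<bar> powr p + \<bar>u k x - f x\<bar> powr p / \<tau> powr p)) * \<bar>w x\<bar>"
        by (rule mult_right_mono) simp
      then show ?thesis
        by (simp add: abs_mult[symmetric] left_diff_distrib ring_distribs mult_ac)
    qed
    have "norm ((LINT x|M. \<bar>u k x\<bar> powr p * w x) - (LINT x|M. \<bar>f x\<bar> powr p * w x))
      = \<bar>LINT x|M. \<bar>u k x\<bar> powr p * w x - \<bar>f x\<bar> powr p * w x\<bar>"
      using u f by simp
    also have "\<dots> \<le> (LINT x|M. \<bar>\<bar>u k x\<bar> powr p * w x - \<bar>f x\<bar> powr p * w x\<bar>)"
      by (rule integral_abs_bound)
    also have "\<dots> \<le> (LINT x|M. \<tau> * C * (\<bar>f x\<bar> powr p * \<bar>w x\<bar>) + \<tau> * C / \<tau> powr p * (\<bar>u k x - f x\<bar> powr p * \<bar>w x\<bar>))"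
      by (intro integral_mono pt integrable_abs Bochner_Integration.integrable_diff Bochner_Integration.integrable_add
          integrable_mult_right u f abs d)
    also have "\<dots> = \<tau> * C * F + \<tau> * C / \<tau> powr p * ?d k"
      using abs[OF f] abs[OF d] by (simp add: F_def)
    also have "\<dots> < e / 2 + e / 2"
    proof (rule add_strict_mono[OF 1])
      show "\<tau> * C / \<tau> powr p * ?d k < e / 2"
        using N[OF k] \<tau> C by (subst (asm) pos_less_divide_eq) (auto simp: mult_ac)
    qed
    finally show ?thesis by simp
  qed
  then show "\<exists>N. \<forall>k\<ge>N. norm ((LINT x|M. \<bar>u k x\<bar> powr p * w x) - (LINT x|M. \<bar>f x\<bar> powr p * w x)) < e"
    by blast
qed

section \<open>The function space and the energy\<close>

text \<open>The kernel \<open>|x - y|\<^bsup>-(n+a)\<^esup>\<close>, with the value \<open>0\<close> on the diagonal.\<close>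

definition frac_kernel :: "real \<Rightarrow> (real^'n) \<times> (real^'n) \<Rightarrow> real" where
  "frac_kernel a z = 1 / norm (fst z - snd z) powr (real CARD('n) + a)"

lemma frac_kernel_nonneg [simp]: "0 \<le> frac_kernel a z"
  by (simp add: frac_kernel_def)

lemma frac_kernel_pos: "fst z \<noteq> snd z \<Longrightarrow> 0 < frac_kernel a z"
  by (simp add: frac_kernel_def)

lemma frac_kernel_measurable [measurable]:
  "frac_kernel a \<in> borel_measurable (leb2 :: ((real^'n) \<times> (real^'n)) measure)"
proof -
  note [measurable] = borel_measurable_fst_leb2[where 'a = "real^'n"] borel_measurable_snd_leb2[where 'a = "real^'n"]
  have "(\<lambda>z::(real^'n) \<times> (real^'n). fst z - snd z) \<in> borel_measurable leb2"
    by (rule borel_measurable_diff) measurable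
  then have "(\<lambda>z::(real^'n) \<times> (real^'n). norm (fst z - snd z)) \<in> borel_measurable leb2"
    by (rule measurable_compose) measurable
  then show ?thesis
    unfolding frac_kernel_def by measurable
qed

text \<open>The setting of the theorem, with the potential extended by zero to the whole space, so that all integrals
  can be taken over the whole space.\<close>

locale frac_schroedinger =
  fixes \<Omega> :: "(real^'n) set" and V :: "(real^'n) \<Rightarrow> real" and s p q :: real
  assumes s: "0 < s" "s < 1" and p: "1 < p"
    and \<Omega>: "open \<Omega>" "bounded \<Omega>" "\<Omega> \<noteq> {}"
    and q: "1 < q" "real CARD('n) / (s * p) < q"
    and V_meas [measurable]: "V \<in> borel_measurable lebesgue"
    and V_out: "\<And>x. x \<notin> \<Omega> \<Longrightarrow> V x = 0"
    and V_int: "integrable lebesgue (\<lambda>x. \<bar>V x\<bar> powr q)"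
begin

abbreviation K :: "(real^'n) \<times> (real^'n) \<Rightarrow> real" where
  "K \<equiv> frac_kernel (s * p)"

text \<open>The integrand of the \<open>p\<close>-th power of the Gagliardo seminorm.\<close>

abbreviation increment :: "((real^'n) \<Rightarrow> real) \<Rightarrow> (real^'n) \<times> (real^'n) \<Rightarrow> real" where
  "increment u z \<equiv> \<bar>u (fst z) - u (snd z)\<bar> powr p * K z"

text \<open>The \<open>p\<close>-th power of the \<open>L\<^sup>p\<close> norm.\<close>

definition mass :: "((real^'n) \<Rightarrow> real) \<Rightarrow> real" where
  "mass u = (LINT x|lebesgue. \<bar>u x\<bar> powr p)"

text \<open>The \<open>p\<close>-th power of the Gagliardo seminorm over the whole space.\<close>

definition seminorm :: "((real^'n) \<Rightarrow> real) \<Rightarrow> real" where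
  "seminorm u = (LINT z|leb2. increment u z)"

text \<open>The potential part of the energy.\<close>

definition potential :: "((real^'n) \<Rightarrow> real) \<Rightarrow> real" where
  "potential u = (LINT x|lebesgue. \<bar>u x\<bar> powr p * V x)"

text \<open>The functional whose infimum over normalized admissible functions is the lowest eigenvalue.\<close>

definition energy :: "((real^'n) \<Rightarrow> real) \<Rightarrow> real" where
  "energy u = seminorm u / 2 + potential u"

text \<open>The admissible functions: fractional Sobolev functions on the whole space that vanish outside \<open>\<Omega>\<close>.\<close>

definition W0 :: "((real^'n) \<Rightarrow> real) set" where
  "W0 = {u \<in> borel_measurable lebesgue. (\<forall>x. x \<notin> \<Omega> \<longrightarrow> u x = 0) \<and>
     integrable lebesgue (\<lambda>x. \<bar>u x\<bar> powr p) \<and>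
     integrable leb2 (\<lambda>z. increment u z)}"

lemma W0D:
  assumes "u \<in> W0"
  shows W0_measurable: "u \<in> borel_measurable lebesgue"
    and W0_outside: "x \<notin> \<Omega> \<Longrightarrow> u x = 0"
    and W0_mass: "integrable lebesgue (\<lambda>x. \<bar>u x\<bar> powr p)"
    and W0_seminorm: "integrable leb2 (\<lambda>z. increment u z)"
  using assms by (auto simp: W0_def)

lemma mass_nonneg: "0 \<le> mass u" and seminorm_nonneg: "0 \<le> seminorm u"
  by (auto simp: mass_def seminorm_def)

lemma Omega_sets [measurable]: "\<Omega> \<in> sets lebesgue"
  using \<Omega>(1) by (simp add: borel_open sets_completionI_sets)

text \<open>Stability of the admissible functions under operations that are controlled by values and increments of
  admissible functions: this covers linear combinations, truncations and the Picone test functions.\<close>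

lemma W0_dominated:
  assumes u: "u \<in> W0" and w: "w \<in> W0" and C: "0 \<le> C"
    and [measurable]: "v \<in> borel_measurable lebesgue"
    and bound: "\<And>x. \<bar>v x\<bar> \<le> C * (\<bar>u x\<bar> + \<bar>w x\<bar>)"
    and diff: "\<And>x y. \<bar>v x - v y\<bar> \<le> C * (\<bar>u x - u y\<bar> + \<bar>w x - w y\<bar>)"
  shows "v \<in> W0"
proof -
  note [measurable] = W0_measurable[OF u] W0_measurable[OF w]
  have *: "\<bar>c\<bar> powr p \<le> C powr p * 2 powr p * (\<bar>a\<bar> powr p + \<bar>b\<bar> powr p)"
    if "\<bar>c\<bar> \<le> C * (\<bar>a\<bar> + \<bar>b\<bar>)" for a b c
  proof -
    have "\<bar>c\<bar> powr p \<le> (C * (\<bar>a\<bar> + \<bar>b\<bar>)) powr p"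
      using that p by (intro powr_mono2) auto
    also have "\<dots> = C powr p * (\<bar>a\<bar> + \<bar>b\<bar>) powr p" by (rule powr_mult)
    also have "\<dots> \<le> C powr p * (2 powr p * (\<bar>a\<bar> powr p + \<bar>b\<bar> powr p))"
      using p by (intro mult_left_mono powr_add_le) auto
    finally show ?thesis by (simp add: mult.assoc)
  qed
  have 0: "v x = 0" if "x \<notin> \<Omega>" for x
    using bound[of x] W0_outside[OF u that] W0_outside[OF w that] by simp
  have 1: "integrable lebesgue (\<lambda>x. \<bar>v x\<bar> powr p)"
    by (rule Bochner_Integration.integrable_bound[where f = "\<lambda>x. C powr p * 2 powr p * (\<bar>u x\<bar> powr p + \<bar>w x\<bar> powr p)"])
      (use W0_mass[OF u] W0_mass[OF w] *[OF bound] in auto)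
  have 2: "\<bar>v x - v y\<bar> powr p * K z
    \<le> C powr p * 2 powr p * (\<bar>u x - u y\<bar> powr p * K z + \<bar>w x - w y\<bar> powr p * K z)" for x y z
    using mult_right_mono[OF *[OF diff[of x y]], of "K z"] by (simp add: algebra_simps)
  have 3: "integrable leb2 (\<lambda>z. increment v z)"
    by (rule Bochner_Integration.integrable_bound[where f = "\<lambda>z. C powr p * 2 powr p *
         (increment u z + increment w z)"])
      (use W0_seminorm[OF u] W0_seminorm[OF w] 2 in auto)
  show ?thesis
    using 0 1 3 by (auto simp: W0_def)
qed

lemma W0_add_scaled:
  assumes u: "u \<in> W0" and w: "w \<in> W0"
  shows "(\<lambda>x. a * u x + b * w x) \<in> W0"
proof (rule W0_dominated[OF u w, of "\<bar>a\<bar> + \<bar>b\<bar>"])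
  note [measurable] = W0_measurable[OF u] W0_measurable[OF w]
  show "(\<lambda>x. a * u x + b * w x) \<in> borel_measurable lebesgue" by measurable
  have *: "\<bar>a * c + b * d\<bar> \<le> (\<bar>a\<bar> + \<bar>b\<bar>) * (\<bar>c\<bar> + \<bar>d\<bar>)" for c d
  proof -
    have "\<bar>a * c + b * d\<bar> \<le> \<bar>a\<bar> * \<bar>c\<bar> + \<bar>b\<bar> * \<bar>d\<bar>"
      using abs_triangle_ineq[of "a * c" "b * d"] by (simp add: abs_mult)
    also have "\<dots> \<le> (\<bar>a\<bar> + \<bar>b\<bar>) * (\<bar>c\<bar> + \<bar>d\<bar>)"
      by (simp add: algebra_simps)
    finally show ?thesis .
  qed
  show "\<bar>a * u x + b * w x\<bar> \<le> (\<bar>a\<bar> + \<bar>b\<bar>) * (\<bar>u x\<bar> + \<bar>w x\<bar>)" for x by (rule *)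
  show "\<bar>(a * u x + b * w x) - (a * u y + b * w y)\<bar> \<le> (\<bar>a\<bar> + \<bar>b\<bar>) * (\<bar>u x - u y\<bar> + \<bar>w x - w y\<bar>)" for x y
    using *[of "u x - u y" "w x - w y"] by (simp add: algebra_simps)
qed auto

lemma W0_scale: "u \<in> W0 \<Longrightarrow> (\<lambda>x. a * u x) \<in> W0"
  using W0_add_scaled[of u u a 0] by simp

lemma W0_uminus: "u \<in> W0 \<Longrightarrow> (\<lambda>x. - u x) \<in> W0"
  using W0_scale[of u "-1"] by simp

lemma W0_add: "u \<in> W0 \<Longrightarrow> w \<in> W0 \<Longrightarrow> (\<lambda>x. u x + w x) \<in> W0"
  using W0_add_scaled[of u w 1 1] by simp

lemma W0_diff: "u \<in> W0 \<Longrightarrow> w \<in> W0 \<Longrightarrow> (\<lambda>x. u x - w x) \<in> W0"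
  using W0_add_scaled[of u w 1 "-1"] by simp

lemma W0_contraction:
  assumes u: "u \<in> W0" and [measurable]: "\<phi> \<in> borel_measurable borel" and "\<phi> 0 = 0"
    and lip: "\<And>a b::real. \<bar>\<phi> a - \<phi> b\<bar> \<le> \<bar>a - b\<bar>"
  shows "(\<lambda>x. \<phi> (u x)) \<in> W0"
proof (rule W0_dominated[OF u u, of 1])
  note [measurable] = W0_measurable[OF u]
  show "(\<lambda>x. \<phi> (u x)) \<in> borel_measurable lebesgue" by measurable
  show "\<bar>\<phi> (u x)\<bar> \<le> 1 * (\<bar>u x\<bar> + \<bar>u x\<bar>)" for x
    using lip[of "u x" 0] \<open>\<phi> 0 = 0\<close> by simp
  show "\<bar>\<phi> (u x) - \<phi> (u y)\<bar> \<le> 1 * (\<bar>u x - u y\<bar> + \<bar>u x - u y\<bar>)" for x y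
  proof (rule order_trans[OF lip])
    have "t \<le> 1 * (t + t)" if "0 \<le> t" for t :: real
      using that by simp
    then show "\<bar>u x - u y\<bar> \<le> 1 * (\<bar>u x - u y\<bar> + \<bar>u x - u y\<bar>)"
      using abs_ge_zero by blast
  qed
qed auto

lemma seminorm_contraction_le:
  assumes u: "u \<in> W0" and v: "v \<in> W0" and lip: "\<And>x y. \<bar>v x - v y\<bar> \<le> \<bar>u x - u y\<bar>"
  shows "seminorm v \<le> seminorm u"
  unfolding seminorm_def
  by (rule integral_mono[OF W0_seminorm[OF v] W0_seminorm[OF u]])
    (use lip p in \<open>auto intro!: mult_right_mono powr_mono2\<close>)

lemma mass_scale: "mass (\<lambda>x. a * u x) = \<bar>a\<bar> powr p * mass u"
  by (simp add: mass_def abs_mult powr_mult)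

lemma seminorm_scale: "seminorm (\<lambda>x. a * u x) = \<bar>a\<bar> powr p * seminorm u"
proof -
  have "\<bar>a * u x - a * u y\<bar> powr p * k = \<bar>a\<bar> powr p * (\<bar>u x - u y\<bar> powr p * k)" for x y k
    by (simp add: right_diff_distrib[symmetric] abs_mult powr_mult)
  then show ?thesis unfolding seminorm_def by (simp only: integral_mult_right_zero)
qed

lemma potential_scale: "potential (\<lambda>x. a * u x) = \<bar>a\<bar> powr p * potential u"
  by (simp add: potential_def abs_mult powr_mult mult.assoc)

lemma energy_scale: "energy (\<lambda>x. a * u x) = \<bar>a\<bar> powr p * energy u"
  by (simp add: energy_def seminorm_scale potential_scale algebra_simps)

lemma mass_eq_0_iff:
  assumes "u \<in> W0"
  shows "mass u = 0 \<longleftrightarrow> (AE x in lebesgue. u x = 0)"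
  unfolding mass_def
  by (subst integral_nonneg_eq_0_iff_AE[OF W0_mass[OF assms]]) auto

end

section \<open>Averages over dyadic cubes\<close>

text \<open>The index of the half-open dyadic cube of side \<open>2\<^bsup>-j\<^esup>\<close> that contains \<open>x\<close>.\<close>

definition cell :: "nat \<Rightarrow> real^'n \<Rightarrow> int^'n" where
  "cell j x = (\<chi> i. \<lfloor>2 ^ j * x $ i\<rfloor>)"

lemma cell_Suc_eq:
  assumes "cell (Suc j) x = cell (Suc j) y"
  shows "cell j x = cell j y"
proof -
  have *: "\<lfloor>2 ^ j * t\<rfloor> = \<lfloor>2 ^ Suc j * t\<rfloor> div 2" for t :: real
    using floor_divide_real_eq_div[of 2 "2 ^ Suc j * t"] by (simp add: mult.commute)
  show ?thesis
    using assms by (simp add: cell_def vec_eq_iff *)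
qed

lemma cell_eq_imp_norm_le:
  fixes x y :: "real^'n"
  assumes "cell j x = cell j y"
  shows "norm (x - y) \<le> real CARD('n) / 2 ^ j"
proof -
  have "\<bar>x $ i - y $ i\<bar> \<le> 1 / 2 ^ j" for i
  proof -
    have "\<lfloor>2 ^ j * x $ i\<rfloor> = \<lfloor>2 ^ j * y $ i\<rfloor>"
      using assms by (simp add: cell_def vec_eq_iff)
    then have "\<bar>2 ^ j * x $ i - 2 ^ j * y $ i\<bar> \<le> 1"
      by linarith
    then have "2 ^ j * \<bar>x $ i - y $ i\<bar> \<le> 1"
      by (simp add: right_diff_distrib[symmetric] abs_mult)
    then show ?thesis
      by (simp add: field_simps)
  qed
  then have "(\<Sum>i\<in>UNIV. \<bar>(x - y) $ i\<bar>) \<le> (\<Sum>i\<in>(UNIV::'n set). 1 / 2 ^ j)"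
    by (intro sum_mono) simp
  then show ?thesis
    using norm_le_l1_cart[of "x - y"] by simp
qed

lemma cell_representative: "cell j (\<chi> i. of_int (z $ i) / 2 ^ j) = z"
  by (simp add: cell_def vec_eq_iff)

lemma cell_eq_sets [measurable]: "{y. cell j y = z} \<in> sets borel" for z :: "int^'n"
proof -
  have "{y. cell j y = z} = {y \<in> space borel. \<forall>i. \<lfloor>2 ^ j * y $ i\<rfloor> = z $ i}"
    by (auto simp: cell_def vec_eq_iff)
  also have "\<dots> \<in> sets borel"
    by measurable
  finally show ?thesis .
qed

lemma emeasure_cell:
  fixes z :: "int^'n"
  shows "emeasure lebesgue {y. cell j y = z} = ennreal (1 / 2 ^ (j * CARD('n)))"
proof -
  let ?S = "{y. cell j y = z}"
  define a :: "real^'n" where "a = (\<chi> i. of_int (z $ i) / 2 ^ j)"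
  define b :: "real^'n" where "b = (\<chi> i. (of_int (z $ i) + 1) / 2 ^ j)"
  have diff: "(b - a) \<bullet> v = 1 / 2 ^ j" if "v \<in> Basis" for v
    using that by (auto simp: Basis_vec_def inner_axis a_def b_def diff_divide_distrib[symmetric])
  then have le: "a \<bullet> v \<le> b \<bullet> v" if "v \<in> Basis" for v
    using that diff[OF that] by (simp add: inner_diff_left) (smt (verit) zero_le_divide_1_iff zero_le_power)
  have prod: "(\<Prod>v\<in>Basis. (b - a) \<bullet> v) = 1 / 2 ^ (j * CARD('n))"
    using diff by (simp add: power_divide power_mult)
  have iff: "cell j y = z \<longleftrightarrow> (\<forall>i. a $ i \<le> y $ i \<and> y $ i < b $ i)" for y
    by (simp add: cell_def vec_eq_iff floor_eq_iff a_def b_def field_simps)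
  \<comment> \<open>The half-open cube lies between an open and a closed box of the same volume.\<close>
  have "emeasure lborel (box a b) \<le> emeasure lborel ?S"
    by (intro emeasure_mono) (auto simp: iff mem_box_cart less_imp_le)
  moreover have "emeasure lborel ?S \<le> emeasure lborel (cbox a b)"
    by (intro emeasure_mono) (auto simp: iff mem_box_cart less_imp_le)
  ultimately have "emeasure lborel ?S = ennreal (1 / 2 ^ (j * CARD('n)))"
    using le prod by (simp add: emeasure_lborel_box emeasure_lborel_cbox)
  then show ?thesis
    by (subst emeasure_completion) auto
qed

text \<open>The averaging kernel over dyadic cubes of generation \<open>j\<close>, in dimension \<open>n\<close>: it is \<open>2\<^bsup>jn\<^esup>\<close> if
  both points lie in the same cube and \<open>0\<close> otherwise.\<close>

definition cell_kernel :: "nat \<Rightarrow> (real^'n) \<times> (real^'n) \<Rightarrow> real" where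
  "cell_kernel j z = (if cell j (fst z) = cell j (snd z) then 2 ^ (j * CARD('n)) else 0)"

lemma cell_kernel_nonneg [simp]: "0 \<le> cell_kernel j z"
  by (simp add: cell_kernel_def)

lemma cell_kernel_commute: "cell_kernel j (x, y) = cell_kernel j (y, x)"
  by (auto simp: cell_kernel_def)

lemma cell_kernel_measurable [measurable]:
  "cell_kernel j \<in> borel_measurable (leb2 :: ((real^'n) \<times> (real^'n)) measure)"
proof -
  note [measurable] = borel_measurable_fst_leb2[where 'a = "real^'n"] borel_measurable_snd_leb2[where 'a = "real^'n"]
  have 1: "(\<lambda>z::(real^'n) \<times> (real^'n). fst z $ i) \<in> borel_measurable leb2" for i
    by (rule measurable_compose[OF borel_measurable_fst_leb2]) measurable
  have 2: "(\<lambda>z::(real^'n) \<times> (real^'n). snd z $ i) \<in> borel_measurable leb2" for i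
    by (rule measurable_compose[OF borel_measurable_snd_leb2]) measurable
  note [measurable] = 1 2
  have "Measurable.pred (leb2 :: ((real^'n) \<times> (real^'n)) measure)
      (\<lambda>z. \<forall>i. \<lfloor>2 ^ j * fst z $ i\<rfloor> = \<lfloor>2 ^ j * snd z $ i\<rfloor>)"
    by measurable
  then have [measurable]: "Measurable.pred (leb2 :: ((real^'n) \<times> (real^'n)) measure) (\<lambda>z. cell j (fst z) = cell j (snd z))"
    by (simp add: cell_def vec_eq_iff)
  show ?thesis
    unfolding cell_kernel_def by measurable
qed

lemma cell_kernel_measurable_snd [measurable]:
  "(\<lambda>y. cell_kernel j (x, y)) \<in> borel_measurable lebesgue"
  by (rule measurable_compose[OF _ cell_kernel_measurable]) simp

lemma nn_integral_cell_kernel: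
  fixes x :: "real^'n"
  shows "(\<integral>\<^sup>+y. ennreal (cell_kernel j (x, y)) \<partial>lebesgue) = 1"
proof -
  have "(\<integral>\<^sup>+y. ennreal (cell_kernel j (x, y)) \<partial>lebesgue)
      = (\<integral>\<^sup>+y. ennreal (2 ^ (j * CARD('n))) * indicator {y. cell j y = cell j x} y \<partial>lebesgue)"
    by (rule nn_integral_cong) (auto simp: cell_kernel_def indicator_def)
  also have "\<dots> = ennreal (2 ^ (j * CARD('n))) * ennreal (1 / 2 ^ (j * CARD('n)))"
    by (subst nn_integral_cmult_indicator) (auto simp: emeasure_cell)
  also have "\<dots> = 1"
    by (simp add: ennreal_mult[symmetric] del: ennreal_power)
  finally show ?thesis .
qed

text \<open>The mean value of \<open>u\<close> over the dyadic cube of generation \<open>j\<close> that contains \<open>x\<close>.\<close>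

definition cell_avg :: "nat \<Rightarrow> ((real^'n) \<Rightarrow> real) \<Rightarrow> (real^'n) \<Rightarrow> real" where
  "cell_avg j u x = (LINT y|lebesgue. cell_kernel j (x, y) * u y)"

lemma cell_avg_cong: "cell j x = cell j y \<Longrightarrow> cell_avg j u x = cell_avg j u y"
  by (simp add: cell_avg_def cell_kernel_def)

lemma cell_avg_measurable [measurable]:
  assumes [measurable]: "u \<in> borel_measurable lebesgue"
  shows "cell_avg j u \<in> borel_measurable lebesgue"
  unfolding cell_avg_def by measurable

lemma cell_avg_jensen:
  fixes u :: "(real^'n) \<Rightarrow> real"
  assumes p: "1 \<le> p" and [measurable]: "u \<in> borel_measurable lebesgue"
    and int: "integrable lebesgue (\<lambda>x. \<bar>u x\<bar> powr p)"
  shows "integrable lebesgue (\<lambda>y. cell_kernel j (x, y) * \<bar>u y - c\<bar> powr p)"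
    and "\<bar>cell_avg j u x - c\<bar> powr p \<le> (LINT y|lebesgue. cell_kernel j (x, y) * \<bar>u y - c\<bar> powr p)"
proof -
  let ?w = "\<lambda>y. cell_kernel j (x, y)"
  have w: "integrable lebesgue ?w"
    by (rule integrableI_nonneg) (auto simp: nn_integral_cell_kernel)
  have w1: "(LINT y|lebesgue. ?w y) = 1"
    by (subst integral_eq_nn_integral) (auto simp: nn_integral_cell_kernel)
  have le: "?w y \<le> 2 ^ (j * CARD('n))" for y
    by (simp add: cell_kernel_def)
  have wu: "integrable lebesgue (\<lambda>y. ?w y * \<bar>u y - d\<bar> powr p)" for d
  proof (rule Bochner_Integration.integrable_bound[where
        f = "\<lambda>y. 2 powr p * (2 ^ (j * CARD('n)) * \<bar>u y\<bar> powr p + ?w y * \<bar>d\<bar> powr p)"])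
    show "integrable lebesgue (\<lambda>y. 2 powr p * (2 ^ (j * CARD('n)) * \<bar>u y\<bar> powr p + ?w y * \<bar>d\<bar> powr p))"
      using int w by auto
    have "?w y * \<bar>u y - d\<bar> powr p \<le> 2 powr p * (2 ^ (j * CARD('n)) * \<bar>u y\<bar> powr p + ?w y * \<bar>d\<bar> powr p)" for y
    proof -
      have "?w y * \<bar>u y - d\<bar> powr p \<le> ?w y * (2 powr p * (\<bar>u y\<bar> powr p + \<bar>d\<bar> powr p))"
        using p by (intro mult_left_mono abs_powr_diff_le) auto
      also have "\<dots> = 2 powr p * (?w y * \<bar>u y\<bar> powr p + ?w y * \<bar>d\<bar> powr p)"
        by (simp add: algebra_simps)
      also have "\<dots> \<le> 2 powr p * (2 ^ (j * CARD('n)) * \<bar>u y\<bar> powr p + ?w y * \<bar>d\<bar> powr p)"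
        using le by (intro mult_left_mono add_right_mono mult_right_mono) auto
      finally show ?thesis .
    qed
    then show "AE y in lebesgue. norm (?w y * \<bar>u y - d\<bar> powr p)
        \<le> norm (2 powr p * (2 ^ (j * CARD('n)) * \<bar>u y\<bar> powr p + ?w y * \<bar>d\<bar> powr p))"
      by (auto intro!: AE_I2 order_trans[OF _ abs_ge_self])
  qed measurable
  show "integrable lebesgue (\<lambda>y. ?w y * \<bar>u y - c\<bar> powr p)" by (rule wu)
  have wi: "integrable lebesgue (\<lambda>y. ?w y * u y)"
    using jensen_abs_powr(1)[OF p _ _ _ nn_integral_cell_kernel, of u j x] wu[of 0] by simp
  have "(LINT y|lebesgue. ?w y * (u y - c)) = cell_avg j u x - c"
    using wi w w1 by (simp add: cell_avg_def right_diff_distrib)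
  then show "\<bar>cell_avg j u x - c\<bar> powr p \<le> (LINT y|lebesgue. ?w y * \<bar>u y - c\<bar> powr p)"
    using jensen_abs_powr(2)[OF p _ _ _ nn_integral_cell_kernel, of "\<lambda>y. u y - c" j x] wu[of c] by simp
qed

lemma cell_avg_bound:
  fixes u :: "(real^'n) \<Rightarrow> real"
  assumes p: "1 \<le> p" and [measurable]: "u \<in> borel_measurable lebesgue"
    and int: "integrable lebesgue (\<lambda>x. \<bar>u x\<bar> powr p)"
  shows "\<bar>cell_avg j u x\<bar> powr p \<le> 2 ^ (j * CARD('n)) * (LINT x|lebesgue. \<bar>u x\<bar> powr p)"
proof -
  have "\<bar>cell_avg j u x\<bar> powr p \<le> (LINT y|lebesgue. cell_kernel j (x, y) * \<bar>u y\<bar> powr p)"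
    using cell_avg_jensen(2)[OF assms, of j x 0] by simp
  also have "\<dots> \<le> (LINT y|lebesgue. 2 ^ (j * CARD('n)) * \<bar>u y\<bar> powr p)"
    using cell_avg_jensen(1)[OF assms, of j x 0] int
    by (intro integral_mono) (auto simp: cell_kernel_def)
  finally show ?thesis by simp
qed

text \<open>Points of the same cube have distance at most \<open>n 2\<^bsup>-j\<^esup>\<close>; so averaging over cubes is controlled by the
  singular kernel, with a gain of \<open>2\<^bsup>-ja\<^esup>\<close>.\<close>

lemma cell_kernel_le_frac_kernel:
  fixes z :: "(real^'n) \<times> (real^'n)"
  assumes a: "0 < a" and ne: "fst z \<noteq> snd z"
  shows "cell_kernel j z \<le> real CARD('n) powr (real CARD('n) + a) * 2 powr (- (real j * a)) * frac_kernel a z"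
proof (cases "cell j (fst z) = cell j (snd z)")
  case True
  let ?n = "real CARD('n)"
  have le: "norm (fst z - snd z) powr (?n + a) \<le> (?n / 2 ^ j) powr (?n + a)"
    using cell_eq_imp_norm_le[OF True] a by (intro powr_mono2) auto
  have "(?n / 2 ^ j) powr (?n + a) = ?n powr (?n + a) / 2 powr (real j * (?n + a))"
    by (simp add: powr_divide powr_realpow[symmetric] powr_powr)
  also have "\<dots> = ?n powr (?n + a) * 2 powr (- (real j * a)) / 2 ^ (j * CARD('n))"
    by (simp add: powr_realpow[symmetric] powr_add ring_distribs powr_minus field_simps)
  finally have "2 ^ (j * CARD('n)) * norm (fst z - snd z) powr (?n + a) \<le> ?n powr (?n + a) * 2 powr (- (real j * a))"
    using mult_left_mono[OF le, of "2 ^ (j * CARD('n))"] by simp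
  then show ?thesis
    using True ne by (simp add: cell_kernel_def frac_kernel_def field_simps)
qed (auto simp: cell_kernel_def)

text \<open>A geometrically weighted version of Hoelder's inequality: each term is at most \<open>\<rho>\<^sup>i\<close> times the
  \<open>1/p\<close>-th power of the sum on the right.\<close>

lemma powr_sum_le:
  fixes a :: "nat \<Rightarrow> real"
  assumes p: "1 \<le> p" and \<rho>: "0 < \<rho>" "\<rho> < 1" and a: "\<And>i. 0 \<le> a i"
  shows "(\<Sum>i<m. a i) powr p \<le> (1 / (1 - \<rho>)) powr p * (\<Sum>i<m. a i powr p / (\<rho> powr p) ^ i)"
proof -
  define S where "S = (\<Sum>i<m. a i powr p / (\<rho> powr p) ^ i)"
  have S: "0 \<le> S" unfolding S_def by (intro sum_nonneg) auto
  have le: "a i \<le> \<rho> ^ i * S powr (1 / p)" if "i < m" for i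
  proof -
    have "a i powr p / (\<rho> powr p) ^ i \<le> S"
      unfolding S_def by (rule member_le_sum) (use that in auto)
    then have "a i powr p \<le> (\<rho> powr p) ^ i * S"
      using \<rho> by (simp add: field_simps)
    then have "(a i powr p) powr (1 / p) \<le> ((\<rho> powr p) ^ i * S) powr (1 / p)"
      using p by (intro powr_mono2) auto
    also have "(\<rho> powr p) ^ i = (\<rho> ^ i) powr p"
      using \<rho> by (simp add: powr_realpow[symmetric] powr_powr mult.commute)
    finally show ?thesis
      using p a \<rho> by (simp add: powr_powr powr_mult)
  qed
  have "(\<Sum>i<m. a i) \<le> (\<Sum>i<m. \<rho> ^ i) * S powr (1 / p)"
    unfolding sum_distrib_right by (rule sum_mono) (use le in auto)
  also have "\<dots> \<le> (1 / (1 - \<rho>)) * S powr (1 / p)"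
  proof (rule mult_right_mono)
    have "(\<Sum>i<m. \<rho> ^ i) \<le> (\<Sum>i. \<rho> ^ i)"
      using \<rho> by (intro sum_le_suminf) auto
    then show "(\<Sum>i<m. \<rho> ^ i) \<le> 1 / (1 - \<rho>)"
      using \<rho> by (simp add: suminf_geometric)
  qed auto
  finally have "(\<Sum>i<m. a i) powr p \<le> ((1 / (1 - \<rho>)) * S powr (1 / p)) powr p"
    using p a by (intro powr_mono2 sum_nonneg) auto
  also have "\<dots> = (1 / (1 - \<rho>)) powr p * S"
    unfolding powr_mult using p S by (simp add: powr_powr)
  finally show ?thesis unfolding S_def .
qed

section \<open>The potential is form bounded with relative bound zero\<close>

context frac_schroedinger
begin

text \<open>The constant in the approximation estimate by dyadic averages.\<close>

definition approx_const :: real where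
  "approx_const = real CARD('n) powr (real CARD('n) + s * p)"

lemma cell_avg_approx:
  assumes u: "u \<in> W0"
  shows "integrable lebesgue (\<lambda>x. \<bar>cell_avg j u x - u x\<bar> powr p)"
    and "(LINT x|lebesgue. \<bar>cell_avg j u x - u x\<bar> powr p) \<le> approx_const * 2 powr (- (real j * (s * p))) * seminorm u"
proof -
  note [measurable] = W0_measurable[OF u]
  let ?C = "approx_const * 2 powr (- (real j * (s * p)))"
  have C: "0 \<le> ?C" by (simp add: approx_const_def)
  note J = cell_avg_jensen[OF less_imp_le[OF p] W0_measurable[OF u] W0_mass[OF u], where j = j]
  have "(\<integral>\<^sup>+x. ennreal (\<bar>cell_avg j u x - u x\<bar> powr p) \<partial>lebesgue)
      \<le> (\<integral>\<^sup>+x. \<integral>\<^sup>+y. ennreal (cell_kernel j (x, y) * \<bar>u y - u x\<bar> powr p) \<partial>lebesgue \<partial>lebesgue)"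
  proof (rule nn_integral_mono)
    fix x
    have "(\<integral>\<^sup>+y. ennreal (cell_kernel j (x, y) * \<bar>u y - u x\<bar> powr p) \<partial>lebesgue)
      = ennreal (LINT y|lebesgue. cell_kernel j (x, y) * \<bar>u y - u x\<bar> powr p)"
      by (rule nn_integral_eq_integral[OF J(1)]) auto
    then show "ennreal (\<bar>cell_avg j u x - u x\<bar> powr p)
        \<le> (\<integral>\<^sup>+y. ennreal (cell_kernel j (x, y) * \<bar>u y - u x\<bar> powr p) \<partial>lebesgue)"
      using J(2)[of x "u x"] by (simp add: ennreal_leI)
  qed
  also have "\<dots> = (\<integral>\<^sup>+z. ennreal (cell_kernel j z * \<bar>u (snd z) - u (fst z)\<bar> powr p) \<partial>leb2)"
    using leb.nn_integral_fst[of "\<lambda>z. ennreal (cell_kernel j z * \<bar>u (snd z) - u (fst z)\<bar> powr p)" lebesgue]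
    by simp
  also have "\<dots> \<le> (\<integral>\<^sup>+z. ennreal (?C * increment u z) \<partial>leb2)"
  proof (intro nn_integral_mono ennreal_leI)
    fix z :: "(real^'n) \<times> (real^'n)"
    show "cell_kernel j z * \<bar>u (snd z) - u (fst z)\<bar> powr p \<le> ?C * increment u z"
    proof (cases "fst z = snd z")
      case False
      have "0 < s * p" using s p by simp
      from mult_right_mono[OF cell_kernel_le_frac_kernel[OF this False], of "\<bar>u (fst z) - u (snd z)\<bar> powr p" j]
      show ?thesis by (simp add: approx_const_def abs_minus_commute mult_ac)
    qed simp
  qed
  also have "\<dots> = ennreal (?C * seminorm u)"
    using W0_seminorm[OF u] C unfolding seminorm_def
    by (subst nn_integral_eq_integral) auto
  finally have le: "(\<integral>\<^sup>+x. ennreal (\<bar>cell_avg j u x - u x\<bar> powr p) \<partial>lebesgue) \<le> ennreal (?C * seminorm u)" .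
  show int: "integrable lebesgue (\<lambda>x. \<bar>cell_avg j u x - u x\<bar> powr p)"
    by (rule integrableI_nonneg) (use le in \<open>auto intro: order_le_less_trans\<close>)
  show "(LINT x|lebesgue. \<bar>cell_avg j u x - u x\<bar> powr p) \<le> ?C * seminorm u"
    using le mult_nonneg_nonneg[OF C seminorm_nonneg] by (simp add: nn_integral_eq_integral[OF int] ennreal_le_iff)
qed

text \<open>An upper bound for \<open>2\<^bsup>-jn/q\<^esup>\<close> times any mean value of \<open>|V|\<close> over a dyadic cube of side \<open>2\<^bsup>-j\<^esup>\<close>.\<close>

definition V_const :: real where
  "V_const = 1 + (LINT x|lebesgue. \<bar>V x\<bar> powr q)"

lemma V_const_pos: "0 < V_const"
  unfolding V_const_def by (intro add_pos_nonneg integral_nonneg_AE) auto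

text \<open>On functions that are constant on the cubes of generation \<open>j\<close>, the weight \<open>|V|\<close> may be replaced by its mean
  values over these cubes.  They are \<open>O(2\<^bsup>jn/q\<^esup>)\<close>, because \<open>|V| \<le> L + L\<^bsup>1-q\<^esup> |V|\<^sup>q\<close> for every \<open>L > 0\<close>.\<close>

lemma cell_weighted_le:
  assumes [measurable]: "v \<in> borel_measurable lebesgue"
    and v: "\<And>x y. cell j x = cell j y \<Longrightarrow> v x = v y"
    and int: "integrable lebesgue (\<lambda>x. \<bar>v x\<bar> powr p)"
  shows "integrable lebesgue (\<lambda>x. \<bar>v x\<bar> powr p * \<bar>V x\<bar>)"
    and "(LINT x|lebesgue. \<bar>v x\<bar> powr p * \<bar>V x\<bar>)
      \<le> 2 powr (real j * real CARD('n) / q) * V_const * (LINT x|lebesgue. \<bar>v x\<bar> powr p)"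
proof -
  let ?L = "2 powr (real j * real CARD('n) / q)"
  have inner: "(\<integral>\<^sup>+x. ennreal (cell_kernel j (x, y) * \<bar>V x\<bar>) \<partial>lebesgue) \<le> ennreal (?L * V_const)" for y
  proof -
    have "cell_kernel j (x, y) * \<bar>V x\<bar> \<le> ?L * cell_kernel j (y, x) + ?L * \<bar>V x\<bar> powr q" for x
    \<comment> \<open>Note that \<open>?L powr q\<close> is the height of the averaging kernel.\<close>
    proof (cases "\<bar>V x\<bar> \<le> ?L")
      case True
      then have "cell_kernel j (x, y) * \<bar>V x\<bar> \<le> cell_kernel j (y, x) * ?L"
        by (subst cell_kernel_commute) (intro mult_left_mono, auto)
      then show ?thesis by (simp add: add_increasing2 mult.commute)
    next
      case False
      then have "?L powr (q - 1) \<le> \<bar>V x\<bar> powr (q - 1)"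
        using q by (intro powr_mono2) auto
      then have "?L powr (q - 1) * \<bar>V x\<bar> \<le> \<bar>V x\<bar> powr (q - 1) * \<bar>V x\<bar>"
        by (rule mult_right_mono) simp
      also have "\<dots> = \<bar>V x\<bar> powr q"
        by (cases "V x = 0") (auto simp: powr_diff)
      finally have "?L * (?L powr (q - 1) * \<bar>V x\<bar>) \<le> ?L * \<bar>V x\<bar> powr q"
        by (intro mult_left_mono) auto
      moreover have "?L * ?L powr (q - 1) = ?L powr q"
        by (simp add: powr_diff)
      moreover have "?L powr q = 2 ^ (j * CARD('n))"
        using q by (simp add: powr_powr powr_realpow[symmetric])
      ultimately have "2 ^ (j * CARD('n)) * \<bar>V x\<bar> \<le> ?L * \<bar>V x\<bar> powr q"
        by (simp add: mult.assoc[symmetric])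
      moreover have "cell_kernel j (x, y) * \<bar>V x\<bar> \<le> 2 ^ (j * CARD('n)) * \<bar>V x\<bar>"
        by (intro mult_right_mono) (auto simp: cell_kernel_def)
      ultimately show ?thesis
        by (simp add: add_increasing)
    qed
    then have "(\<integral>\<^sup>+x. ennreal (cell_kernel j (x, y) * \<bar>V x\<bar>) \<partial>lebesgue)
      \<le> (\<integral>\<^sup>+x. ennreal ?L * ennreal (cell_kernel j (y, x)) + ennreal ?L * ennreal (\<bar>V x\<bar> powr q) \<partial>lebesgue)"
      by (intro nn_integral_mono) (simp add: ennreal_mult[symmetric] ennreal_plus[symmetric] ennreal_leI del: ennreal_plus)
    also have "\<dots> = ennreal ?L * 1 + ennreal ?L * ennreal (LINT x|lebesgue. \<bar>V x\<bar> powr q)"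
      by (subst nn_integral_add; simp add: nn_integral_cmult nn_integral_cell_kernel nn_integral_eq_integral[OF V_int])
    also have "\<dots> = ennreal (?L * V_const)"
      by (simp add: V_const_def ring_distribs ennreal_mult[symmetric] ennreal_plus[symmetric] del: ennreal_plus)
    finally show ?thesis .
  qed
  have "(\<integral>\<^sup>+x. ennreal (\<bar>v x\<bar> powr p * \<bar>V x\<bar>) \<partial>lebesgue)
    = (\<integral>\<^sup>+x. \<integral>\<^sup>+y. ennreal (cell_kernel j (x, y)) * ennreal (\<bar>v x\<bar> powr p * \<bar>V x\<bar>) \<partial>lebesgue \<partial>lebesgue)"
    by (simp add: nn_integral_multc nn_integral_cell_kernel)
  also have "\<dots> = (\<integral>\<^sup>+x. \<integral>\<^sup>+y. ennreal (\<bar>v y\<bar> powr p) * ennreal (cell_kernel j (x, y) * \<bar>V x\<bar>) \<partial>lebesgue \<partial>lebesgue)"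
  proof (intro nn_integral_cong)
    fix x y
    show "ennreal (cell_kernel j (x, y)) * ennreal (\<bar>v x\<bar> powr p * \<bar>V x\<bar>)
      = ennreal (\<bar>v y\<bar> powr p) * ennreal (cell_kernel j (x, y) * \<bar>V x\<bar>)"
      using v[of x y] by (auto simp: cell_kernel_def ennreal_mult[symmetric] mult_ac)
  qed
  also have "\<dots> = (\<integral>\<^sup>+y. \<integral>\<^sup>+x. ennreal (\<bar>v y\<bar> powr p) * ennreal (cell_kernel j (x, y) * \<bar>V x\<bar>) \<partial>lebesgue \<partial>lebesgue)"
    by (rule leb2.Fubini'[symmetric]) measurable
  also have "\<dots> = (\<integral>\<^sup>+y. ennreal (\<bar>v y\<bar> powr p) * (\<integral>\<^sup>+x. ennreal (cell_kernel j (x, y) * \<bar>V x\<bar>) \<partial>lebesgue) \<partial>lebesgue)"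
    by (intro nn_integral_cong nn_integral_cmult) measurable
  also have "\<dots> \<le> (\<integral>\<^sup>+y. ennreal (\<bar>v y\<bar> powr p) * ennreal (?L * V_const) \<partial>lebesgue)"
    by (intro nn_integral_mono mult_left_mono inner) auto
  also have "\<dots> = ennreal (LINT x|lebesgue. \<bar>v x\<bar> powr p) * ennreal (?L * V_const)"
    by (simp add: nn_integral_multc nn_integral_eq_integral[OF int])
  also have "\<dots> = ennreal (?L * V_const * (LINT x|lebesgue. \<bar>v x\<bar> powr p))"
    using V_const_pos by (simp add: ennreal_mult[symmetric] mult_ac)
  finally have le: "(\<integral>\<^sup>+x. ennreal (\<bar>v x\<bar> powr p * \<bar>V x\<bar>) \<partial>lebesgue)
      \<le> ennreal (?L * V_const * (LINT x|lebesgue. \<bar>v x\<bar> powr p))" .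
  show I: "integrable lebesgue (\<lambda>x. \<bar>v x\<bar> powr p * \<bar>V x\<bar>)"
    by (rule integrableI_nonneg) (use le in \<open>auto intro: order_le_less_trans\<close>)
  have "0 \<le> ?L * V_const * (LINT x|lebesgue. \<bar>v x\<bar> powr p)"
    using V_const_pos by simp
  then show "(LINT x|lebesgue. \<bar>v x\<bar> powr p * \<bar>V x\<bar>)
      \<le> ?L * V_const * (LINT x|lebesgue. \<bar>v x\<bar> powr p)"
    using le by (simp add: nn_integral_eq_integral[OF I])
qed

lemma cell_avg_subseq:
  assumes u: "u \<in> W0"
  obtains r where "strict_mono r" "AE x in lebesgue. (\<lambda>n. cell_avg (r n) u x) \<longlonglongrightarrow> u x"
proof -
  note A = cell_avg_approx[OF u]
  have sp: "0 < s * p" using s p by simp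
  have "(\<lambda>j. (2 powr (- (s * p))) ^ j) \<longlonglongrightarrow> 0"
    using sp by (intro LIMSEQ_power_zero) (auto simp: powr_less_one)
  then have "(\<lambda>j. approx_const * 2 powr (- (real j * (s * p))) * seminorm u) \<longlonglongrightarrow> 0"
    by (auto simp: powr_power mult.commute intro!: tendsto_mult_left_zero tendsto_mult_right_zero)
  then have "(\<lambda>j. LINT x|lebesgue. norm (\<bar>cell_avg j u x - u x\<bar> powr p)) \<longlonglongrightarrow> 0"
    by (rule tendsto_sandwich[OF _ _ tendsto_const, rotated 2]) (use A(2) in auto)
  from tendsto_L1_AE_subseq[OF A(1) this] obtain r where r: "strict_mono r"
    "AE x in lebesgue. (\<lambda>n. \<bar>cell_avg (r n) u x - u x\<bar> powr p) \<longlonglongrightarrow> 0"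
    by auto
  have "AE x in lebesgue. (\<lambda>n. cell_avg (r n) u x) \<longlonglongrightarrow> u x"
    using r(2)
  proof eventually_elim
    case (elim x)
    have "(\<lambda>n. (\<bar>cell_avg (r n) u x - u x\<bar> powr p) powr (1 / p)) \<longlonglongrightarrow> 0"
      using p by (intro tendsto_zero_powrI[OF elim tendsto_const]) auto
    then have "(\<lambda>n. \<bar>cell_avg (r n) u x - u x\<bar>) \<longlonglongrightarrow> 0"
      using p by (simp add: powr_powr)
    then show ?case
      by (simp add: tendsto_rabs_zero_iff LIM_zero_iff)
  qed
  with r(1) show ?thesis by (rule that)
qed

lemma integral_abs_powr_diff_le:
  fixes f g :: "'a \<Rightarrow> real"
  assumes [measurable]: "f \<in> borel_measurable M" "g \<in> borel_measurable M"
    and f: "integrable M (\<lambda>x. \<bar>f x\<bar> powr p)" and g: "integrable M (\<lambda>x. \<bar>g x\<bar> powr p)"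
  shows "integrable M (\<lambda>x. \<bar>f x - g x\<bar> powr p)"
    and "(LINT x|M. \<bar>f x - g x\<bar> powr p) \<le> 2 powr p * ((LINT x|M. \<bar>f x\<bar> powr p) + (LINT x|M. \<bar>g x\<bar> powr p))"
proof -
  have le: "\<bar>f x - g x\<bar> powr p \<le> 2 powr p * (\<bar>f x\<bar> powr p + \<bar>g x\<bar> powr p)" for x
    using p by (intro abs_powr_diff_le) auto
  show i: "integrable M (\<lambda>x. \<bar>f x - g x\<bar> powr p)"
    by (rule Bochner_Integration.integrable_bound[where f = "\<lambda>x. 2 powr p * (\<bar>f x\<bar> powr p + \<bar>g x\<bar> powr p)"])
      (use f g le in auto)
  have "(LINT x|M. \<bar>f x - g x\<bar> powr p) \<le> (LINT x|M. 2 powr p * (\<bar>f x\<bar> powr p + \<bar>g x\<bar> powr p))"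
    by (rule integral_mono[OF i]) (use f g le in auto)
  then show "(LINT x|M. \<bar>f x - g x\<bar> powr p) \<le> 2 powr p * ((LINT x|M. \<bar>f x\<bar> powr p) + (LINT x|M. \<bar>g x\<bar> powr p))"
    using f g by simp
qed

lemma gap_pos: "0 < s * p - real CARD('n) / q"
  using q s p by (simp add: field_simps)

text \<open>The factor \<open>2\<^bsup>jn/q\<^esup>\<close> of the weight is beaten by the factor \<open>2\<^bsup>-jsp\<^esup>\<close> of the approximation.\<close>

lemma cell_increment_le:
  assumes u: "u \<in> W0"
  shows "integrable lebesgue (\<lambda>x. \<bar>cell_avg (Suc j) u x - cell_avg j u x\<bar> powr p * \<bar>V x\<bar>)" (is ?A)
    and "(LINT x|lebesgue. \<bar>cell_avg (Suc j) u x - cell_avg j u x\<bar> powr p * \<bar>V x\<bar>)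
      \<le> V_const * 2 powr (real CARD('n) / q) * 2 powr p * (2 * approx_const)
          * 2 powr (- (real j * (s * p - real CARD('n) / q))) * seminorm u" (is "?I \<le> ?R")
proof -
  note [measurable] = W0_measurable[OF u]
  let ?D = "\<lambda>x. cell_avg (Suc j) u x - cell_avg j u x"
  have eq: "?D x = (cell_avg (Suc j) u x - u x) - (cell_avg j u x - u x)" for x
    by simp
  have const: "?D x = ?D y" if "cell (Suc j) x = cell (Suc j) y" for x y
    using that cell_avg_cong[OF that, of u] cell_avg_cong[OF cell_Suc_eq[OF that], of u] by simp
  have iD: "integrable lebesgue (\<lambda>x. \<bar>?D x\<bar> powr p)"
    unfolding eq by (rule integral_abs_powr_diff_le) (use cell_avg_approx(1)[OF u] in auto)
  have "(LINT x|lebesgue. \<bar>?D x\<bar> powr p)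
    \<le> 2 powr p * ((LINT x|lebesgue. \<bar>cell_avg (Suc j) u x - u x\<bar> powr p) + (LINT x|lebesgue. \<bar>cell_avg j u x - u x\<bar> powr p))"
    unfolding eq by (rule integral_abs_powr_diff_le) (use cell_avg_approx(1)[OF u] in auto)
  also have "\<dots> \<le> 2 powr p * (approx_const * 2 powr (- (real (Suc j) * (s * p))) * seminorm u
      + approx_const * 2 powr (- (real j * (s * p))) * seminorm u)"
    by (intro mult_left_mono add_mono cell_avg_approx[OF u]) auto
  also have "\<dots> \<le> 2 powr p * (approx_const * 2 powr (- (real j * (s * p))) * seminorm u
      + approx_const * 2 powr (- (real j * (s * p))) * seminorm u)"
  proof -
    have "2 powr (- (real (Suc j) * (s * p))) \<le> (2::real) powr (- (real j * (s * p)))"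
      using s p by (intro powr_mono) (auto intro!: mult_right_mono)
    then have "approx_const * 2 powr (- (real (Suc j) * (s * p))) * seminorm u
        \<le> approx_const * 2 powr (- (real j * (s * p))) * seminorm u"
      by (rule mult_right_mono[OF mult_left_mono]) (auto simp: approx_const_def seminorm_nonneg)
    then show ?thesis by (rule mult_left_mono[OF add_right_mono]) simp
  qed
  also have "\<dots> = 2 powr p * (2 * approx_const) * 2 powr (- (real j * (s * p))) * seminorm u"
    by simp
  finally have D: "(LINT x|lebesgue. \<bar>?D x\<bar> powr p) \<le> \<dots>" .
  have [measurable]: "?D \<in> borel_measurable lebesgue" by measurable
  show ?A
    by (rule cell_weighted_le(1)[OF _ const iD]) simp_all
  have "?I \<le> 2 powr (real (Suc j) * real CARD('n) / q) * V_const * (LINT x|lebesgue. \<bar>?D x\<bar> powr p)"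
    by (rule cell_weighted_le(2)[OF _ const iD]) simp_all
  also have "\<dots> \<le> 2 powr (real (Suc j) * real CARD('n) / q) * V_const *
      (2 powr p * (2 * approx_const) * 2 powr (- (real j * (s * p))) * seminorm u)"
    using V_const_pos by (intro mult_left_mono D) auto
  also have "2 powr (real (Suc j) * real CARD('n) / q) = 2 powr (real CARD('n) / q) * 2 powr (real j * real CARD('n) / q)"
    by (simp add: powr_add[symmetric] add_divide_distrib ring_distribs)
  also have "2 powr (real CARD('n) / q) * 2 powr (real j * real CARD('n) / q) * V_const *
      (2 powr p * (2 * approx_const) * 2 powr (- (real j * (s * p))) * seminorm u)
    = V_const * 2 powr (real CARD('n) / q) * 2 powr p * (2 * approx_const)
          * (2 powr (real j * real CARD('n) / q) * 2 powr (- (real j * (s * p)))) * seminorm u"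
    by (simp add: mult_ac)
  also have "2 powr (real j * real CARD('n) / q) * 2 powr (- (real j * (s * p))) = 2 powr (- (real j * (s * p - real CARD('n) / q)))"
    by (simp add: powr_add[symmetric] algebra_simps)
  finally show "?I \<le> ?R" .
qed

end

context frac_schroedinger
begin

lemma cell_avg_weighted_le:
  assumes u: "u \<in> W0"
  shows "integrable lebesgue (\<lambda>x. \<bar>cell_avg j u x\<bar> powr p * \<bar>V x\<bar>)" (is ?A)
    and "(LINT x|lebesgue. \<bar>cell_avg j u x\<bar> powr p * \<bar>V x\<bar>)
      \<le> V_const * 2 powr p * approx_const * 2 powr (- (real j * (s * p - real CARD('n) / q))) * seminorm u
        + V_const * 2 powr p * 2 powr (real j * real CARD('n) / q) * mass u" (is "?I \<le> ?R")
proof -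
  note [measurable] = W0_measurable[OF u]
  let ?L = "2 powr (real j * real CARD('n) / q)"
  have eq: "cell_avg j u x = (cell_avg j u x - u x) - (- u x)" for x
    by simp
  have D: "integrable lebesgue (\<lambda>x. \<bar>(cell_avg j u x - u x) - (- u x)\<bar> powr p)"
    "(LINT x|lebesgue. \<bar>(cell_avg j u x - u x) - (- u x)\<bar> powr p)
      \<le> 2 powr p * ((LINT x|lebesgue. \<bar>cell_avg j u x - u x\<bar> powr p) + (LINT x|lebesgue. \<bar>- u x\<bar> powr p))"
    by (rule integral_abs_powr_diff_le; use cell_avg_approx(1)[OF u] W0_mass[OF u] in simp)+
  have iD: "integrable lebesgue (\<lambda>x. \<bar>cell_avg j u x\<bar> powr p)"
    using D(1) by simp
  have "(LINT x|lebesgue. \<bar>cell_avg j u x\<bar> powr p)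
    \<le> 2 powr p * ((LINT x|lebesgue. \<bar>cell_avg j u x - u x\<bar> powr p) + mass u)"
    using D(2) by (simp add: mass_def)
  also have "\<dots> \<le> 2 powr p * (approx_const * 2 powr (- (real j * (s * p))) * seminorm u + mass u)"
    by (intro mult_left_mono add_right_mono cell_avg_approx[OF u]) auto
  finally have le: "(LINT x|lebesgue. \<bar>cell_avg j u x\<bar> powr p) \<le> \<dots>" .
  show ?A
    by (rule cell_weighted_le(1)[OF _ cell_avg_cong iD]) simp_all
  have "?I \<le> ?L * V_const * (LINT x|lebesgue. \<bar>cell_avg j u x\<bar> powr p)"
    by (rule cell_weighted_le(2)[OF _ cell_avg_cong iD]) simp_all
  also have "\<dots> \<le> ?L * V_const * (2 powr p * (approx_const * 2 powr (- (real j * (s * p))) * seminorm u + mass u))"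
    using V_const_pos by (intro mult_left_mono le) auto
  also have "\<dots> = V_const * 2 powr p * approx_const * (?L * 2 powr (- (real j * (s * p)))) * seminorm u
        + V_const * 2 powr p * ?L * mass u"
    by (simp add: algebra_simps)
  also have "?L * 2 powr (- (real j * (s * p))) = 2 powr (- (real j * (s * p - real CARD('n) / q)))"
    by (simp add: powr_add[symmetric] algebra_simps)
  finally show "?I \<le> ?R" .
qed

lemma cell_avg_telescope:
  assumes \<rho>: "0 < \<rho>" "\<rho> < 1"
  shows "\<bar>cell_avg (J + m) u x\<bar> powr p \<le> 2 powr p * (\<bar>cell_avg J u x\<bar> powr p
      + (1 / (1 - \<rho>)) powr p * (\<Sum>i<m. \<bar>cell_avg (Suc (J + i)) u x - cell_avg (J + i) u x\<bar> powr p / (\<rho> powr p) ^ i))"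
proof -
  let ?d = "\<lambda>i. cell_avg (Suc (J + i)) u x - cell_avg (J + i) u x"
  have "cell_avg (J + m) u x = cell_avg J u x + (\<Sum>i<m. ?d i)"
    by (induction m) auto
  then have "\<bar>cell_avg (J + m) u x\<bar> \<le> \<bar>cell_avg J u x\<bar> + (\<Sum>i<m. \<bar>?d i\<bar>)"
    using abs_triangle_ineq[of "cell_avg J u x" "\<Sum>i<m. ?d i"] sum_abs[of ?d "{..<m}"] by linarith
  then have "\<bar>cell_avg (J + m) u x\<bar> powr p \<le> (\<bar>cell_avg J u x\<bar> + (\<Sum>i<m. \<bar>?d i\<bar>)) powr p"
    using p by (intro powr_mono2) auto
  also have "\<dots> \<le> 2 powr p * (\<bar>cell_avg J u x\<bar> powr p + (\<Sum>i<m. \<bar>?d i\<bar>) powr p)"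
    using p by (intro powr_add_le sum_nonneg) auto
  also have "\<dots> \<le> 2 powr p * (\<bar>cell_avg J u x\<bar> powr p + (1 / (1 - \<rho>)) powr p * (\<Sum>i<m. \<bar>?d i\<bar> powr p / (\<rho> powr p) ^ i))"
    using p \<rho> by (intro mult_left_mono add_left_mono powr_sum_le) auto
  finally show ?thesis .
qed

text \<open>The potential energy is an arbitrarily small perturbation of the seminorm.  Writing the average of
  generation \<open>J + m\<close> as the average of generation \<open>J\<close> plus increments, the latter contribute \<open>O(2\<^bsup>-J\<gamma>\<^esup>)\<close> times the seminorm,
  where \<open>\<gamma> = sp - n/q\<close>.  Then \<open>J\<close> is taken large, and \<open>m \<rightarrow> \<infinity>\<close> by Fatou's lemma.\<close>

lemma potential_bound:
  assumes \<epsilon>: "0 < \<epsilon>"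
  shows "\<exists>C\<ge>0. \<forall>u\<in>W0. integrable lebesgue (\<lambda>x. \<bar>u x\<bar> powr p * \<bar>V x\<bar>) \<and>
           (LINT x|lebesgue. \<bar>u x\<bar> powr p * \<bar>V x\<bar>) \<le> \<epsilon> * seminorm u + C * mass u"
proof -
  define \<gamma> where "\<gamma> = s * p - real CARD('n) / q"
  have \<gamma>: "0 < \<gamma>" using gap_pos by (simp add: \<gamma>_def)
  \<comment> \<open>Half of the decay rate \<open>\<gamma>\<close> pays for the weights in the telescoping estimate, the other half for summability.\<close>
  define \<rho> :: real where "\<rho> = 2 powr (- (\<gamma> / (2 * p)))"
  have \<rho>: "0 < \<rho>" "\<rho> < 1"
    using \<gamma> p by (auto simp: \<rho>_def powr_less_one)
  define \<theta> :: real where "\<theta> = 2 powr (- (\<gamma> / 2))"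
  have \<theta>: "0 < \<theta>" "\<theta> < 1"
    using \<gamma> by (auto simp: \<theta>_def powr_less_one)
  have \<rho>\<theta>: "\<rho> powr p = \<theta>"
    using p by (simp add: \<rho>_def \<theta>_def powr_powr)
  define B where "B = V_const * 2 powr (real CARD('n) / q) * 2 powr p * (2 * approx_const)"
  define B' where "B' = V_const * 2 powr p * approx_const"
  define R where "R = (1 / (1 - \<rho>)) powr p"
  have nn: "0 \<le> B" "0 \<le> B'" "0 \<le> R"
    using V_const_pos by (auto simp: B_def B'_def R_def approx_const_def)
  define M where "M = 2 powr p * (B' + R * B * (1 / (1 - \<theta>)))"
  have "(\<lambda>j. M * (2 powr (- \<gamma>)) ^ j) \<longlonglongrightarrow> 0"
    using \<gamma> by (intro tendsto_mult_right_zero LIMSEQ_power_zero) (auto simp: powr_less_one)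
  then have "\<forall>\<^sub>F j in sequentially. M * (2 powr (- \<gamma>)) ^ j < \<epsilon>"
    using \<epsilon> by (rule order_tendstoD(2))
  then obtain J where J: "M * (2 powr (- \<gamma>)) ^ J < \<epsilon>"
    by (auto simp: eventually_sequentially)
  define C where "C = 2 powr p * (V_const * 2 powr p * 2 powr (real J * real CARD('n) / q))"
  have C: "0 \<le> C" using V_const_pos by (simp add: C_def)
  have pow: "2 powr (- (real j * \<gamma>)) = (2 powr (- \<gamma>)) ^ j" for j
    by (simp add: powr_power mult.commute)
  have \<theta>2: "2 powr (- \<gamma>) = \<theta> * \<theta>"
    by (simp add: \<theta>_def powr_add[symmetric])
  have main: "(LINT x|lebesgue. \<bar>cell_avg (J + m) u x\<bar> powr p * \<bar>V x\<bar>) \<le> \<epsilon> * seminorm u + C * mass u"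
    if u: "u \<in> W0" for u m
  proof -
    let ?d = "\<lambda>i x. \<bar>cell_avg (Suc (J + i)) u x - cell_avg (J + i) u x\<bar> powr p * \<bar>V x\<bar>"
    let ?a = "\<lambda>j x. \<bar>cell_avg j u x\<bar> powr p * \<bar>V x\<bar>"
    note ia = cell_avg_weighted_le(1)[OF u] and id = cell_increment_le(1)[OF u]
    have "(LINT x|lebesgue. ?a (J + m) x) \<le> (LINT x|lebesgue. 2 powr p * (?a J x + R * (\<Sum>i<m. ?d i x / \<theta> ^ i)))"
    proof (rule integral_mono[OF ia])
      show "integrable lebesgue (\<lambda>x. 2 powr p * (?a J x + R * (\<Sum>i<m. ?d i x / \<theta> ^ i)))"
        by (intro integrable_mult_right Bochner_Integration.integrable_add Bochner_Integration.integrable_sum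
            integrable_divide ia id)
      fix x
      show "?a (J + m) x \<le> 2 powr p * (?a J x + R * (\<Sum>i<m. ?d i x / \<theta> ^ i))"
      proof -
        let ?S = "\<Sum>i<m. \<bar>cell_avg (Suc (J + i)) u x - cell_avg (J + i) u x\<bar> powr p / \<theta> ^ i"
        have "?a (J + m) x \<le> 2 powr p * (\<bar>cell_avg J u x\<bar> powr p + R * ?S) * \<bar>V x\<bar>"
          using cell_avg_telescope[OF \<rho>, of J m u x] unfolding R_def \<rho>\<theta>
          by (rule mult_right_mono) simp
        also have "\<dots> = 2 powr p * (?a J x + R * (?S * \<bar>V x\<bar>))"
          by (simp only: ring_distribs mult_ac)
        also have "?S * \<bar>V x\<bar> = (\<Sum>i<m. ?d i x / \<theta> ^ i)"
          by (simp add: sum_distrib_right)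
        finally show ?thesis .
      qed
    qed
    also have "\<dots> = 2 powr p * ((LINT x|lebesgue. ?a J x) + R * (\<Sum>i<m. (LINT x|lebesgue. ?d i x) / \<theta> ^ i))"
      using ia id by simp
    also have "\<dots> \<le> 2 powr p * ((B' * (2 powr (- \<gamma>)) ^ J * seminorm u
        + V_const * 2 powr p * 2 powr (real J * real CARD('n) / q) * mass u)
        + R * (B * (2 powr (- \<gamma>)) ^ J * seminorm u * (1 / (1 - \<theta>))))"
    proof (intro mult_left_mono add_mono)
      show "(LINT x|lebesgue. ?a J x) \<le> B' * (2 powr (- \<gamma>)) ^ J * seminorm u
        + V_const * 2 powr p * 2 powr (real J * real CARD('n) / q) * mass u"
        using cell_avg_weighted_le(2)[OF u, of J] unfolding B'_def \<gamma>_def[symmetric] pow .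
      have "(LINT x|lebesgue. ?d i x) / \<theta> ^ i \<le> B * (2 powr (- \<gamma>)) ^ J * seminorm u * \<theta> ^ i" for i
      proof -
        have "(LINT x|lebesgue. ?d i x) \<le> B * (2 powr (- \<gamma>)) ^ (J + i) * seminorm u"
          using cell_increment_le(2)[OF u, of "J + i"] unfolding B_def \<gamma>_def[symmetric] pow .
        also have "\<dots> = (B * (2 powr (- \<gamma>)) ^ J * seminorm u * \<theta> ^ i) * \<theta> ^ i"
          unfolding power_add \<theta>2 by (simp add: power_mult_distrib)
        finally show ?thesis using \<theta> by (simp add: pos_divide_le_eq)
      qed
      then have "(\<Sum>i<m. (LINT x|lebesgue. ?d i x) / \<theta> ^ i) \<le> (\<Sum>i<m. B * (2 powr (- \<gamma>)) ^ J * seminorm u * \<theta> ^ i)"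
        by (intro sum_mono)
      also have "\<dots> = B * (2 powr (- \<gamma>)) ^ J * seminorm u * (\<Sum>i<m. \<theta> ^ i)"
        by (simp only: sum_distrib_left)
      also have "\<dots> \<le> B * (2 powr (- \<gamma>)) ^ J * seminorm u * (1 / (1 - \<theta>))"
      proof (rule mult_left_mono)
        have "(\<Sum>i<m. \<theta> ^ i) \<le> (\<Sum>i. \<theta> ^ i)"
          using \<theta> by (intro sum_le_suminf) auto
        then show "(\<Sum>i<m. \<theta> ^ i) \<le> 1 / (1 - \<theta>)"
          using \<theta> by (simp add: suminf_geometric)
      qed (use nn seminorm_nonneg[of u] in auto)
      finally show "(\<Sum>i<m. (LINT x|lebesgue. ?d i x) / \<theta> ^ i) \<le> B * (2 powr (- \<gamma>)) ^ J * seminorm u * (1 / (1 - \<theta>))" .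
    qed (use nn in auto)
    also have "\<dots> = (M * (2 powr (- \<gamma>)) ^ J) * seminorm u + C * mass u"
      by (simp add: M_def C_def ring_distribs mult_ac)
    also have "\<dots> \<le> \<epsilon> * seminorm u + C * mass u"
      using J by (intro add_right_mono mult_right_mono seminorm_nonneg) auto
    finally show ?thesis .
  qed
  have "integrable lebesgue (\<lambda>x. \<bar>u x\<bar> powr p * \<bar>V x\<bar>) \<and>
           (LINT x|lebesgue. \<bar>u x\<bar> powr p * \<bar>V x\<bar>) \<le> \<epsilon> * seminorm u + C * mass u" if u: "u \<in> W0" for u
  proof -
    note [measurable] = W0_measurable[OF u]
    obtain r where r: "strict_mono r" "AE x in lebesgue. (\<lambda>n. cell_avg (r n) u x) \<longlonglongrightarrow> u x"
      by (rule cell_avg_subseq[OF u])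
    have lim: "AE x in lebesgue. (\<lambda>n. \<bar>cell_avg (r n) u x\<bar> powr p * \<bar>V x\<bar>) \<longlonglongrightarrow> \<bar>u x\<bar> powr p * \<bar>V x\<bar>"
      using r(2) by eventually_elim (use p in \<open>auto intro!: tendsto_mult tendsto_powr' tendsto_rabs\<close>)
    have ev: "\<forall>\<^sub>F n in sequentially. (LINT x|lebesgue. \<bar>cell_avg (r n) u x\<bar> powr p * \<bar>V x\<bar>) \<le> \<epsilon> * seminorm u + C * mass u"
      unfolding eventually_sequentially
    proof (intro exI allI impI)
      fix n assume "J \<le> n"
      then have "r n = J + (r n - J)"
        using seq_suble[OF r(1), of n] by simp
      then show "(LINT x|lebesgue. \<bar>cell_avg (r n) u x\<bar> powr p * \<bar>V x\<bar>) \<le> \<epsilon> * seminorm u + C * mass u"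
        using main[OF u, of "r n - J"] by simp
    qed
    show ?thesis
      using fatou_integral[OF _ cell_avg_weighted_le(1)[OF u] _ lim ev] by simp
  qed
  with C show ?thesis by blast
qed

lemma W0_potential_integrable:
  assumes u: "u \<in> W0"
  shows "integrable lebesgue (\<lambda>x. \<bar>u x\<bar> powr p * V x)"
proof -
  note [measurable] = W0_measurable[OF u]
  have "integrable lebesgue (\<lambda>x. \<bar>u x\<bar> powr p * \<bar>V x\<bar>)"
    using potential_bound[of 1] u by auto
  then show ?thesis
    by (rule Bochner_Integration.integrable_bound) (auto simp: abs_mult)
qed

lemma energy_coercive: "\<exists>C\<ge>0. \<forall>u\<in>W0. seminorm u / 4 - C * mass u \<le> energy u"
proof -
  obtain C where C: "0 \<le> C" "\<And>u. u \<in> W0 \<Longrightarrow> integrable lebesgue (\<lambda>x. \<bar>u x\<bar> powr p * \<bar>V x\<bar>)"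
    "\<And>u. u \<in> W0 \<Longrightarrow> (LINT x|lebesgue. \<bar>u x\<bar> powr p * \<bar>V x\<bar>) \<le> 1/4 * seminorm u + C * mass u"
    using potential_bound[of "1/4"] by auto
  have "seminorm u / 4 - C * mass u \<le> energy u" if u: "u \<in> W0" for u
  proof -
    have "\<bar>potential u\<bar> \<le> (LINT x|lebesgue. \<bar>\<bar>u x\<bar> powr p * V x\<bar>)"
      unfolding potential_def by (rule integral_abs_bound)
    also have "\<dots> = (LINT x|lebesgue. \<bar>u x\<bar> powr p * \<bar>V x\<bar>)"
      by (simp add: abs_mult)
    finally show ?thesis
      using C(3)[OF u] by (simp add: energy_def)
  qed
  with C(1) show ?thesis by blast
qed

end

section \<open>Compactness in the p-th power mean\<close>

context frac_schroedinger
begin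

text \<open>All averages of all generations are determined by their values at the countably many points \<open>2\<^bsup>-j\<^esup> z\<close> with
  integral \<open>z\<close>.\<close>

lemma cell_avg_convergent_subseq:
  fixes u :: "nat \<Rightarrow> (real^'n) \<Rightarrow> real"
  assumes u: "\<And>k. u k \<in> W0" and B: "\<And>k. mass (u k) \<le> B"
  obtains r w where "strict_mono (r :: nat \<Rightarrow> nat)" "\<And>j x. (\<lambda>k. cell_avg j (u (r k)) x) \<longlonglongrightarrow> w j x"
proof -
  define M where "M j = (2 ^ (j * CARD('n)) * B) powr (1 / p) + 1" for j
  have M: "0 < M j" for j by (simp add: M_def add_nonneg_pos)
  have le: "\<bar>cell_avg j (u k) x\<bar> \<le> M j" for j k x
  proof -
    have "\<bar>cell_avg j (u k) x\<bar> powr p \<le> 2 ^ (j * CARD('n)) * mass (u k)"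
      using cell_avg_bound[OF _ W0_measurable[OF u] W0_mass[OF u], of j k x] p by (simp add: mass_def)
    also have "\<dots> \<le> 2 ^ (j * CARD('n)) * B"
      using B by (intro mult_left_mono) auto
    finally have "(\<bar>cell_avg j (u k) x\<bar> powr p) powr (1 / p) \<le> (2 ^ (j * CARD('n)) * B) powr (1 / p)"
      using p by (intro powr_mono2) auto
    then show ?thesis using p by (simp add: powr_powr M_def)
  qed
  define rep :: "nat \<Rightarrow> int^'n \<Rightarrow> real^'n" where "rep j z = (\<chi> i. of_int (z $ i) / 2 ^ j)" for j z
  \<comment> \<open>Scaling by \<open>M j\<close> makes the averages bounded by \<open>1\<close>, uniformly in \<open>j\<close>.\<close>
  define f where "f k jz = cell_avg (fst jz) (u k) (rep (fst jz) (snd jz)) / M (fst jz)" for k and jz :: "nat \<times> (int^'n)"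
  have "norm (f k jz) \<le> 1" for k jz
    using le[of "fst jz" k] M by (simp add: f_def abs_div pos_divide_le_eq abs_of_pos)
  then obtain r where r: "strict_mono r" "\<And>jz. jz \<in> UNIV \<Longrightarrow> \<exists>l. (\<lambda>k. f (r k) jz) \<longlonglongrightarrow> l"
    using function_convergent_subsequence[OF countableI_type, of UNIV f 1] by blast
  have "\<exists>l. (\<lambda>k. cell_avg j (u (r k)) x) \<longlonglongrightarrow> l" for j x
  proof -
    obtain l where "(\<lambda>k. f (r k) (j, cell j x)) \<longlonglongrightarrow> l"
      using r(2) by blast
    from tendsto_mult_left[OF this, of "M j"]
    have "(\<lambda>k. cell_avg j (u (r k)) (rep j (cell j x))) \<longlonglongrightarrow> M j * l"
      using M[of j] by (simp add: f_def)
    moreover have "cell_avg j (u (r k)) (rep j (cell j x)) = cell_avg j (u (r k)) x" for k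
      by (rule cell_avg_cong) (simp add: rep_def cell_representative)
    ultimately show ?thesis by auto
  qed
  then obtain w where "\<And>j x. (\<lambda>k. cell_avg j (u (r k)) x) \<longlonglongrightarrow> w j x"
    by metis
  with r(1) show ?thesis by (rule that)
qed

lemma cell_avg_support:
  assumes u: "u \<in> W0" and R: "\<And>x. x \<in> \<Omega> \<Longrightarrow> norm x \<le> R" and x: "R + real CARD('n) < norm x"
  shows "cell_avg j u x = 0"
proof -
  have "cell_kernel j (x, y) * u y = 0" for y
  proof (cases "y \<in> \<Omega> \<and> cell j x = cell j y")
    case True
    then have "norm (x - y) \<le> real CARD('n) / 2 ^ j"
      by (intro cell_eq_imp_norm_le) auto
    also have "\<dots> \<le> real CARD('n)"
      by (simp add: divide_le_eq)
    finally have "norm x \<le> R + real CARD('n)"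
      using R[of y] True norm_triangle_sub[of x y] by auto
    then show ?thesis using x by simp
  next
    case False
    then show ?thesis using W0_outside[OF u, of y] by (auto simp: cell_kernel_def)
  qed
  then show ?thesis unfolding cell_avg_def by (simp only: integral_zero)
qed

lemma cell_avg_Lp_convergence:
  fixes u :: "nat \<Rightarrow> (real^'n) \<Rightarrow> real"
  assumes u: "\<And>k. u k \<in> W0" and B: "\<And>k. mass (u k) \<le> B"
    and lim: "\<And>x. (\<lambda>k. cell_avg j (u k) x) \<longlonglongrightarrow> w x"
  shows "w \<in> borel_measurable lebesgue"
    and "integrable lebesgue (\<lambda>x. \<bar>cell_avg j (u k) x - w x\<bar> powr p)"
    and "(\<lambda>k. LINT x|lebesgue. \<bar>cell_avg j (u k) x - w x\<bar> powr p) \<longlonglongrightarrow> 0"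
proof -
  note [measurable] = W0_measurable[OF u]
  show w [measurable]: "w \<in> borel_measurable lebesgue"
    by (rule borel_measurable_LIMSEQ_real[OF lim]) measurable
  obtain R where R: "\<And>x. x \<in> \<Omega> \<Longrightarrow> norm x \<le> R"
    using \<Omega>(2) by (auto simp: bounded_iff)
  define S where "S = cball (0 :: real^'n) (R + real CARD('n))"
  define M where "M = 2 ^ (j * CARD('n)) * B"
  have le: "\<bar>cell_avg j (u k) x\<bar> powr p \<le> M" for k x
  proof -
    have "\<bar>cell_avg j (u k) x\<bar> powr p \<le> 2 ^ (j * CARD('n)) * mass (u k)"
      using cell_avg_bound[OF _ W0_measurable[OF u] W0_mass[OF u], of j k x] p by (simp add: mass_def)
    also have "\<dots> \<le> M"
      unfolding M_def using B by (intro mult_left_mono) auto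
    finally show ?thesis .
  qed
  have wle: "\<bar>w x\<bar> powr p \<le> M" for x
  proof (rule LIMSEQ_le_const2)
    show "(\<lambda>k. \<bar>cell_avg j (u k) x\<bar> powr p) \<longlonglongrightarrow> \<bar>w x\<bar> powr p"
      using p by (intro tendsto_powr' tendsto_rabs lim tendsto_const) auto
  qed (use le in auto)
  have dom: "\<bar>cell_avg j (u k) x - w x\<bar> powr p \<le> 2 powr p * (M + M) * indicator S x" for k x
  proof (cases "x \<in> S")
    case True
    have "\<bar>cell_avg j (u k) x - w x\<bar> powr p \<le> 2 powr p * (\<bar>cell_avg j (u k) x\<bar> powr p + \<bar>w x\<bar> powr p)"
      using p by (intro abs_powr_diff_le) auto
    also have "\<dots> \<le> 2 powr p * (M + M)"
      by (intro mult_left_mono add_mono le wle) auto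
    finally show ?thesis using True by simp
  next
    case False
    then have z: "cell_avg j (u k) x = 0" for k
      by (intro cell_avg_support[OF u R]) (auto simp: S_def)
    then have "w x = 0"
      using lim[of x] by (simp add: LIMSEQ_const_iff)
    then show ?thesis using False z by simp
  qed
  have [measurable]: "S \<in> sets lebesgue"
    by (simp add: S_def)
  have "emeasure lebesgue S < \<infinity>"
    using emeasure_bounded_finite[of S] by (simp add: S_def)
  then have iS: "integrable lebesgue (\<lambda>x. 2 powr p * (M + M) * indicator S x)"
    by (intro integrable_mult_right integrable_real_indicator) auto
  show "integrable lebesgue (\<lambda>x. \<bar>cell_avg j (u k) x - w x\<bar> powr p)" for k
    by (rule Bochner_Integration.integrable_bound[OF iS]) (use dom order_trans[OF dom abs_ge_self] in auto)
  have "(\<lambda>k. LINT x|lebesgue. \<bar>cell_avg j (u k) x - w x\<bar> powr p) \<longlonglongrightarrow> (LINT x::real^'n|lebesgue. 0)"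
  proof (rule integral_dominated_convergence[OF _ _ iS])
    have "(\<lambda>k. \<bar>cell_avg j (u k) x - w x\<bar> powr p) \<longlonglongrightarrow> 0" for x
      using p lim[of x]
      by (intro tendsto_zero_powrI[OF _ tendsto_const]) (auto intro!: tendsto_rabs_zero simp: LIM_zero_iff)
    then show "AE x in lebesgue. (\<lambda>k. \<bar>cell_avg j (u k) x - w x\<bar> powr p) \<longlonglongrightarrow> 0"
      by auto
  qed (use dom in auto)
  then show "(\<lambda>k. LINT x|lebesgue. \<bar>cell_avg j (u k) x - w x\<bar> powr p) \<longlonglongrightarrow> 0"
    by simp
qed

text \<open>For a fixed fine generation, the averages along the subsequence converge in the \<open>p\<close>-th power mean, and all
  functions are uniformly close to their averages.\<close>

lemma Lp_Cauchy_subseq: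
  fixes u :: "nat \<Rightarrow> (real^'n) \<Rightarrow> real"
  assumes u: "\<And>k. u k \<in> W0" and A: "\<And>k. seminorm (u k) \<le> A" and B: "\<And>k. mass (u k) \<le> B"
  obtains r where "strict_mono (r :: nat \<Rightarrow> nat)"
    "\<And>e. 0 < e \<Longrightarrow> \<exists>N. \<forall>k\<ge>N. \<forall>l\<ge>N. mass (\<lambda>x. u (r k) x - u (r l) x) < e"
proof -
  obtain r w where r: "strict_mono r" and w: "\<And>j x. (\<lambda>k. cell_avg j (u (r k)) x) \<longlonglongrightarrow> w j x"
    by (rule cell_avg_convergent_subseq[where u = u, OF u B]) blast
  let ?u = "\<lambda>k. u (r k)"
  note [measurable] = W0_measurable[OF u]
  note L = cell_avg_Lp_convergence[OF u B w]
  note [measurable] = L(1)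
  have *: "\<exists>N. \<forall>k\<ge>N. \<forall>l\<ge>N. mass (\<lambda>x. ?u k x - ?u l x) < e" if e: "0 < e" for e
  proof -
    let ?c = "2 powr p * 2 powr p * 4"
    define \<delta> where "\<delta> = e / ?c"
    have \<delta>: "0 < \<delta>" using e by (simp add: \<delta>_def)
    have sp: "0 < s * p" using s p by simp
    have "(\<lambda>j. (2 powr (- (s * p))) ^ j) \<longlonglongrightarrow> 0"
      using sp by (intro LIMSEQ_power_zero) (auto simp: powr_less_one)
    then have "(\<lambda>j. approx_const * 2 powr (- (real j * (s * p))) * A) \<longlonglongrightarrow> 0"
      by (auto simp: powr_power mult.commute intro!: tendsto_mult_left_zero tendsto_mult_right_zero)
    then have "\<forall>\<^sub>F j in sequentially. approx_const * 2 powr (- (real j * (s * p))) * A < \<delta>"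
      using \<delta> by (rule order_tendstoD(2))
    then obtain j where j: "approx_const * 2 powr (- (real j * (s * p))) * A < \<delta>"
      by (auto simp: eventually_sequentially)
    have "\<forall>\<^sub>F k in sequentially. (LINT x|lebesgue. \<bar>cell_avg j (?u k) x - w j x\<bar> powr p) < \<delta>"
      using L(3)[of j] \<delta> by (rule order_tendstoD(2))
    then obtain N where N: "\<And>k. N \<le> k \<Longrightarrow> (LINT x|lebesgue. \<bar>cell_avg j (?u k) x - w j x\<bar> powr p) < \<delta>"
      by (auto simp: eventually_sequentially)
    define g where "g k x = \<bar>cell_avg j (?u k) x - ?u k x\<bar> powr p + \<bar>cell_avg j (?u k) x - w j x\<bar> powr p" for k x
    have ig: "integrable lebesgue (g k)" for k
      unfolding g_def by (intro Bochner_Integration.integrable_add cell_avg_approx(1)[OF u] L(2))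
    have g: "(LINT x|lebesgue. g k x) < 2 * \<delta>" if "N \<le> k" for k
    proof -
      have "(LINT x|lebesgue. \<bar>cell_avg j (?u k) x - ?u k x\<bar> powr p) \<le> approx_const * 2 powr (- (real j * (s * p))) * seminorm (?u k)"
        by (rule cell_avg_approx(2)[OF u])
      also have "\<dots> \<le> approx_const * 2 powr (- (real j * (s * p))) * A"
        using A by (intro mult_left_mono) (auto simp: approx_const_def)
      finally have "(LINT x|lebesgue. \<bar>cell_avg j (?u k) x - ?u k x\<bar> powr p) < \<delta>"
        using j by simp
      then show ?thesis
        using N[OF that] unfolding g_def
        by (subst Bochner_Integration.integral_add[OF cell_avg_approx(1)[OF u] L(2)]) simp
    qed
    have "mass (\<lambda>x. ?u k x - ?u l x) < e" if "N \<le> k" "N \<le> l" for k l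
    proof -
      have pt: "\<bar>?u k x - ?u l x\<bar> powr p \<le> 2 powr p * 2 powr p * (g k x + g l x)" for x
      proof -
        have 1: "\<bar>?u i x - w j x\<bar> powr p \<le> 2 powr p * g i x" for i
          using abs_powr_diff_le[of p "cell_avg j (?u i) x - w j x" "cell_avg j (?u i) x - ?u i x"] p
          by (simp add: g_def add.commute)
        have "\<bar>?u k x - ?u l x\<bar> powr p \<le> 2 powr p * (\<bar>?u k x - w j x\<bar> powr p + \<bar>?u l x - w j x\<bar> powr p)"
          using abs_powr_diff_le[of p "?u k x - w j x" "?u l x - w j x"] p by simp
        also have "\<dots> \<le> 2 powr p * (2 powr p * g k x + 2 powr p * g l x)"
          by (intro mult_left_mono add_mono 1) auto
        finally show ?thesis by (simp add: ring_distribs mult.assoc)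
      qed
      have "mass (\<lambda>x. ?u k x - ?u l x) \<le> (LINT x|lebesgue. 2 powr p * 2 powr p * (g k x + g l x))"
        unfolding mass_def
        by (intro integral_mono W0_mass W0_diff u pt integrable_mult_right Bochner_Integration.integrable_add ig)
      also have "\<dots> = 2 powr p * 2 powr p * ((LINT x|lebesgue. g k x) + (LINT x|lebesgue. g l x))"
        using ig by simp
      also have "\<dots> < 2 powr p * 2 powr p * (2 * \<delta> + 2 * \<delta>)"
        using g[OF that(1)] g[OF that(2)] by (intro mult_strict_left_mono add_strict_mono) auto
      also have "\<dots> = e"
        by (simp add: \<delta>_def)
      finally show ?thesis .
    qed
    then show ?thesis by blast
  qed
  show ?thesis
  proof (rule that[OF r])
    show "\<exists>N. \<forall>k\<ge>N. \<forall>l\<ge>N. mass (\<lambda>x. u (r k) x - u (r l) x) < e" if "0 < e" for e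
      by (rule *[OF that])
  qed
qed

lemma Omega_finite_measure: "emeasure lebesgue \<Omega> < \<infinity>"
  using emeasure_bounded_finite[OF \<Omega>(2)] \<Omega>(1) by simp

text \<open>A quantitative form of the inclusion of \<open>L\<^sup>p\<close> in \<open>L\<^sup>1\<close> over the bounded set \<open>\<Omega>\<close>.\<close>

lemma W0_integrable:
  assumes u: "u \<in> W0" and \<delta>: "0 < \<delta>"
  shows "integrable lebesgue u"
    and "(LINT x|lebesgue. \<bar>u x\<bar>) \<le> \<delta> * measure lebesgue \<Omega> + \<delta> powr (1 - p) * mass u"
proof -
  note [measurable] = W0_measurable[OF u]
  have i\<Omega>: "integrable lebesgue (\<lambda>x. \<delta> * indicator \<Omega> x + \<delta> powr (1 - p) * \<bar>u x\<bar> powr p)"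
    using Omega_finite_measure W0_mass[OF u] by auto
  have le: "\<bar>u x\<bar> \<le> \<delta> * indicator \<Omega> x + \<delta> powr (1 - p) * \<bar>u x\<bar> powr p" for x
  proof (cases "x \<in> \<Omega>")
    case True
    show ?thesis
    proof (cases "\<bar>u x\<bar> \<le> \<delta>")
      case False
      then have "\<delta> powr (p - 1) \<le> \<bar>u x\<bar> powr (p - 1)"
        using \<delta> p by (intro powr_mono2) auto
      then have "\<delta> powr (p - 1) * \<bar>u x\<bar> \<le> \<bar>u x\<bar> powr (p - 1) * \<bar>u x\<bar>"
        by (rule mult_right_mono) simp
      also have "\<dots> = \<bar>u x\<bar> powr p"
        using False \<delta> by (simp add: powr_diff)
      finally have "\<delta> powr (1 - p) * (\<delta> powr (p - 1) * \<bar>u x\<bar>) \<le> \<delta> powr (1 - p) * \<bar>u x\<bar> powr p"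
        by (intro mult_left_mono) auto
      also have "\<delta> powr (1 - p) * (\<delta> powr (p - 1) * \<bar>u x\<bar>) = \<bar>u x\<bar>"
        using \<delta> by (simp add: mult.assoc[symmetric] powr_add[symmetric])
      finally show ?thesis using \<delta> by (simp add: add_increasing)
    qed (use True in \<open>auto intro: add_increasing2\<close>)
  qed (use W0_outside[OF u] in auto)
  show "integrable lebesgue u"
    by (rule Bochner_Integration.integrable_bound[OF i\<Omega>]) (use order_trans[OF le abs_ge_self] in auto)
  then have "(LINT x|lebesgue. \<bar>u x\<bar>) \<le> (LINT x|lebesgue. \<delta> * indicator \<Omega> x + \<delta> powr (1 - p) * \<bar>u x\<bar> powr p)"
    by (intro integral_mono i\<Omega> le) auto
  also have "\<dots> = \<delta> * measure lebesgue \<Omega> + \<delta> powr (1 - p) * mass u"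
    using Omega_finite_measure W0_mass[OF u] by (simp add: mass_def)
  finally show "(LINT x|lebesgue. \<bar>u x\<bar>) \<le> \<delta> * measure lebesgue \<Omega> + \<delta> powr (1 - p) * mass u" .
qed

lemma seminorm_fatou:
  fixes u :: "nat \<Rightarrow> (real^'n) \<Rightarrow> real"
  assumes u: "\<And>k. u k \<in> W0" and [measurable]: "f \<in> borel_measurable lebesgue"
    and lim: "AE x in lebesgue. (\<lambda>k. u k x) \<longlonglongrightarrow> f x"
    and A: "\<forall>\<^sub>F k in sequentially. seminorm (u k) \<le> A"
  shows "integrable leb2 (\<lambda>z. increment f z)" and "seminorm f \<le> A"
proof -
  have lim2: "AE z in leb2. (\<lambda>k. increment (u k) z) \<longlonglongrightarrow> increment f z"
    using AE_leb2I[OF lim]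
  proof eventually_elim
    case (elim z)
    then show ?case
      using p by (intro tendsto_mult tendsto_powr' tendsto_rabs tendsto_diff tendsto_const) auto
  qed
  note F = fatou_integral[OF _ W0_seminorm[OF u] _ lim2 A[unfolded seminorm_def]]
  show "integrable leb2 (\<lambda>z. increment f z)"
    by (rule F(1)) auto
  show "seminorm f \<le> A"
    unfolding seminorm_def by (rule F(2)) auto
qed

text \<open>The compact embedding of the admissible functions into \<open>L\<^sup>p\<close>, with almost everywhere convergence.\<close>

lemma W0_compact:
  fixes u :: "nat \<Rightarrow> (real^'n) \<Rightarrow> real"
  assumes u: "\<And>k. u k \<in> W0" and A: "\<And>k. seminorm (u k) \<le> A" and B: "\<And>k. mass (u k) \<le> B"
  obtains r f where "strict_mono (r :: nat \<Rightarrow> nat)" "f \<in> W0" "AE x in lebesgue. (\<lambda>k. u (r k) x) \<longlonglongrightarrow> f x"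
    "(\<lambda>k. mass (\<lambda>x. u (r k) x - f x)) \<longlonglongrightarrow> 0"
proof -
  obtain r :: "nat \<Rightarrow> nat" where r: "strict_mono r" and C: "\<And>e. 0 < e \<Longrightarrow> \<exists>N. \<forall>k\<ge>N. \<forall>l\<ge>N. mass (\<lambda>x. u (r k) x - u (r l) x) < e"
    by (rule Lp_Cauchy_subseq[where u = u, OF u A B]) blast
  note [measurable] = W0_measurable[OF u]
  have "\<exists>N. \<forall>k\<ge>N. \<forall>l\<ge>N. (LINT x|lebesgue. norm (u (r k) x - u (r l) x)) < e" if e: "0 < e" for e
  proof -
    define \<delta> where "\<delta> = e / (2 * (measure lebesgue \<Omega> + 1))"
    have m: "0 < measure lebesgue \<Omega> + 1" by (simp add: add_nonneg_pos)
    then have \<delta>: "0 < \<delta>" using e by (simp add: \<delta>_def)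
    have "\<delta> * measure lebesgue \<Omega> < \<delta> * (measure lebesgue \<Omega> + 1)" using \<delta> by simp
    also have "\<dots> = e / 2" using m by (auto simp: \<delta>_def divide_simps)
    finally have d: "\<delta> * measure lebesgue \<Omega> < e / 2" .
    obtain N where N: "\<And>k l. N \<le> k \<Longrightarrow> N \<le> l \<Longrightarrow> mass (\<lambda>x. u (r k) x - u (r l) x) < e / 2 / \<delta> powr (1 - p)"
      using C[of "e / 2 / \<delta> powr (1 - p)"] e \<delta> by auto
    have "(LINT x|lebesgue. norm (u (r k) x - u (r l) x)) < e" if "N \<le> k" "N \<le> l" for k l
      using W0_integrable(2)[OF W0_diff[OF u u] \<delta>, of "r k" "r l"] N[OF that] d \<delta>
      by (simp add: pos_less_divide_eq mult.commute)
    then show ?thesis by blast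
  qed
  from cauchy_L1_AE_cauchy_subseq[where s = "\<lambda>k. u (r k)", OF W0_integrable(1)[OF u zero_less_one] this]
  obtain r' :: "nat \<Rightarrow> nat" where r': "strict_mono r'" "AE x in lebesgue. Cauchy (\<lambda>i. u (r (r' i)) x)"
    by auto
  let ?v = "\<lambda>k. u (r (r' k))"
  \<comment> \<open>Outside \<open>\<Omega>\<close> the sequence is constantly \<open>0\<close>, hence so is the limit.\<close>
  define f where "f x = lim (\<lambda>k. ?v k x)" for x
  have f [measurable]: "f \<in> borel_measurable lebesgue"
    unfolding f_def by measurable
  have lim: "AE x in lebesgue. (\<lambda>k. ?v k x) \<longlonglongrightarrow> f x"
    using r'(2) by eventually_elim (auto simp: f_def Cauchy_convergent_iff convergent_LIMSEQ_iff)
  have f_out: "f x = 0" if "x \<notin> \<Omega>" for x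
    unfolding f_def using W0_outside[OF u that] by simp
  have diff: "integrable lebesgue (\<lambda>x. \<bar>?v k x - f x\<bar> powr p) \<and> mass (\<lambda>x. ?v k x - f x) \<le> e"
    if "\<forall>\<^sub>F l in sequentially. mass (\<lambda>x. ?v k x - ?v l x) \<le> e" for k e
  proof -
    have l: "AE x in lebesgue. (\<lambda>l. \<bar>?v k x - ?v l x\<bar> powr p) \<longlonglongrightarrow> \<bar>?v k x - f x\<bar> powr p"
      using lim by eventually_elim (use p in \<open>auto intro!: tendsto_powr' tendsto_rabs tendsto_diff\<close>)
    note F = fatou_integral[OF _ W0_mass[OF W0_diff[OF u u]] _ l that[unfolded mass_def]]
    show ?thesis
      unfolding mass_def by (intro conjI F) auto
  qed
  have ev: "\<forall>\<^sub>F k in sequentially. mass (\<lambda>x. ?v k x - f x) \<le> e \<and> integrable lebesgue (\<lambda>x. \<bar>?v k x - f x\<bar> powr p)"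
    if e: "0 < e" for e
  proof -
    obtain N where N: "\<And>k l. N \<le> k \<Longrightarrow> N \<le> l \<Longrightarrow> mass (\<lambda>x. u (r k) x - u (r l) x) < e"
      using C[OF e] by auto
    have "\<forall>\<^sub>F l in sequentially. mass (\<lambda>x. ?v k x - ?v l x) \<le> e" if "N \<le> k" for k
      unfolding eventually_sequentially
      using N[of "r' k" "r' _"] seq_suble[OF r'(1)] that by (meson less_imp_le order_trans)
    then show ?thesis
      using diff by (intro eventually_sequentiallyI[of N]) blast
  qed
  have mass_lim: "(\<lambda>k. mass (\<lambda>x. ?v k x - f x)) \<longlonglongrightarrow> 0"
  proof (rule LIMSEQ_I)
    fix e :: real assume "0 < e"
    then have "\<forall>\<^sub>F k in sequentially. mass (\<lambda>x. ?v k x - f x) \<le> e / 2"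
      using ev[of "e / 2"] by (auto elim: eventually_mono)
    then show "\<exists>N. \<forall>k\<ge>N. norm (mass (\<lambda>x. ?v k x - f x) - 0) < e"
      using \<open>0 < e\<close> by (fastforce simp: eventually_sequentially mass_nonneg)
  qed
  have "integrable lebesgue (\<lambda>x. \<bar>f x\<bar> powr p)"
  proof -
    have l: "AE x in lebesgue. (\<lambda>l. \<bar>?v l x\<bar> powr p) \<longlonglongrightarrow> \<bar>f x\<bar> powr p"
      using lim by eventually_elim (use p in \<open>auto intro!: tendsto_powr' tendsto_rabs\<close>)
    show ?thesis
      by (rule fatou_integral(1)[OF _ W0_mass[OF u] _ l, of B]) (use B in \<open>auto simp: mass_def\<close>)
  qed
  moreover have "integrable leb2 (\<lambda>z. increment f z)"
    by (rule seminorm_fatou(1)[OF u f lim, of A]) (use A in auto)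
  ultimately have "f \<in> W0"
    using f_out by (auto simp: W0_def)
  moreover have "strict_mono (\<lambda>k. r (r' k))"
    using r r'(1) by (auto simp: strict_mono_def)
  ultimately show ?thesis
    using that[of "\<lambda>k. r (r' k)" f] lim mass_lim by blast
qed

end

section \<open>Nontrivial admissible functions\<close>

lemma dyadic_below_one:
  fixes t :: real
  assumes "0 < t" "t \<le> 1"
  obtains k where "(1/2) ^ Suc k < t" "t \<le> (1/2) ^ k"
proof -
  have ex: "\<exists>k. (1/2) ^ Suc k < t"
  proof -
    obtain k where "(1/2::real) ^ k < t"
      using real_arch_pow_inv[OF assms(1), of "1/2"] by auto
    then have "(1/2) ^ Suc k < t"
      by (rule le_less_trans[rotated]) simp
    then show ?thesis ..
  qed
  define k where "k = (LEAST k. (1/2) ^ Suc k < t)"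
  have 1: "(1/2) ^ Suc k < t"
    unfolding k_def by (rule LeastI_ex[OF ex])
  have "t \<le> (1/2) ^ k"
  proof (cases k)
    case (Suc m)
    then have "\<not> (1/2) ^ Suc m < t"
      using not_less_Least[of m "\<lambda>k. (1/2) ^ Suc k < t"] unfolding k_def[symmetric] by simp
    then show ?thesis using Suc by simp
  qed (use assms in simp)
  with 1 show ?thesis by (rule that)
qed

lemma dyadic_above_one:
  fixes t :: real
  assumes "1 < t"
  obtains k where "2 ^ k < t" "t \<le> 2 ^ Suc k"
proof -
  have ex: "\<exists>k. t \<le> 2 ^ Suc k"
  proof -
    obtain k where "t < 2 ^ k"
      using real_arch_pow[of 2 t] by auto
    then have "t \<le> 2 ^ Suc k"
      by (rule order_trans[OF less_imp_le]) simp
    then show ?thesis ..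
  qed
  define k where "k = (LEAST k. t \<le> 2 ^ Suc k)"
  have 1: "t \<le> 2 ^ Suc k"
    unfolding k_def by (rule LeastI_ex[OF ex])
  have "2 ^ k < t"
  proof (cases k)
    case (Suc m)
    then have "\<not> t \<le> 2 ^ Suc m"
      using not_less_Least[of m "\<lambda>k. t \<le> 2 ^ Suc k"] unfolding k_def[symmetric] by simp
    then show ?thesis using Suc by simp
  qed (use assms in simp)
  from this 1 show ?thesis by (rule that)
qed

lemma ennreal_le_suminf: "(f :: nat \<Rightarrow> ennreal) k \<le> suminf f"
  using sum_le_suminf[OF summableI, of "{k}" f] by simp

context frac_schroedinger
begin

text \<open>The singularity is integrable because \<open>s < 1\<close>, the tail because \<open>s > 0\<close>; both are seen by comparing with a
  geometric series over dyadic annuli.\<close>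

lemma truncated_kernel_integral:
  assumes r: "0 < r"
  shows "\<exists>C\<ge>0. \<forall>x::real^'n. (\<integral>\<^sup>+y. ennreal (min r (norm (x - y)) powr p * K (x, y)) \<partial>lebesgue) \<le> ennreal C"
proof -
  let ?n = "CARD('n)"
  define c where "c = unit_ball_vol (real ?n)"
  have c: "0 \<le> c" by (simp add: c_def)
  have ball: "emeasure lebesgue (cball x \<rho>) = ennreal (c * \<rho> ^ ?n)" if "0 \<le> \<rho>" for x :: "real^'n" and \<rho>
    using emeasure_cball[of \<rho> x] that by (simp add: c_def)
  define \<alpha> where "\<alpha> = p - s * p"
  have \<alpha>: "0 < \<alpha>" using s p by (simp add: \<alpha>_def)
  have sp: "0 < s * p" using s p by simp
  \<comment> \<open>Bounds for the integrand on the annuli inside and outside the unit ball around \<open>x\<close>, respectively.\<close>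
  define a where "a k = ((1/2) ^ k) powr \<alpha> / ((1/2) ^ Suc k) ^ ?n" for k :: nat
  define b where "b k = r powr p / (2 ^ k) powr (real ?n + s * p)" for k :: nat
  have nn: "0 \<le> a k" "0 \<le> b k" for k by (auto simp: a_def b_def)
  have pt: "ennreal (min r (norm (x - y)) powr p * K (x, y))
    \<le> (\<Sum>k. ennreal (a k) * indicator (cball x ((1/2) ^ k)) y) + (\<Sum>k. ennreal (b k) * indicator (cball x (2 ^ Suc k)) y)"
    for x y :: "real^'n"
  proof -
    let ?t = "norm (x - y)"
    have K: "K (x, y) = 1 / ?t powr (real ?n + s * p)"
      by (simp add: frac_kernel_def)
    consider "?t = 0" | "0 < ?t" "?t \<le> 1" | "1 < ?t"
      by fastforce
    then show ?thesis
    proof cases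
      case 1
      then show ?thesis unfolding K by simp
    next
      case 2
      then obtain k where k: "(1/2) ^ Suc k < ?t" "?t \<le> (1/2) ^ k"
        by (rule dyadic_below_one)
      have "min r ?t powr p * K (x, y) \<le> ?t powr p * K (x, y)"
        using p r by (intro mult_right_mono powr_mono2) auto
      also have "\<dots> = ?t powr \<alpha> / ?t ^ ?n"
        using 2 by (simp add: K \<alpha>_def powr_diff powr_add powr_realpow)
      also have "\<dots> \<le> a k"
        unfolding a_def using k \<alpha> by (intro frac_le powr_mono2 power_mono) auto
      finally have "ennreal (min r ?t powr p * K (x, y)) \<le> ennreal (a k) * indicator (cball x ((1/2) ^ k)) y"
        using k by (simp add: indicator_def dist_norm ennreal_leI)
      also have "\<dots> \<le> (\<Sum>k. ennreal (a k) * indicator (cball x ((1/2) ^ k)) y)"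
        by (rule ennreal_le_suminf)
      finally show ?thesis by (rule order_trans) simp
    next
      case 3
      then obtain k where k: "2 ^ k < ?t" "?t \<le> 2 ^ Suc k"
        by (rule dyadic_above_one)
      have "min r ?t powr p * K (x, y) \<le> r powr p * K (x, y)"
        using p r 3 by (intro mult_right_mono powr_mono2) auto
      also have "\<dots> = r powr p / ?t powr (real ?n + s * p)"
        by (simp add: K)
      also have "\<dots> \<le> b k"
      proof -
        have "x \<noteq> y" using 3 by auto
        then show ?thesis
          unfolding b_def using k sp by (intro divide_left_mono powr_mono2 mult_pos_pos) auto
      qed
      finally have "ennreal (min r ?t powr p * K (x, y)) \<le> ennreal (b k) * indicator (cball x (2 ^ Suc k)) y"
        using k by (simp add: indicator_def dist_norm ennreal_leI)
      also have "\<dots> \<le> (\<Sum>k. ennreal (b k) * indicator (cball x (2 ^ Suc k)) y)"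
        by (rule ennreal_le_suminf)
      finally show ?thesis by (rule order_trans) simp
    qed
  qed
  define A where "A k = c * 2 ^ ?n * ((1/2) powr \<alpha>) ^ k" for k :: nat
  define B where "B k = c * 2 ^ ?n * r powr p * (2 powr (- (s * p))) ^ k" for k :: nat
  have A: "a k * (c * ((1/2) ^ k) ^ ?n) = A k" for k
  proof -
    have "((1/2::real) ^ k) powr \<alpha> = ((1/2) powr \<alpha>) ^ k"
      by (simp add: powr_power powr_realpow[symmetric] powr_powr mult.commute)
    moreover have "((1/2::real) ^ k) ^ ?n = ((1/2) ^ Suc k) ^ ?n * 2 ^ ?n"
      by (simp add: power_mult_distrib[symmetric])
    ultimately show ?thesis
      by (simp add: a_def A_def)
  qed
  have B: "b k * (c * (2 ^ Suc k) ^ ?n) = B k" for k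
  proof -
    have "(2 ^ k) powr (real ?n + s * p) = (2 ^ k) ^ ?n * (2 ^ k :: real) powr (s * p)"
      by (simp add: powr_add powr_realpow)
    moreover have "(2 ^ k :: real) powr (s * p) * (2 powr (- (s * p))) ^ k = 1"
      by (simp add: powr_power powr_realpow[symmetric] powr_powr powr_add[symmetric] mult.commute)
    moreover have "(2 ^ k :: real) powr (s * p) > 0"
      by simp
    ultimately show ?thesis
      by (simp add: b_def B_def power_mult_distrib field_simps)
  qed
  have sA: "summable A" and sB: "summable B"
    unfolding A_def B_def using \<alpha> sp
    by (intro summable_mult summable_geometric; simp add: powr_less_one powr01_less_one)+
  have nnAB: "0 \<le> A k" "0 \<le> B k" for k using c by (auto simp: A_def B_def)
  have "(\<integral>\<^sup>+y. ennreal (min r (norm (x - y)) powr p * K (x, y)) \<partial>lebesgue) \<le> ennreal (suminf A + suminf B)" for x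
  proof -
    have "(\<integral>\<^sup>+y. ennreal (min r (norm (x - y)) powr p * K (x, y)) \<partial>lebesgue)
      \<le> (\<integral>\<^sup>+y. (\<Sum>k. ennreal (a k) * indicator (cball x ((1/2) ^ k)) y) + (\<Sum>k. ennreal (b k) * indicator (cball x (2 ^ Suc k)) y) \<partial>lebesgue)"
      by (intro nn_integral_mono pt)
    also have "\<dots> = (\<Sum>k. \<integral>\<^sup>+y. ennreal (a k) * indicator (cball x ((1/2) ^ k)) y \<partial>lebesgue)
        + (\<Sum>k. \<integral>\<^sup>+y. ennreal (b k) * indicator (cball x (2 ^ Suc k)) y \<partial>lebesgue)"
    proof -
      have m: "(\<lambda>y. ennreal d * indicator (cball x \<rho>) y) \<in> borel_measurable lebesgue" for d \<rho>
        by (intro borel_measurable_times_ennreal borel_measurable_const borel_measurable_indicator) simp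
      show ?thesis
        by (subst nn_integral_add) (intro borel_measurable_suminf_order m nn_integral_suminf arg_cong2[where f = "(+)"])+
    qed
    also have "\<dots> = (\<Sum>k. ennreal (A k)) + (\<Sum>k. ennreal (B k))"
    proof -
      have I: "(\<integral>\<^sup>+y. ennreal d * indicator (cball x \<rho>) y \<partial>lebesgue) = ennreal (d * (c * \<rho> ^ ?n))"
        if "0 \<le> d" "0 \<le> \<rho>" for d \<rho>
      proof -
        have "(\<integral>\<^sup>+y. ennreal d * indicator (cball x \<rho>) y \<partial>lebesgue) = ennreal d * emeasure lebesgue (cball x \<rho>)"
          by (rule nn_integral_cmult_indicator) simp
        also have "\<dots> = ennreal (d * (c * \<rho> ^ ?n))"
          unfolding ball[OF that(2)] using that c by (intro ennreal_mult[symmetric]) auto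
        finally show ?thesis .
      qed
      have "(\<integral>\<^sup>+y. ennreal (a k) * indicator (cball x ((1/2) ^ k)) y \<partial>lebesgue) = ennreal (A k)"
        "(\<integral>\<^sup>+y. ennreal (b k) * indicator (cball x (2 ^ Suc k)) y \<partial>lebesgue) = ennreal (B k)" for k
        unfolding A[symmetric] B[symmetric] by (intro I nn; simp)+
      then show ?thesis by (simp only:)
    qed
    also have "\<dots> = ennreal (suminf A + suminf B)"
      using nnAB sA sB by (simp add: suminf_ennreal2 suminf_nonneg ennreal_plus)
    finally show ?thesis .
  qed
  moreover have "0 \<le> suminf A + suminf B"
    using nnAB sA sB by (intro add_nonneg_nonneg suminf_nonneg)
  ultimately show ?thesis by blast
qed

text \<open>A Lipschitz bump supported in a small ball is admissible, so the variational problem is not void.\<close>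

lemma W0_nontrivial: "\<exists>u\<in>W0. mass u \<noteq> 0"
proof -
  obtain x0 where "x0 \<in> \<Omega>" using \<Omega>(3) by blast
  then obtain r where r: "0 < r" "ball x0 r \<subseteq> \<Omega>"
    using \<Omega>(1) open_contains_ball by blast
  define u where "u x = max 0 (r - norm (x - x0))" for x
  let ?B = "ball x0 r"
  have [measurable]: "u \<in> borel_measurable lebesgue"
    unfolding u_def by measurable
  have out: "u x = 0" if "x \<notin> ?B" for x
    using that by (auto simp: u_def dist_norm norm_minus_commute)
  have le: "0 \<le> u x" "u x \<le> r" for x
    using r by (auto simp: u_def)
  have lip: "\<bar>u x - u y\<bar> \<le> min r (norm (x - y))" for x y
  proof -
    have "\<bar>norm (x - x0) - norm (y - x0)\<bar> \<le> norm (x - y)"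
      using norm_triangle_ineq3[of "x - x0" "y - x0"] by simp
    then have "\<bar>u x - u y\<bar> \<le> norm (x - y)"
      unfolding u_def by linarith
    moreover have "\<bar>u x - u y\<bar> \<le> r"
      using le[of x] le[of y] by linarith
    ultimately show ?thesis by simp
  qed
  have Bf: "emeasure lebesgue ?B < \<infinity>"
    using emeasure_bounded_finite[of ?B] by simp
  have "integrable lebesgue (\<lambda>x. r powr p * indicator ?B x)"
    using Bf by (intro integrable_mult_right integrable_real_indicator) auto
  then have 1: "integrable lebesgue (\<lambda>x. \<bar>u x\<bar> powr p)"
    by (rule Bochner_Integration.integrable_bound)
      (use le out p in \<open>auto simp: indicator_def intro!: AE_I2 powr_mono2\<close>)
  obtain C where C: "0 \<le> C"
    "\<And>x::real^'n. (\<integral>\<^sup>+y. ennreal (min r (norm (x - y)) powr p * K (x, y)) \<partial>lebesgue) \<le> ennreal C"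
    using truncated_kernel_integral[OF r(1)] by blast
  define h where "h z = ennreal (min r (norm (fst z - snd z)) powr p * K z)" for z :: "(real^'n) \<times> (real^'n)"
  have h [measurable]: "h \<in> borel_measurable leb2"
  proof -
    note [measurable] = borel_measurable_fst_leb2[where 'a = "real^'n"] borel_measurable_snd_leb2[where 'a = "real^'n"]
    have "(\<lambda>z::(real^'n) \<times> (real^'n). fst z - snd z) \<in> borel_measurable leb2"
      by (rule borel_measurable_diff) measurable
    then have [measurable]: "(\<lambda>z::(real^'n) \<times> (real^'n). norm (fst z - snd z)) \<in> borel_measurable leb2"
      by (rule measurable_compose) measurable
    show ?thesis unfolding h_def by measurable
  qed
  have h_sym: "h (x, y) = h (y, x)" for x y
    by (simp add: h_def frac_kernel_def norm_minus_commute)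
  have hC: "(\<integral>\<^sup>+y. h (x, y) \<partial>lebesgue) \<le> ennreal C" for x
    using C(2)[of x] by (simp add: h_def)
  have [measurable]: "?B \<in> sets lebesgue" by simp
  have half: "(\<integral>\<^sup>+x. \<integral>\<^sup>+y. indicator ?B x * h (x, y) \<partial>lebesgue \<partial>lebesgue) \<le> emeasure lebesgue ?B * ennreal C"
  proof -
    have "(\<integral>\<^sup>+x. \<integral>\<^sup>+y. indicator ?B x * h (x, y) \<partial>lebesgue \<partial>lebesgue)
      = (\<integral>\<^sup>+x. indicator ?B x * (\<integral>\<^sup>+y. h (x, y) \<partial>lebesgue) \<partial>lebesgue)"
      by (intro nn_integral_cong nn_integral_cmult) measurable
    also have "\<dots> \<le> (\<integral>\<^sup>+x. indicator ?B x * ennreal C \<partial>lebesgue)"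
      by (intro nn_integral_mono mult_left_mono hC) auto
    finally show ?thesis by (simp add: nn_integral_multc)
  qed
  have "(\<integral>\<^sup>+z. ennreal (increment u z) \<partial>leb2)
      \<le> (\<integral>\<^sup>+z. indicator ?B (fst z) * h z + indicator ?B (snd z) * h z \<partial>leb2)"
  proof (rule nn_integral_mono)
    fix z :: "(real^'n) \<times> (real^'n)"
    have le: "ennreal (increment u z) \<le> h z"
      unfolding h_def using p lip[of "fst z" "snd z"]
      by (intro ennreal_leI mult_right_mono powr_mono2) auto
    show "ennreal (increment u z) \<le> indicator ?B (fst z) * h z + indicator ?B (snd z) * h z"
    proof (cases "fst z \<in> ?B \<or> snd z \<in> ?B")
      case True
      then show ?thesis using le by (auto simp: indicator_def intro: add_increasing add_increasing2)
    next
      case False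
      then show ?thesis using out[of "fst z"] out[of "snd z"] by simp
    qed
  qed
  also have "\<dots> = (\<integral>\<^sup>+z. indicator ?B (fst z) * h z \<partial>leb2) + (\<integral>\<^sup>+z. indicator ?B (snd z) * h z \<partial>leb2)"
    by (rule nn_integral_add) measurable
  also have "(\<integral>\<^sup>+z. indicator ?B (fst z) * h z \<partial>leb2) = (\<integral>\<^sup>+x. \<integral>\<^sup>+y. indicator ?B x * h (x, y) \<partial>lebesgue \<partial>lebesgue)"
    using leb.nn_integral_fst[of "\<lambda>z. indicator ?B (fst z) * h z" lebesgue] by simp
  also have "(\<integral>\<^sup>+z. indicator ?B (snd z) * h z \<partial>leb2) = (\<integral>\<^sup>+y. \<integral>\<^sup>+x. indicator ?B y * h (y, x) \<partial>lebesgue \<partial>lebesgue)"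
    using leb2.nn_integral_snd[of "\<lambda>z. indicator ?B (snd z) * h z"] h_sym by simp
  also have "(\<integral>\<^sup>+x. \<integral>\<^sup>+y. indicator ?B x * h (x, y) \<partial>lebesgue \<partial>lebesgue) + \<dots>
      \<le> emeasure lebesgue ?B * ennreal C + emeasure lebesgue ?B * ennreal C"
    by (intro add_mono half)
  also have "\<dots> < \<infinity>"
    using Bf by (simp add: ennreal_mult_less_top less_top)
  finally have 2: "integrable leb2 (\<lambda>z. increment u z)"
    by (intro integrableI_nonneg) auto
  have u: "u \<in> W0"
  proof -
    have "u x = 0" if "x \<notin> \<Omega>" for x
      using that out r(2) by blast
    then show ?thesis
      using 1 2 by (simp add: W0_def)
  qed
  have "\<not> (AE x in lebesgue. u x = 0)"
  proof
    assume "AE x in lebesgue. u x = 0"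
    then have "AE x in lebesgue. x \<notin> ?B"
      by eventually_elim (auto simp: u_def dist_norm norm_minus_commute)
    then have "emeasure lebesgue ?B = 0"
      by (subst (asm) AE_iff_measurable[of ?B]) auto
    then show False
      using emeasure_ball[of r x0] r(1) unit_ball_vol_pos[of "real CARD('n)"] by simp
  qed
  then have "mass u \<noteq> 0"
    using mass_eq_0_iff[OF u] by simp
  with u show ?thesis by blast
qed

end

section \<open>Minimizers of the energy and their equation\<close>

context frac_schroedinger
begin

text \<open>The infimum of the energy on the unit sphere of \<open>L\<^sup>p\<close>.\<close>

definition first_eig :: real where
  "first_eig = Inf {energy u | u. u \<in> W0 \<and> mass u = 1}"

lemma normalize:
  assumes u: "u \<in> W0" and m: "mass u \<noteq> 0"
  defines "v \<equiv> \<lambda>x. mass u powr (- 1 / p) * u x"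
  shows "v \<in> W0" "mass v = 1" "energy v = energy u / mass u"
proof -
  have pos: "0 < mass u" using m mass_nonneg[of u] by simp
  have c: "\<bar>mass u powr (- 1 / p)\<bar> powr p = 1 / mass u"
    unfolding abs_of_nonneg[OF powr_ge_zero] powr_powr using pos p by (simp add: powr_minus_divide)
  show "v \<in> W0" unfolding v_def by (rule W0_scale[OF u])
  show "mass v = 1" unfolding v_def mass_scale c using m by simp
  show "energy v = energy u / mass u" unfolding v_def energy_scale c by simp
qed

lemma admissible_nonempty: "\<exists>u\<in>W0. mass u = 1"
  using W0_nontrivial normalize(1,2) by blast

lemma admissible_bdd_below: "bdd_below {energy u | u. u \<in> W0 \<and> mass u = 1}"
proof -
  obtain C where C: "\<And>u. u \<in> W0 \<Longrightarrow> seminorm u / 4 - C * mass u \<le> energy u"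
    using energy_coercive by blast
  have "- C \<le> energy u" if "u \<in> W0" "mass u = 1" for u
    using C[OF that(1)] that(2) seminorm_nonneg[of u] by simp
  then show ?thesis by (intro bdd_belowI[of _ "- C"]) auto
qed

lemma first_eig_le_energy:
  assumes u: "u \<in> W0"
  shows "first_eig * mass u \<le> energy u"
proof (cases "mass u = 0")
  case True
  then have "AE x in lebesgue. u x = 0"
    using mass_eq_0_iff[OF u] by simp
  then have "potential u = 0"
    unfolding potential_def by (intro integral_eq_zero_AE) auto
  then show ?thesis using True seminorm_nonneg[of u] by (simp add: energy_def)
next
  case False
  then have pos: "0 < mass u" using mass_nonneg[of u] by simp
  have "first_eig \<le> energy u / mass u"
    unfolding first_eig_def
    by (rule cInf_lower[OF _ admissible_bdd_below]) (use normalize[OF u False] in \<open>auto intro!: exI\<close>)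
  then show ?thesis using pos by (simp add: pos_le_divide_eq)
qed

text \<open>Bounded seminorms and convergence in \<open>L\<^sup>p\<close> suffice for convergence of the potential energy, by the
  form bound with small \<open>\<epsilon>\<close>.\<close>

lemma mass_potential_tendsto:
  fixes u :: "nat \<Rightarrow> (real^'n) \<Rightarrow> real"
  assumes u: "\<And>k. u k \<in> W0" and f: "f \<in> W0" and A: "\<And>k. seminorm (u k) \<le> A"
    and lim: "(\<lambda>k. mass (\<lambda>x. u k x - f x)) \<longlonglongrightarrow> 0"
  shows "(\<lambda>k. mass (u k)) \<longlonglongrightarrow> mass f" and "(\<lambda>k. potential (u k)) \<longlonglongrightarrow> potential f"
proof -
  note d = W0_diff[OF u f]
  show "(\<lambda>k. mass (u k)) \<longlonglongrightarrow> mass f"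
    using tendsto_integral_abs_powr[of p lebesgue u "\<lambda>x. 1" f] p W0_mass[OF u] W0_mass[OF f] W0_mass[OF d] lim
    by (simp add: mass_def)
  define S where "S = 2 powr p * (A + seminorm f)"
  have S: "seminorm (\<lambda>x. u k x - f x) \<le> S" for k
  proof -
    have pt: "\<bar>(u k x - f x) - (u k y - f y)\<bar> powr p * K z
      \<le> 2 powr p * (\<bar>u k x - u k y\<bar> powr p * K z + \<bar>f x - f y\<bar> powr p * K z)" for x y z
      using mult_right_mono[OF abs_powr_diff_le[of p "u k x - u k y" "f x - f y"], of "K z"] p
      by (simp add: algebra_simps)
    have "seminorm (\<lambda>x. u k x - f x) \<le> (LINT z|leb2. 2 powr p *
        (increment (u k) z + increment f z))"
      unfolding seminorm_def
      by (intro integral_mono pt W0_seminorm[OF d] integrable_mult_right Bochner_Integration.integrable_add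
          W0_seminorm u f)
    also have "\<dots> = 2 powr p * (seminorm (u k) + seminorm f)"
      using W0_seminorm[OF u, of k] W0_seminorm[OF f] by (simp add: seminorm_def)
    also have "\<dots> \<le> S"
      unfolding S_def using A by (intro mult_left_mono add_right_mono) auto
    finally show ?thesis .
  qed
  have S0: "0 \<le> S" using S[of 0] seminorm_nonneg[of "\<lambda>x. u 0 x - f x"] by simp
  have "(\<lambda>k. LINT x|lebesgue. \<bar>u k x - f x\<bar> powr p * \<bar>V x\<bar>) \<longlonglongrightarrow> 0"
  proof (rule LIMSEQ_I)
    fix e :: real assume e: "0 < e"
    define \<epsilon> where "\<epsilon> = e / (2 * (S + 1))"
    have \<epsilon>: "0 < \<epsilon>" using e S0 by (simp add: \<epsilon>_def)
    have "\<epsilon> * S < \<epsilon> * (S + 1)" using \<epsilon> by simp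
    also have "\<dots> = e / 2" using S0 by (auto simp: \<epsilon>_def divide_simps)
    finally have \<epsilon>S: "\<epsilon> * S < e / 2" .
    obtain C where C: "0 \<le> C" "\<And>u. u \<in> W0 \<Longrightarrow> (LINT x|lebesgue. \<bar>u x\<bar> powr p * \<bar>V x\<bar>) \<le> \<epsilon> * seminorm u + C * mass u"
      using potential_bound[OF \<epsilon>] by blast
    have "(\<lambda>k. C * mass (\<lambda>x. u k x - f x)) \<longlonglongrightarrow> 0"
      using tendsto_mult_left[OF lim, of C] by simp
    then have "\<forall>\<^sub>F k in sequentially. C * mass (\<lambda>x. u k x - f x) < e / 2"
      using e by (intro order_tendstoD(2)) auto
    then obtain N where N: "\<And>k. N \<le> k \<Longrightarrow> C * mass (\<lambda>x. u k x - f x) < e / 2"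
      by (auto simp: eventually_sequentially)
    have "norm ((LINT x|lebesgue. \<bar>u k x - f x\<bar> powr p * \<bar>V x\<bar>) - 0) < e" if "N \<le> k" for k
    proof -
      have "\<epsilon> * seminorm (\<lambda>x. u k x - f x) \<le> \<epsilon> * S"
        using S \<epsilon> by (intro mult_left_mono) auto
      then show ?thesis
        using C(2)[OF d, of k] N[OF that] \<epsilon>S by simp
    qed
    then show "\<exists>N. \<forall>k\<ge>N. norm ((LINT x|lebesgue. \<bar>u k x - f x\<bar> powr p * \<bar>V x\<bar>) - 0) < e"
      by blast
  qed
  then show "(\<lambda>k. potential (u k)) \<longlonglongrightarrow> potential f"
    unfolding potential_def
    by (intro tendsto_integral_abs_powr p W0_potential_integrable u f d)
qed

lemma minimizing_sequence:
  fixes u :: "nat \<Rightarrow> (real^'n) \<Rightarrow> real"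
  assumes u: "\<And>k. u k \<in> W0" and m: "\<And>k. mass (u k) = 1" and E: "(\<lambda>k. energy (u k)) \<longlonglongrightarrow> first_eig"
  obtains r f where "strict_mono (r :: nat \<Rightarrow> nat)" "f \<in> W0" "mass f = 1" "energy f = first_eig"
    "AE x in lebesgue. (\<lambda>k. u (r k) x) \<longlonglongrightarrow> f x"
proof -
  obtain C where C: "\<And>u. u \<in> W0 \<Longrightarrow> seminorm u / 4 - C * mass u \<le> energy u"
    using energy_coercive by blast
  obtain E0 where "\<And>k. \<bar>energy (u k)\<bar> \<le> E0"
    using convergent_imp_Bseq[OF convergentI[OF E]] by (auto simp: Bseq_def)
  then have E0: "energy (u k) \<le> E0" for k
    using abs_le_D1 by blast
  define A where "A = 4 * (E0 + C)"
  have A: "seminorm (u k) \<le> A" for k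
    using C[OF u, of k] m[of k] E0[of k] by (simp add: A_def)
  obtain r :: "nat \<Rightarrow> nat" and f where r: "strict_mono r" and f: "f \<in> W0"
    and ae: "AE x in lebesgue. (\<lambda>k. u (r k) x) \<longlonglongrightarrow> f x"
    and lim: "(\<lambda>k. mass (\<lambda>x. u (r k) x - f x)) \<longlonglongrightarrow> 0"
    using W0_compact[where u = u and A = A and B = 1, OF u A] m by auto
  note T = mass_potential_tendsto[where u = "\<lambda>k. u (r k)", OF u f A lim]
  have mf: "mass f = 1"
    using T(1) m by (simp add: LIMSEQ_const_iff)
  have "(\<lambda>k. energy (u (r k))) \<longlonglongrightarrow> first_eig"
    using LIMSEQ_subseq_LIMSEQ[OF E r] by (simp add: o_def)
  from tendsto_mult_left[OF tendsto_diff[OF this T(2)], of 2]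
  have S: "(\<lambda>k. seminorm (u (r k))) \<longlonglongrightarrow> 2 * (first_eig - potential f)"
    by (simp add: energy_def)
  have "seminorm f \<le> 2 * (first_eig - potential f)"
  proof (rule field_le_epsilon)
    fix e :: real assume "0 < e"
    then have "\<forall>\<^sub>F k in sequentially. seminorm (u (r k)) < 2 * (first_eig - potential f) + e"
      using S by (intro order_tendstoD(2)) auto
    then have "\<forall>\<^sub>F k in sequentially. seminorm (u (r k)) \<le> 2 * (first_eig - potential f) + e"
      by (rule eventually_mono) simp
    then show "seminorm f \<le> 2 * (first_eig - potential f) + e"
      by (rule seminorm_fatou(2)[where u = "\<lambda>k. u (r k)", OF u W0_measurable[OF f] ae])
  qed
  then have "energy f \<le> first_eig"
    by (simp add: energy_def)
  moreover have "first_eig \<le> energy f"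
    using first_eig_le_energy[OF f] mf by simp
  ultimately show ?thesis
    using that[OF r f mf _ ae] by simp
qed

lemma minimizer_exists: "\<exists>f\<in>W0. mass f = 1 \<and> energy f = first_eig"
proof -
  have "\<exists>u. u \<in> W0 \<and> mass u = 1 \<and> energy u < first_eig + 1 / real (Suc k)" for k
  proof -
    have "first_eig < first_eig + 1 / real (Suc k)" by simp
    then have "\<exists>e\<in>{energy u | u. u \<in> W0 \<and> mass u = 1}. e < first_eig + 1 / real (Suc k)"
      unfolding first_eig_def using admissible_nonempty by (intro cInf_lessD) auto
    then show ?thesis by auto
  qed
  then obtain u where u: "\<And>k. u k \<in> W0" "\<And>k. mass (u k) = 1" "\<And>k. energy (u k) < first_eig + 1 / real (Suc k)"
    by metis
  have "(\<lambda>k. energy (u k)) \<longlonglongrightarrow> first_eig"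
  proof (rule tendsto_sandwich[of "\<lambda>_. first_eig" _ _ "\<lambda>k. first_eig + 1 / real (Suc k)"])
    show "\<forall>\<^sub>F k in sequentially. first_eig \<le> energy (u k)"
      using first_eig_le_energy[OF u(1)] u(2) by simp
    show "\<forall>\<^sub>F k in sequentially. energy (u k) \<le> first_eig + 1 / real (Suc k)"
      using u(3) by (simp add: less_imp_le del: of_nat_Suc)
    show "(\<lambda>k. first_eig + 1 / real (Suc k)) \<longlonglongrightarrow> first_eig"
      using tendsto_add[OF tendsto_const[of first_eig] LIMSEQ_inverse_real_of_nat] by (simp add: inverse_eq_divide)
  qed simp
  from minimizing_sequence[where u = u, OF u(1,2) this] show ?thesis
    by metis
qed

text \<open>The form \<open>\<H>\<close>; on the diagonal \<open>form u u = seminorm u / 2\<close>.\<close>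

definition form :: "((real^'n) \<Rightarrow> real) \<Rightarrow> ((real^'n) \<Rightarrow> real) \<Rightarrow> real" where
  "form u v = (LINT z|leb2. \<bar>u (fst z) - u (snd z)\<bar> powr (p - 2) * (u (fst z) - u (snd z))
      * (v (fst z) - v (snd z)) * K z) / 2"

text \<open>The eigenvalue equation, without requiring that \<open>u\<close> is nontrivial.\<close>

definition weak_solution :: "real \<Rightarrow> ((real^'n) \<Rightarrow> real) \<Rightarrow> bool" where
  "weak_solution \<mu> u \<longleftrightarrow> u \<in> W0 \<and> (\<forall>v\<in>W0. form u v + (LINT x|lebesgue. \<bar>u x\<bar> powr (p - 2) * u x * v x * V x)
      = \<mu> * (LINT x|lebesgue. \<bar>u x\<bar> powr (p - 2) * u x * v x))"

lemma weak_integrable: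
  assumes u: "u \<in> W0" and v: "v \<in> W0"
  shows "integrable leb2 (\<lambda>z. \<bar>u (fst z) - u (snd z)\<bar> powr (p - 2) * (u (fst z) - u (snd z)) * (v (fst z) - v (snd z)) * K z)"
    and "integrable lebesgue (\<lambda>x. \<bar>u x\<bar> powr (p - 2) * u x * v x * V x)"
    and "integrable lebesgue (\<lambda>x. \<bar>u x\<bar> powr (p - 2) * u x * v x)"
proof -
  note [measurable] = W0_measurable[OF u] W0_measurable[OF v]
  show "integrable leb2 (\<lambda>z. \<bar>u (fst z) - u (snd z)\<bar> powr (p - 2) * (u (fst z) - u (snd z)) * (v (fst z) - v (snd z)) * K z)"
    by (rule gateaux_integral(1)[OF p _ _ _ W0_seminorm[OF u] W0_seminorm[OF v]]) measurable
  show "integrable lebesgue (\<lambda>x. \<bar>u x\<bar> powr (p - 2) * u x * v x * V x)"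
    by (rule gateaux_integral(1)[OF p _ _ _ W0_potential_integrable[OF u] W0_potential_integrable[OF v]]) measurable
  show "integrable lebesgue (\<lambda>x. \<bar>u x\<bar> powr (p - 2) * u x * v x)"
    using gateaux_integral(1)[OF p, of u lebesgue v "\<lambda>x. 1"] W0_mass[OF u] W0_mass[OF v] by simp
qed

lemma minimizer_weak_solution:
  assumes f: "f \<in> W0" and E: "energy f = first_eig * mass f"
  shows "weak_solution first_eig f"
proof -
  define Q where "Q v = form f v + (LINT x|lebesgue. \<bar>f x\<bar> powr (p - 2) * f x * v x * V x)
      - first_eig * (LINT x|lebesgue. \<bar>f x\<bar> powr (p - 2) * f x * v x)" for v
  have Q: "0 \<le> Q v" if v: "v \<in> W0" for v
  proof -
    note [measurable] = W0_measurable[OF f] W0_measurable[OF v]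
    let ?t = "\<lambda>n. 1 / real (Suc n)"
    let ?w = "\<lambda>n x. f x + ?t n * v x"
    have w: "?w n \<in> W0" for n
      using W0_add_scaled[OF f v, of 1 "?t n"] by simp
    have 1: "(\<lambda>n. (seminorm (?w n) - seminorm f) / ?t n) \<longlonglongrightarrow> p * (2 * form f v)"
    proof -
      have "(f x + t * v x) - (f y + t * v y) = (f x - f y) + t * (v x - v y)" for t x y
        by (simp add: algebra_simps)
      moreover have "(\<lambda>n. ((LINT z|leb2. \<bar>(f (fst z) - f (snd z)) + ?t n * (v (fst z) - v (snd z))\<bar> powr p * K z)
        - (LINT z|leb2. increment f z)) / ?t n) \<longlonglongrightarrow> p * (LINT z|leb2. \<bar>f (fst z) - f (snd z)\<bar> powr (p - 2)
          * (f (fst z) - f (snd z)) * (v (fst z) - v (snd z)) * K z)"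
        by (rule gateaux_integral(2)[OF p _ _ _ W0_seminorm[OF f] W0_seminorm[OF v]]) measurable
      ultimately show ?thesis
        unfolding seminorm_def form_def by (simp only: times_divide_eq_right nonzero_mult_div_cancel_left)
    qed
    have 2: "(\<lambda>n. (potential (?w n) - potential f) / ?t n) \<longlonglongrightarrow> p * (LINT x|lebesgue. \<bar>f x\<bar> powr (p - 2) * f x * v x * V x)"
      unfolding potential_def
      by (rule gateaux_integral(2)[OF p _ _ _ W0_potential_integrable[OF f] W0_potential_integrable[OF v]]) measurable
    have 3: "(\<lambda>n. (mass (?w n) - mass f) / ?t n) \<longlonglongrightarrow> p * (LINT x|lebesgue. \<bar>f x\<bar> powr (p - 2) * f x * v x)"
      using gateaux_integral(2)[OF p, of f lebesgue v "\<lambda>x. 1"] W0_mass[OF f] W0_mass[OF v]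
      unfolding mass_def by (simp only: mult_1_right) measurable
    have "(\<lambda>n. (seminorm (?w n) - seminorm f) / ?t n / 2 + (potential (?w n) - potential f) / ?t n
        - first_eig * ((mass (?w n) - mass f) / ?t n)) \<longlonglongrightarrow> p * (2 * form f v) / 2
        + p * (LINT x|lebesgue. \<bar>f x\<bar> powr (p - 2) * f x * v x * V x)
        - first_eig * (p * (LINT x|lebesgue. \<bar>f x\<bar> powr (p - 2) * f x * v x))"
      by (intro tendsto_diff tendsto_add tendsto_divide tendsto_mult tendsto_const 1 2 3) simp
    also have "p * (2 * form f v) / 2
        + p * (LINT x|lebesgue. \<bar>f x\<bar> powr (p - 2) * f x * v x * V x)
        - first_eig * (p * (LINT x|lebesgue. \<bar>f x\<bar> powr (p - 2) * f x * v x)) = p * Q v"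
      by (simp add: Q_def algebra_simps)
    finally have "0 \<le> p * Q v"
    proof (rule LIMSEQ_le_const)
      have "0 \<le> (seminorm (?w n) - seminorm f) / ?t n / 2 + (potential (?w n) - potential f) / ?t n
        - first_eig * ((mass (?w n) - mass f) / ?t n)" for n
      proof -
        have "(seminorm (?w n) - seminorm f) / ?t n / 2 + (potential (?w n) - potential f) / ?t n
          - first_eig * ((mass (?w n) - mass f) / ?t n) = (energy (?w n) - first_eig * mass (?w n)) / ?t n
            - (energy f - first_eig * mass f) / ?t n"
        proof -
          have "(a - a') / t / 2 + (b - b') / t - l * ((c - c') / t)
            = (a / 2 + b - l * c) / t - (a' / 2 + b' - l * c') / t" for a a' b b' c c' l t :: real
            by (simp add: diff_divide_distrib add_divide_distrib algebra_simps)
          then show ?thesis unfolding energy_def .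
        qed
        also have "\<dots> \<ge> 0"
          using first_eig_le_energy[OF w[of n]] E by simp
        finally show ?thesis .
      qed
      then show "\<exists>N. \<forall>n\<ge>N. 0 \<le> (seminorm (?w n) - seminorm f) / ?t n / 2 + (potential (?w n) - potential f) / ?t n
        - first_eig * ((mass (?w n) - mass f) / ?t n)" by blast
    qed
    then show ?thesis using p by (simp add: zero_le_mult_iff)
  qed
  \<comment> \<open>The inequality for \<open>v\<close> and for \<open>-v\<close> yields the equation.\<close>
  have neg: "Q (\<lambda>x. - v x) = - Q v" for v
  proof -
    have "form f (\<lambda>x. - v x) = - form f v"
    proof -
      have "\<bar>f x - f y\<bar> powr (p - 2) * (f x - f y) * (- v x - - v y) * k
        = - (\<bar>f x - f y\<bar> powr (p - 2) * (f x - f y) * (v x - v y) * k)" for x y k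
        by (simp add: algebra_simps)
      then show ?thesis unfolding form_def by (simp only: integral_minus minus_divide_left)
    qed
    then show ?thesis by (simp add: Q_def)
  qed
  have "Q v = 0" if v: "v \<in> W0" for v
    using Q[OF v] Q[OF W0_uminus[OF v]] neg[of v] by simp
  then show ?thesis
    using f by (auto simp: weak_solution_def Q_def)
qed

end

section \<open>Nonnegative weak solutions and the Picone inequality\<close>

context frac_schroedinger
begin

text \<open>The test function \<open>\<phi>\<^sup>p / (|u| + \<delta>)\<^bsup>p-1\<^esup>\<close> is a Lipschitz function of \<open>(\<phi>, u)\<close> as long as \<open>\<phi>\<close> is bounded.\<close>

lemma picone_test_function:
  assumes u: "u \<in> W0" and \<phi>: "\<phi> \<in> W0" and b: "\<And>x. 0 \<le> \<phi> x" "\<And>x. \<phi> x \<le> M" and \<delta>: "0 < \<delta>"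
  shows "(\<lambda>x. \<phi> x powr p / (\<bar>u x\<bar> + \<delta>) powr (p - 1)) \<in> W0"
proof -
  note [measurable] = W0_measurable[OF u] W0_measurable[OF \<phi>]
  have M: "0 \<le> M" using b order_trans by blast
  let ?v = "\<lambda>x. \<phi> x powr p / (\<bar>u x\<bar> + \<delta>) powr (p - 1)"
  let ?r = "\<lambda>x. 1 / (\<bar>u x\<bar> + \<delta>) powr (p - 1)"
  define C1 where "C1 = p * M powr (p - 1) / \<delta> powr (p - 1)"
  define C2 where "C2 = M powr p * ((p - 1) / \<delta> powr p)"
  define C3 where "C3 = M powr (p - 1) / \<delta> powr (p - 1)"
  have C: "0 \<le> C1" "0 \<le> C2" "0 \<le> C3"
    using p M by (auto simp: C1_def C2_def C3_def)
  have r: "0 \<le> ?r x" "?r x \<le> 1 / \<delta> powr (p - 1)" for x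
    using \<delta> p by (auto intro!: divide_left_mono powr_mono2)
  have \<phi>p: "\<phi> x powr p = \<phi> x powr (p - 1) * \<phi> x" for x
    using b(1)[of x] by (cases "\<phi> x = 0") (auto simp: powr_diff)
  have \<phi>le: "\<phi> x powr p \<le> M powr (p - 1) * \<phi> x" for x
    unfolding \<phi>p using b[of x] p by (intro mult_right_mono powr_mono2) auto
  show ?thesis
  proof (rule W0_dominated[OF \<phi> u, of "C1 + C2 + C3"])
    show "?v \<in> borel_measurable lebesgue" by measurable
    show "\<bar>?v x\<bar> \<le> (C1 + C2 + C3) * (\<bar>\<phi> x\<bar> + \<bar>u x\<bar>)" for x
    proof -
      have "\<bar>?v x\<bar> = \<phi> x powr p * ?r x" by simp
      also have "\<dots> \<le> (M powr (p - 1) * \<phi> x) * (1 / \<delta> powr (p - 1))"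
        by (intro mult_mono \<phi>le r) (use b in auto)
      also have "\<dots> = C3 * \<bar>\<phi> x\<bar>"
        using b(1)[of x] by (simp add: C3_def)
      also have "\<dots> \<le> (C1 + C2 + C3) * (\<bar>\<phi> x\<bar> + \<bar>u x\<bar>)"
        using C by (intro mult_mono) auto
      finally show ?thesis .
    qed
    show "\<bar>?v x - ?v y\<bar> \<le> (C1 + C2 + C3) * (\<bar>\<phi> x - \<phi> y\<bar> + \<bar>u x - u y\<bar>)" for x y
    proof -
      have "?v x - ?v y = (\<phi> x powr p - \<phi> y powr p) * ?r x + \<phi> y powr p * (?r x - ?r y)"
      proof -
        have "a * c - b * d = (a - b) * c + b * (c - d)" for a b c d :: real
          by (simp add: algebra_simps)
        from this[of "\<phi> x powr p" "?r x" "\<phi> y powr p" "?r y"] show ?thesis by simp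
      qed
      then have "\<bar>?v x - ?v y\<bar> \<le> \<bar>\<phi> x powr p - \<phi> y powr p\<bar> * ?r x + \<phi> y powr p * \<bar>?r x - ?r y\<bar>"
        using abs_triangle_ineq[of "(\<phi> x powr p - \<phi> y powr p) * ?r x" "\<phi> y powr p * (?r x - ?r y)"] r(1)[of x]
        by (simp only: abs_mult abs_of_nonneg powr_ge_zero)
      also have "\<dots> \<le> (p * M powr (p - 1) * \<bar>\<phi> x - \<phi> y\<bar>) * (1 / \<delta> powr (p - 1))
          + M powr p * ((p - 1) / \<delta> powr p * \<bar>(\<bar>u x\<bar> + \<delta>) - (\<bar>u y\<bar> + \<delta>)\<bar>)"
        using b p M \<delta>
        by (intro add_mono mult_mono powr_diff_Lipschitz powr_neg_diff_Lipschitz r powr_mono2) auto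
      also have "\<dots> = C1 * \<bar>\<phi> x - \<phi> y\<bar> + C2 * \<bar>\<bar>u x\<bar> - \<bar>u y\<bar>\<bar>"
        by (simp add: C1_def C2_def)
      also have "\<dots> \<le> C1 * \<bar>\<phi> x - \<phi> y\<bar> + C2 * \<bar>u x - u y\<bar>"
        using C by (intro add_left_mono mult_left_mono abs_triangle_ineq3) auto
      also have "\<dots> \<le> (C1 + C2 + C3) * \<bar>\<phi> x - \<phi> y\<bar> + (C1 + C2 + C3) * \<bar>u x - u y\<bar>"
        using C by (intro add_mono mult_right_mono) auto
      finally show ?thesis by (simp only: ring_distribs)
    qed
  qed (use C in auto)
qed

text \<open>The defect in the pointwise Picone inequality for \<open>u + \<delta>\<close> and \<open>\<phi>\<close>, times the kernel.  It is nonnegative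
  where \<open>u\<close> and \<open>\<phi>\<close> are.\<close>

definition picone_gap ::
    "((real^'n) \<Rightarrow> real) \<Rightarrow> ((real^'n) \<Rightarrow> real) \<Rightarrow> real \<Rightarrow> (real^'n) \<times> (real^'n) \<Rightarrow> real" where
  "picone_gap u \<phi> \<delta> z = increment \<phi> z
     - \<bar>u (fst z) - u (snd z)\<bar> powr (p - 2) * (u (fst z) - u (snd z))
       * (\<phi> (fst z) powr p / (\<bar>u (fst z)\<bar> + \<delta>) powr (p - 1) - \<phi> (snd z) powr p / (\<bar>u (snd z)\<bar> + \<delta>) powr (p - 1)) * K z"

lemma picone_gap_nonneg:
  assumes "\<And>x. 0 \<le> \<phi> x" and "0 < \<delta>" and "0 \<le> u (fst z)" "0 \<le> u (snd z)"
  shows "0 \<le> picone_gap u \<phi> \<delta> z"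
  using mult_right_mono[OF picone_pointwise[OF p, of "u (fst z) + \<delta>" "u (snd z) + \<delta>" "\<phi> (fst z)" "\<phi> (snd z)"], of "K z"]
    assms by (simp add: picone_gap_def add_nonneg_pos)

text \<open>The weak equation for \<open>u\<close> tested with \<open>\<phi>\<^sup>p / (|u| + \<delta>)\<^bsup>p-1\<^esup>\<close>.\<close>

lemma picone_gap_integral:
  assumes w: "weak_solution \<mu> u" and u0: "AE x in lebesgue. 0 \<le> u x"
    and \<phi>: "\<phi> \<in> W0" and b: "\<And>x. 0 \<le> \<phi> x" "\<And>x. \<phi> x \<le> M" and \<delta>: "0 < \<delta>"
  defines "\<theta> \<equiv> \<lambda>x. (\<bar>u x\<bar> / (\<bar>u x\<bar> + \<delta>)) powr (p - 1)"
  shows "integrable leb2 (picone_gap u \<phi> \<delta>)"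
    and "AE z in leb2. 0 \<le> picone_gap u \<phi> \<delta> z"
    and "(LINT z|leb2. picone_gap u \<phi> \<delta> z) = seminorm \<phi>
      + 2 * (LINT x|lebesgue. \<theta> x * (\<bar>\<phi> x\<bar> powr p * V x)) - 2 * \<mu> * (LINT x|lebesgue. \<theta> x * \<bar>\<phi> x\<bar> powr p)"
proof -
  have u: "u \<in> W0" using w by (simp add: weak_solution_def)
  note [measurable] = W0_measurable[OF u] W0_measurable[OF \<phi>]
  define v where "v x = \<phi> x powr p / (\<bar>u x\<bar> + \<delta>) powr (p - 1)" for x
  have v: "v \<in> W0"
    unfolding v_def by (rule picone_test_function[OF u \<phi> b \<delta>])
  note [measurable] = W0_measurable[OF v]
  have gap: "picone_gap u \<phi> \<delta> = (\<lambda>z. increment \<phi> z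
     - \<bar>u (fst z) - u (snd z)\<bar> powr (p - 2) * (u (fst z) - u (snd z)) * (v (fst z) - v (snd z)) * K z)"
    by (auto simp: picone_gap_def v_def)
  show "integrable leb2 (picone_gap u \<phi> \<delta>)"
    unfolding gap by (intro Bochner_Integration.integrable_diff W0_seminorm[OF \<phi>] weak_integrable(1) u v)
  show "AE z in leb2. 0 \<le> picone_gap u \<phi> \<delta> z"
    using AE_leb2I[OF u0] by eventually_elim (rule picone_gap_nonneg; use b \<delta> in auto)
  have \<theta>: "\<bar>u x\<bar> powr (p - 2) * u x * v x = \<theta> x * \<bar>\<phi> x\<bar> powr p" if "0 \<le> u x" for x
  proof -
    have "\<bar>u x\<bar> powr (p - 2) * u x = \<bar>u x\<bar> powr (p - 1)"
      using abs_powr_abs_mult[of "u x" p] that by simp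
    then show ?thesis
      using b(1)[of x] by (simp add: v_def \<theta>_def powr_divide)
  qed
  have e1: "(LINT x|lebesgue. \<bar>u x\<bar> powr (p - 2) * u x * v x) = (LINT x|lebesgue. \<theta> x * \<bar>\<phi> x\<bar> powr p)"
    by (rule integral_cong_AE) (use u0 \<theta> in \<open>auto simp: \<theta>_def\<close>)
  have e2: "(LINT x|lebesgue. \<bar>u x\<bar> powr (p - 2) * u x * v x * V x) = (LINT x|lebesgue. \<theta> x * (\<bar>\<phi> x\<bar> powr p * V x))"
  proof (rule integral_cong_AE)
    show "AE x in lebesgue. \<bar>u x\<bar> powr (p - 2) * u x * v x * V x = \<theta> x * (\<bar>\<phi> x\<bar> powr p * V x)"
      using u0 by eventually_elim (simp only: \<theta> mult.assoc[symmetric])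
  qed (auto simp: \<theta>_def)
  have "(LINT z|leb2. picone_gap u \<phi> \<delta> z) = seminorm \<phi> - 2 * form u v"
    unfolding gap seminorm_def form_def
    by (subst Bochner_Integration.integral_diff[OF W0_seminorm[OF \<phi>] weak_integrable(1)[OF u v]]) simp
  moreover have "form u v + (LINT x|lebesgue. \<bar>u x\<bar> powr (p - 2) * u x * v x * V x)
      = \<mu> * (LINT x|lebesgue. \<bar>u x\<bar> powr (p - 2) * u x * v x)"
    using w v by (simp add: weak_solution_def)
  ultimately show "(LINT z|leb2. picone_gap u \<phi> \<delta> z) = seminorm \<phi>
      + 2 * (LINT x|lebesgue. \<theta> x * (\<bar>\<phi> x\<bar> powr p * V x)) - 2 * \<mu> * (LINT x|lebesgue. \<theta> x * \<bar>\<phi> x\<bar> powr p)"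
    unfolding e1 e2 by (simp add: algebra_simps)
qed

lemma picone_ratio_bounds:
  fixes t \<delta> :: real
  assumes "0 < \<delta>"
  shows "0 \<le> (\<bar>t\<bar> / (\<bar>t\<bar> + \<delta>)) powr (p - 1)" and "(\<bar>t\<bar> / (\<bar>t\<bar> + \<delta>)) powr (p - 1) \<le> 1"
  using assms p by (auto intro!: powr_le1 simp: divide_le_eq_1)

lemma picone_gap_integral_bound:
  assumes w: "weak_solution \<mu> u" and u0: "AE x in lebesgue. 0 \<le> u x"
    and \<phi>: "\<phi> \<in> W0" and b: "\<And>x. 0 \<le> \<phi> x" "\<And>x. \<phi> x \<le> M" and \<delta>: "0 < \<delta>"
  shows "(LINT z|leb2. picone_gap u \<phi> \<delta> z)
    \<le> seminorm \<phi> + 2 * (LINT x|lebesgue. \<bar>\<bar>\<phi> x\<bar> powr p * V x\<bar>) + 2 * \<bar>\<mu>\<bar> * mass \<phi>"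
proof -
  have u: "u \<in> W0" using w by (simp add: weak_solution_def)
  note [measurable] = W0_measurable[OF u] W0_measurable[OF \<phi>]
  let ?\<theta> = "\<lambda>x. (\<bar>u x\<bar> / (\<bar>u x\<bar> + \<delta>)) powr (p - 1)"
  note \<theta> = picone_ratio_bounds[OF \<delta>]
  have le: "\<bar>?\<theta> x * c\<bar> \<le> \<bar>c\<bar>" for x c
    using mult_right_mono[OF \<theta>(2)[of "u x"], of "\<bar>c\<bar>"] by (simp add: abs_mult)
  have *: "\<bar>LINT x|lebesgue. ?\<theta> x * g x\<bar> \<le> (LINT x|lebesgue. \<bar>g x\<bar>)" if g: "integrable lebesgue g" for g
  proof -
    have [measurable]: "g \<in> borel_measurable lebesgue" using g by auto
    have "integrable lebesgue (\<lambda>x. ?\<theta> x * g x)"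
      by (rule Bochner_Integration.integrable_bound[OF g]) (use le in auto)
    then have "(LINT x|lebesgue. \<bar>?\<theta> x * g x\<bar>) \<le> (LINT x|lebesgue. \<bar>g x\<bar>)"
      by (intro integral_mono integrable_abs g le)
    then show ?thesis
      using integral_abs_bound[of lebesgue "\<lambda>x. ?\<theta> x * g x"] by linarith
  qed
  have 1: "(LINT x|lebesgue. ?\<theta> x * (\<bar>\<phi> x\<bar> powr p * V x)) \<le> (LINT x|lebesgue. \<bar>\<bar>\<phi> x\<bar> powr p * V x\<bar>)"
    using *[OF W0_potential_integrable[OF \<phi>]] by linarith
  have "\<bar>LINT x|lebesgue. ?\<theta> x * \<bar>\<phi> x\<bar> powr p\<bar> \<le> mass \<phi>"
    using *[OF W0_mass[OF \<phi>]] by (simp add: mass_def)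
  then have "\<bar>\<mu>\<bar> * \<bar>LINT x|lebesgue. ?\<theta> x * \<bar>\<phi> x\<bar> powr p\<bar> \<le> \<bar>\<mu>\<bar> * mass \<phi>"
    by (rule mult_left_mono) simp
  then have 2: "- (\<mu> * (LINT x|lebesgue. ?\<theta> x * \<bar>\<phi> x\<bar> powr p)) \<le> \<bar>\<mu>\<bar> * mass \<phi>"
    unfolding abs_mult[symmetric] by linarith
  show ?thesis
    unfolding picone_gap_integral(3)[OF w u0 \<phi> b \<delta>] using 1 2 by linarith
qed

text \<open>A strong minimum principle: a nonnegative nontrivial solution cannot vanish on a set of positive measure where
  some bounded nonnegative admissible function is positive.\<close>

lemma nonneg_solution_pos:
  assumes w: "weak_solution \<mu> u" and u0: "AE x in lebesgue. 0 \<le> u x" and nt: "\<not> (AE x in lebesgue. u x = 0)"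
    and \<phi>: "\<phi> \<in> W0" and b: "\<And>x. 0 \<le> \<phi> x" "\<And>x. \<phi> x \<le> M"
  shows "AE x in lebesgue. 0 < \<phi> x \<longrightarrow> u x \<noteq> 0"
proof -
  have u: "u \<in> W0" using w by (simp add: weak_solution_def)
  note [measurable] = W0_measurable[OF u] W0_measurable[OF \<phi>]
  \<comment> \<open>If \<open>u\<close> vanished where \<open>\<phi> > 0\<close>, the Picone defect would blow up like \<open>\<delta>\<^bsup>1-p\<^esup>\<close> on the pairs described by \<open>bad\<close>, while its integral stays bounded.  So the defect is multiplied by \<open>\<delta>\<^bsup>p-1\<^esup>\<close> before the limit is taken.\<close>
  define bad where "bad z \<longleftrightarrow> u (fst z) = 0 \<and> 0 < \<phi> (fst z) \<and> 0 < u (snd z)" for z :: "(real^'n) \<times> (real^'n)"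
  have [measurable]: "Measurable.pred leb2 bad"
    unfolding bad_def by measurable
  let ?t = "\<lambda>n. 1 / real (Suc n)"
  let ?I = "\<lambda>z. if bad z then 1 else (0::real)"
  define f where "f n z = ?I z * (?t n powr (p - 1) * picone_gap u \<phi> (?t n) z)" for n z
  define G where "G z = ?I z * (u (snd z) powr (p - 1) * \<phi> (fst z) powr p * K z)" for z
  have t: "0 < ?t n" for n by simp
  have t_lim: "?t \<longlonglongrightarrow> 0"
    using LIMSEQ_inverse_real_of_nat by (simp add: inverse_eq_divide)
  have tp_lim: "(\<lambda>n. ?t n powr (p - 1)) \<longlonglongrightarrow> 0"
    by (rule tendsto_zero_powrI[OF t_lim tendsto_const]) (use p in auto)
  note gapI = picone_gap_integral(1)[OF w u0 \<phi> b t]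
  have [measurable]: "picone_gap u \<phi> (?t n) \<in> borel_measurable leb2" for n
    using gapI by auto
  have fi: "integrable leb2 (f n)" for n
  proof (rule Bochner_Integration.integrable_bound[OF integrable_mult_right[OF gapI[of n], of "?t n powr (p - 1)"]])
    show "f n \<in> borel_measurable leb2"
      unfolding f_def by measurable
    show "AE z in leb2. norm (f n z) \<le> norm (?t n powr (p - 1) * picone_gap u \<phi> (?t n) z)"
      by (rule AE_I2) (simp add: f_def)
  qed
  have fn: "0 \<le> f n z" for n z
    unfolding f_def using b picone_gap_nonneg[of \<phi> "?t n" u z] by (auto simp: bad_def)
  define C where "C = seminorm \<phi> + 2 * (LINT x|lebesgue. \<bar>\<bar>\<phi> x\<bar> powr p * V x\<bar>) + 2 * \<bar>\<mu>\<bar> * mass \<phi>"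
  have fC: "(LINT z|leb2. f n z) \<le> ?t n powr (p - 1) * C" for n
  proof -
    have "(LINT z|leb2. f n z) \<le> (LINT z|leb2. ?t n powr (p - 1) * picone_gap u \<phi> (?t n) z)"
    proof (rule integral_mono_AE[OF fi integrable_mult_right[OF gapI]])
      show "AE z in leb2. f n z \<le> ?t n powr (p - 1) * picone_gap u \<phi> (?t n) z"
        using picone_gap_integral(2)[OF w u0 \<phi> b t] by eventually_elim (auto simp: f_def)
    qed
    also have "\<dots> \<le> ?t n powr (p - 1) * C"
      unfolding C_def integral_mult_right_zero
      by (intro mult_left_mono picone_gap_integral_bound[OF w u0 \<phi> b t]) auto
    finally show ?thesis .
  qed
  have lim: "(\<lambda>n. f n z) \<longlonglongrightarrow> G z" for z
  proof (cases "bad z")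
    case True
    let ?c = "\<phi> (fst z)" and ?d = "\<phi> (snd z)" and ?b = "u (snd z)"
    have b0: "u (fst z) = 0" "0 < ?c" "0 < ?b" using True by (auto simp: bad_def)
    have eq: "f n z = ?t n powr (p - 1) * (\<bar>?c - ?d\<bar> powr p * K z)
        + ?b powr (p - 1) * (?c powr p - ?t n powr (p - 1) * (?d powr p / (?b + ?t n) powr (p - 1))) * K z" for n
    proof -
      have 1: "\<bar>0 - ?b\<bar> powr (p - 2) * (0 - ?b) = - (?b powr (p - 1))"
        using abs_powr_abs_mult[of ?b p] b0 by simp
      have 2: "?t n powr (p - 1) \<noteq> 0" using t[of n] by simp
      have "f n z = ?t n powr (p - 1) * (\<bar>?c - ?d\<bar> powr p * K z
          + ?b powr (p - 1) * (?c powr p / ?t n powr (p - 1) - ?d powr p / (?b + ?t n) powr (p - 1)) * K z)"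
        unfolding f_def picone_gap_def b0(1) 1 using True b0 by simp
      also have "\<dots> = ?t n powr (p - 1) * (\<bar>?c - ?d\<bar> powr p * K z)
        + ?b powr (p - 1) * (?t n powr (p - 1) * (?c powr p / ?t n powr (p - 1)) - ?t n powr (p - 1) * (?d powr p / (?b + ?t n) powr (p - 1))) * K z"
        by (simp only: ring_distribs right_diff_distrib mult_ac)
      also have "?t n powr (p - 1) * (?c powr p / ?t n powr (p - 1)) = ?c powr p"
        using 2 by simp
      finally show ?thesis .
    qed
    have "(\<lambda>n. (?b + ?t n) powr (p - 1)) \<longlonglongrightarrow> (?b + 0) powr (p - 1)"
      using b0 by (intro tendsto_powr tendsto_add tendsto_const t_lim) auto
    then have "(\<lambda>n. ?t n powr (p - 1) * (\<bar>?c - ?d\<bar> powr p * K z)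
        + ?b powr (p - 1) * (?c powr p - ?t n powr (p - 1) * (?d powr p / (?b + ?t n) powr (p - 1))) * K z)
      \<longlonglongrightarrow> 0 * (\<bar>?c - ?d\<bar> powr p * K z) + ?b powr (p - 1) * (?c powr p - 0 * (?d powr p / (?b + 0) powr (p - 1))) * K z"
      using b0 by (intro tendsto_add tendsto_mult tendsto_diff tendsto_divide tendsto_const tp_lim) auto
    then show ?thesis
      unfolding eq using True by (simp add: G_def)
  qed (simp add: f_def G_def)
  have [measurable]: "G \<in> borel_measurable leb2"
    unfolding G_def by measurable
  have bound: "\<forall>\<^sub>F n in sequentially. (LINT z|leb2. f n z) \<le> e" if "0 < e" for e
  proof -
    have "(\<lambda>n. ?t n powr (p - 1) * C) \<longlonglongrightarrow> 0"
      using tendsto_mult_right[OF tp_lim, of C] by simp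
    then have "\<forall>\<^sub>F n in sequentially. ?t n powr (p - 1) * C < e"
      using that by (rule order_tendstoD(2))
    then show ?thesis
      by eventually_elim (use fC in \<open>meson less_imp_le order_trans\<close>)
  qed
  note F = fatou_integral[OF _ fi fn AE_I2[OF lim] bound]
  have Gi: "integrable leb2 G"
    by (rule F(1)[of 1]) auto
  have "(LINT z|leb2. G z) \<le> 0"
    by (rule field_le_epsilon) (simp add: F(2))
  moreover have G0: "0 \<le> G z" for z
    by (simp add: G_def)
  ultimately have "(LINT z|leb2. G z) = 0"
    by (intro antisym integral_nonneg_AE) auto
  then have "AE z in leb2. G z = 0"
    using integral_nonneg_eq_0_iff_AE[OF Gi] G0 by simp
  then have "AE z in leb2. \<not> bad z"
  proof eventually_elim
    case (elim z)
    show ?case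
    proof
      assume B: "bad z"
      then have "fst z \<noteq> snd z" by (auto simp: bad_def)
      then have "0 < K z" by (rule frac_kernel_pos)
      then have "0 < G z" using B by (simp add: G_def bad_def)
      then show False using elim by simp
    qed
  qed
  from leb2.AE_pair[OF this]
  have "AE x in lebesgue. AE y in lebesgue. \<not> bad (x, y)" .
  then show ?thesis
  proof eventually_elim
    case (elim x)
    show ?case
    proof (intro impI notI)
      assume "0 < \<phi> x" "u x = 0"
      then have "AE y in lebesgue. u y = 0"
        using elim u0 by (auto simp: bad_def elim!: eventually_elim2)
      then show False using nt by simp
    qed
  qed
qed

text \<open>The limit \<open>\<delta> \<rightarrow> 0\<close> in the tested equation.  The factor \<open>\<theta>\<close> tends to \<open>1\<close> on the set where \<open>\<phi> > 0\<close>,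
  because \<open>u\<close> has no zeros there.\<close>

lemma nonneg_solution_le_energy_bounded:
  assumes w: "weak_solution \<mu> u" and u0: "AE x in lebesgue. 0 \<le> u x" and nt: "\<not> (AE x in lebesgue. u x = 0)"
    and \<phi>: "\<phi> \<in> W0" and b: "\<And>x. 0 \<le> \<phi> x" "\<And>x. \<phi> x \<le> M"
  shows "\<mu> * mass \<phi> \<le> energy \<phi>"
proof -
  have u: "u \<in> W0" using w by (simp add: weak_solution_def)
  note [measurable] = W0_measurable[OF u] W0_measurable[OF \<phi>]
  let ?t = "\<lambda>n. 1 / real (Suc n)"
  let ?\<theta> = "\<lambda>n x. (\<bar>u x\<bar> / (\<bar>u x\<bar> + ?t n)) powr (p - 1)"
  have t: "0 < ?t n" for n by simp
  have t_lim: "?t \<longlonglongrightarrow> 0"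
    using LIMSEQ_inverse_real_of_nat by (simp add: inverse_eq_divide)
  note \<theta> = picone_ratio_bounds[OF t]
  have conv: "(\<lambda>n. LINT x|lebesgue. ?\<theta> n x * (\<bar>\<phi> x\<bar> powr p * c x)) \<longlonglongrightarrow> (LINT x|lebesgue. \<bar>\<phi> x\<bar> powr p * c x)"
    if c: "integrable lebesgue (\<lambda>x. \<bar>\<phi> x\<bar> powr p * c x)" for c
  proof (rule integral_dominated_convergence[OF _ _ integrable_abs[OF c]])
    show cm [measurable]: "(\<lambda>x. \<bar>\<phi> x\<bar> powr p * c x) \<in> borel_measurable lebesgue"
      using c by (rule borel_measurable_integrable)
    have "?\<theta> n \<in> borel_measurable lebesgue" for n
      by measurable
    then show "(\<lambda>x. ?\<theta> n x * (\<bar>\<phi> x\<bar> powr p * c x)) \<in> borel_measurable lebesgue" for n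
      using cm by (rule borel_measurable_times)
    show "AE x in lebesgue. (\<lambda>n. ?\<theta> n x * (\<bar>\<phi> x\<bar> powr p * c x)) \<longlonglongrightarrow> \<bar>\<phi> x\<bar> powr p * c x"
      using nonneg_solution_pos[OF w u0 nt \<phi> b]
    proof eventually_elim
      case (elim x)
      show ?case
      proof (cases "\<phi> x = 0")
        case False
        then have ux: "u x \<noteq> 0" using elim b(1)[of x] by simp
        have "(\<lambda>n. ?\<theta> n x) \<longlonglongrightarrow> (\<bar>u x\<bar> / (\<bar>u x\<bar> + 0)) powr (p - 1)"
          using ux by (intro tendsto_powr tendsto_divide tendsto_add tendsto_const t_lim) auto
        then have "(\<lambda>n. ?\<theta> n x) \<longlonglongrightarrow> 1"
          using ux by simp
        from tendsto_mult_right[OF this, of "\<bar>\<phi> x\<bar> powr p * c x"] show ?thesis by simp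
      qed simp
    qed
    show "AE x in lebesgue. norm (?\<theta> n x * (\<bar>\<phi> x\<bar> powr p * c x)) \<le> \<bar>\<bar>\<phi> x\<bar> powr p * c x\<bar>" for n
    proof (rule AE_I2)
      fix x
      show "norm (?\<theta> n x * (\<bar>\<phi> x\<bar> powr p * c x)) \<le> \<bar>\<bar>\<phi> x\<bar> powr p * c x\<bar>"
        using mult_right_mono[OF \<theta>(2) abs_ge_zero, of "u x" n "\<bar>\<phi> x\<bar> powr p * c x"]
        by (simp only: real_norm_def abs_mult[of "?\<theta> n x"] abs_of_nonneg[OF \<theta>(1)] mult_1_left)
    qed
  qed
  have L: "(\<lambda>n. LINT z|leb2. picone_gap u \<phi> (?t n) z) \<longlonglongrightarrow> seminorm \<phi> + 2 * potential \<phi> - 2 * \<mu> * mass \<phi>"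
    unfolding picone_gap_integral(3)[OF w u0 \<phi> b t] potential_def mass_def
    using conv[of V] conv[of "\<lambda>x. 1"] W0_potential_integrable[OF \<phi>] W0_mass[OF \<phi>]
    by (intro tendsto_diff tendsto_add tendsto_mult tendsto_const) simp_all
  have "0 \<le> seminorm \<phi> + 2 * potential \<phi> - 2 * \<mu> * mass \<phi>"
    by (rule LIMSEQ_le_const[OF L])
      (use integral_nonneg_AE[OF picone_gap_integral(2)[OF w u0 \<phi> b t]] in blast)
  then show ?thesis by (simp add: energy_def)
qed

text \<open>The bound \<open>\<mu> \<le> energy \<phi> / mass \<phi>\<close> for bounded \<open>\<phi>\<close> is applied to the truncations of a minimizer.\<close>

lemma nonneg_solution_le_first:
  assumes w: "weak_solution \<mu> u" and u0: "AE x in lebesgue. 0 \<le> u x" and nt: "\<not> (AE x in lebesgue. u x = 0)"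
  shows "\<mu> \<le> first_eig"
proof -
  obtain \<phi> where \<phi>: "\<phi> \<in> W0" "mass \<phi> = 1" "energy \<phi> = first_eig"
    using minimizer_exists by blast
  note [measurable] = W0_measurable[OF \<phi>(1)]
  \<comment> \<open>Truncation makes the minimizer an admissible choice in the Picone test function.\<close>
  let ?\<phi> = "\<lambda>k x. min \<bar>\<phi> x\<bar> (real k)"
  have lip: "abs (min (abs a) (real k) - min (abs b) (real k)) \<le> abs (a - b)" for a b k
    by linarith
  have W: "?\<phi> k \<in> W0" for k
    by (rule W0_contraction[OF \<phi>(1), where \<phi> = "\<lambda>t. min \<bar>t\<bar> (real k)"]) (use lip in auto)
  have le: "\<mu> * mass (?\<phi> k) \<le> seminorm \<phi> / 2 + potential (?\<phi> k)" for k
  proof -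
    have "\<mu> * mass (?\<phi> k) \<le> energy (?\<phi> k)"
      by (rule nonneg_solution_le_energy_bounded[OF w u0 nt W, where M = "real k"]) auto
    moreover have "seminorm (?\<phi> k) \<le> seminorm \<phi>"
      by (rule seminorm_contraction_le[OF \<phi>(1) W lip])
    ultimately show ?thesis by (simp add: energy_def)
  qed
  have conv: "(\<lambda>k. LINT x|lebesgue. \<bar>?\<phi> k x\<bar> powr p * c x) \<longlonglongrightarrow> (LINT x|lebesgue. \<bar>\<phi> x\<bar> powr p * c x)"
    if c: "integrable lebesgue (\<lambda>x. \<bar>\<phi> x\<bar> powr p * c x)" and [measurable]: "c \<in> borel_measurable lebesgue" for c
  proof (rule integral_dominated_convergence[OF _ _ integrable_abs[OF c]])
    show "AE x in lebesgue. (\<lambda>k. \<bar>?\<phi> k x\<bar> powr p * c x) \<longlonglongrightarrow> \<bar>\<phi> x\<bar> powr p * c x"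
    proof (rule AE_I2)
      fix x
      obtain N where N: "\<bar>\<phi> x\<bar> \<le> real N"
        using real_arch_simple by blast
      show "(\<lambda>k. \<bar>?\<phi> k x\<bar> powr p * c x) \<longlonglongrightarrow> \<bar>\<phi> x\<bar> powr p * c x"
      proof (rule tendsto_eventually, rule eventually_sequentiallyI[of N])
        fix k assume "N \<le> k"
        then show "\<bar>?\<phi> k x\<bar> powr p * c x = \<bar>\<phi> x\<bar> powr p * c x"
          using N by simp
      qed
    qed
    show "AE x in lebesgue. norm (\<bar>?\<phi> k x\<bar> powr p * c x) \<le> \<bar>\<bar>\<phi> x\<bar> powr p * c x\<bar>" for k
      using p by (intro AE_I2) (auto simp: abs_mult intro!: mult_right_mono powr_mono2)
  qed measurable
  have 1: "(\<lambda>k. potential (?\<phi> k)) \<longlonglongrightarrow> potential \<phi>"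
    unfolding potential_def by (rule conv[OF W0_potential_integrable[OF \<phi>(1)] V_meas])
  have 2: "(\<lambda>k. mass (?\<phi> k)) \<longlonglongrightarrow> mass \<phi>"
    using conv[of "\<lambda>x. 1"] W0_mass[OF \<phi>(1)] by (simp add: mass_def)
  have "\<mu> * mass \<phi> \<le> seminorm \<phi> / 2 + potential \<phi>"
    by (rule LIMSEQ_le[OF tendsto_mult[OF tendsto_const 2] tendsto_add[OF tendsto_const 1]]) (use le in blast)
  then show ?thesis using \<phi> by (simp add: energy_def)
qed

lemma weak_solution_uminus:
  assumes "weak_solution \<mu> u"
  shows "weak_solution \<mu> (\<lambda>x. - u x)"
proof -
  have u: "u \<in> W0" using assms by (simp add: weak_solution_def)
  have "form (\<lambda>x. - u x) v = - form u v" for v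
  proof -
    have "\<bar>- u x - - u y\<bar> powr (p - 2) * (- u x - - u y) * (v x - v y) * k
      = - (\<bar>u x - u y\<bar> powr (p - 2) * (u x - u y) * (v x - v y) * k)" for x y k
      by (simp add: abs_minus_commute algebra_simps)
    then show ?thesis unfolding form_def by (simp only: integral_minus minus_divide_left)
  qed
  then show ?thesis
    using assms W0_uminus[OF u] by (auto simp: weak_solution_def)
qed

lemma weak_solution_energy:
  assumes w: "weak_solution \<mu> u"
  shows "energy u = \<mu> * mass u"
proof -
  have u: "u \<in> W0" using w by (simp add: weak_solution_def)
  have "form u u = seminorm u / 2"
    unfolding form_def seminorm_def abs_powr_minus_two ..
  then show ?thesis
    using w u unfolding weak_solution_def energy_def potential_def mass_def
    by (auto simp: abs_powr_minus_two)
qed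

text \<open>Testing the equation with the positive part of \<open>u\<close>, and using that truncation only decreases increments.\<close>

lemma positive_part_energy:
  assumes w: "weak_solution \<mu> u"
  defines "v \<equiv> \<lambda>x. max (u x) 0"
  shows "v \<in> W0" "energy v \<le> \<mu> * mass v"
proof -
  have u: "u \<in> W0" using w by (simp add: weak_solution_def)
  show v: "v \<in> W0"
    unfolding v_def by (rule W0_contraction[OF u, where \<phi> = "\<lambda>t. max t 0"]) auto
  have "seminorm v \<le> 2 * form u v"
  proof -
    have "seminorm v \<le> (LINT z|leb2. \<bar>u (fst z) - u (snd z)\<bar> powr (p - 2) * (u (fst z) - u (snd z))
      * (v (fst z) - v (snd z)) * K z)"
      unfolding seminorm_def
      by (rule integral_mono[OF W0_seminorm[OF v] weak_integrable(1)[OF u v]])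
        (auto simp: v_def intro!: mult_right_mono positive_part_le[OF p])
    then show ?thesis by (simp add: form_def)
  qed
  moreover have "\<bar>u x\<bar> powr (p - 2) * u x * v x = \<bar>v x\<bar> powr p" for x
    using abs_powr_minus_two[of "u x" p] by (auto simp: v_def max_def)
  then have "form u v + potential v = \<mu> * mass v"
    using w v unfolding weak_solution_def potential_def mass_def by auto
  ultimately show "energy v \<le> \<mu> * mass v"
    by (simp add: energy_def)
qed

end

section \<open>Isolation of the lowest eigenvalue\<close>

context frac_schroedinger
begin

text \<open>The sum of two nonnegative minimizers with disjoint supports would have mass \<open>2\<close>, but energy
  strictly below twice the infimum, because the interaction between the supports lowers the seminorm.\<close>

lemma no_disjoint_minimizers:
  assumes f: "f \<in> W0" "mass f = 1" "energy f = first_eig" "AE x in lebesgue. 0 \<le> f x"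
    and g: "g \<in> W0" "mass g = 1" "energy g = first_eig" "AE x in lebesgue. 0 \<le> g x"
    and dis: "AE x in lebesgue. f x * g x = 0"
  shows False
proof -
  note [measurable] = W0_measurable[OF f(1)] W0_measurable[OF g(1)]
  let ?h = "\<lambda>x. f x + g x"
  have h: "?h \<in> W0" by (rule W0_add[OF f(1) g(1)])
  have ae: "AE x in lebesgue. 0 \<le> f x \<and> 0 \<le> g x \<and> f x * g x = 0"
    using f(4) g(4) dis by auto
  have sum: "\<bar>a + b\<bar> powr p = \<bar>a\<bar> powr p + \<bar>b\<bar> powr p" if "a * b = 0" for a b :: real
    using that by auto
  have "mass ?h = (LINT x|lebesgue. \<bar>f x\<bar> powr p + \<bar>g x\<bar> powr p)"
    unfolding mass_def by (rule integral_cong_AE) (use dis sum in auto)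
  then have mh: "mass ?h = 2"
    using W0_mass[OF f(1)] W0_mass[OF g(1)] f(2) g(2) by (simp add: mass_def)
  have "potential ?h = (LINT x|lebesgue. \<bar>f x\<bar> powr p * V x + \<bar>g x\<bar> powr p * V x)"
    unfolding potential_def
  proof (rule integral_cong_AE)
    show "AE x in lebesgue. \<bar>?h x\<bar> powr p * V x = \<bar>f x\<bar> powr p * V x + \<bar>g x\<bar> powr p * V x"
      using dis by eventually_elim (simp add: sum distrib_right)
  qed measurable
  then have ph: "potential ?h = potential f + potential g"
    using W0_potential_integrable[OF f(1)] W0_potential_integrable[OF g(1)] by (simp add: potential_def)
  let ?D = "\<lambda>z. increment f z + increment g z
      - increment ?h z"
  have Di: "integrable leb2 ?D"
    by (intro Bochner_Integration.integrable_diff Bochner_Integration.integrable_add W0_seminorm f g h)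
  have "(LINT z|leb2. ?D z) = seminorm f + seminorm g - seminorm ?h"
    unfolding seminorm_def using W0_seminorm[OF f(1)] W0_seminorm[OF g(1)] W0_seminorm[OF h] by simp
  also have "\<dots> \<le> 0"
    using first_eig_le_energy[OF h] f(3) g(3) unfolding mh by (simp add: energy_def ph)
  finally have D0: "(LINT z|leb2. ?D z) \<le> 0" .
  have ae2: "AE z in leb2. (0 \<le> f (fst z) \<and> 0 \<le> g (fst z) \<and> f (fst z) * g (fst z) = 0) \<and>
      (0 \<le> f (snd z) \<and> 0 \<le> g (snd z) \<and> f (snd z) * g (snd z) = 0)"
    by (rule AE_leb2I[OF ae])
  have D1: "AE z in leb2. 0 \<le> ?D z"
    using ae2
  proof eventually_elim
    case (elim z)
    then have "\<bar>?h (fst z) - ?h (snd z)\<bar> powr p \<le> \<bar>f (fst z) - f (snd z)\<bar> powr p + \<bar>g (fst z) - g (snd z)\<bar> powr p"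
      using disjoint_supports_le(1)[of p "f (fst z)" "f (snd z)" "g (fst z)" "g (snd z)"] p by simp
    from mult_right_mono[OF this, of "K z"] show ?case
      by (simp add: distrib_right)
  qed
  have "(LINT z|leb2. ?D z) = 0"
    using D0 integral_nonneg_AE[OF D1] by simp
  then have "AE z in leb2. ?D z = 0"
    using integral_nonneg_eq_0_iff_AE[OF Di D1] by simp
  then have "AE z in leb2. \<not> (0 < f (fst z) \<and> 0 < g (snd z))"
    using ae2
  proof eventually_elim
    case (elim z)
    show ?case
    proof
      assume B: "0 < f (fst z) \<and> 0 < g (snd z)"
      then have "fst z \<noteq> snd z" using elim by auto
      then have K: "0 < K z" by (rule frac_kernel_pos)
      have "\<bar>?h (fst z) - ?h (snd z)\<bar> powr p < \<bar>f (fst z) - f (snd z)\<bar> powr p + \<bar>g (fst z) - g (snd z)\<bar> powr p"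
        using disjoint_supports_le(2)[of p "f (fst z)" "f (snd z)" "g (fst z)" "g (snd z)"] p elim B by simp
      from mult_strict_right_mono[OF this K] show False
        using elim by (simp add: distrib_right)
    qed
  qed
  from leb2.AE_pair[OF this]
  have P: "AE x in lebesgue. AE y in lebesgue. \<not> (0 < f x \<and> 0 < g y)" by simp
  have "AE x in lebesgue. f x = 0"
    using P f(4)
  proof eventually_elim
    case (elim x)
    show ?case
    proof (rule ccontr)
      assume "f x \<noteq> 0"
      then have "0 < f x" using elim by simp
      then have "AE y in lebesgue. g y = 0"
        using elim(1) g(4) by (auto elim!: eventually_elim2)
      then show False
        using mass_eq_0_iff[OF g(1)] g(2) by simp
    qed
  qed
  then show False
    using mass_eq_0_iff[OF f(1)] f(2) by simp
qed

lemma weak_solution_ge_first: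
  assumes w: "weak_solution \<mu> u" and nt: "\<not> (AE x in lebesgue. u x = 0)"
  shows "first_eig \<le> \<mu>"
proof -
  have u: "u \<in> W0" using w by (simp add: weak_solution_def)
  have "0 < mass u"
    using mass_eq_0_iff[OF u] nt mass_nonneg[of u] by simp
  then show ?thesis
    using first_eig_le_energy[OF u] weak_solution_energy[OF w] by simp
qed

lemma higher_solution_positive_part:
  assumes w: "weak_solution \<mu> u" and nt: "\<not> (AE x in lebesgue. u x = 0)" and \<mu>: "first_eig < \<mu>"
  shows "mass (\<lambda>x. max (u x) 0) \<noteq> 0"
proof
  assume "mass (\<lambda>x. max (u x) 0) = 0"
  then have "AE x in lebesgue. max (u x) 0 = 0"
    using mass_eq_0_iff[OF positive_part_energy(1)[OF w]] by simp
  then have "AE x in lebesgue. 0 \<le> - u x"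
    by eventually_elim (simp add: max_def split: if_splits)
  from nonneg_solution_le_first[OF weak_solution_uminus[OF w] this] nt \<mu> show False
    by simp
qed

lemma normalized_positive_part:
  assumes w: "weak_solution \<mu> u" and nt: "\<not> (AE x in lebesgue. u x = 0)" and \<mu>: "first_eig < \<mu>"
  defines "v \<equiv> \<lambda>x. mass (\<lambda>x. max (u x) 0) powr (- 1 / p) * max (u x) 0"
  shows "v \<in> W0" "mass v = 1" "first_eig \<le> energy v" "energy v \<le> \<mu>"
proof -
  let ?u = "\<lambda>x. max (u x) 0"
  note P = positive_part_energy[OF w]
  note N = normalize[OF P(1) higher_solution_positive_part[OF w nt \<mu>], folded v_def]
  show "v \<in> W0" "mass v = 1" by (rule N)+
  then show "first_eig \<le> energy v"
    using first_eig_le_energy[of v] by simp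
  have "0 < mass ?u"
    using higher_solution_positive_part[OF w nt \<mu>] mass_nonneg[of ?u] by simp
  then show "energy v \<le> \<mu>"
    using P(2) N(3) by (simp add: pos_divide_le_eq)
qed

lemma first_eig_isolated:
  "\<exists>\<epsilon>>0. \<forall>\<mu> u. weak_solution \<mu> u \<and> \<not> (AE x in lebesgue. u x = 0) \<and> \<bar>\<mu> - first_eig\<bar> < \<epsilon> \<longrightarrow> \<mu> = first_eig"
proof (rule ccontr)
  assume contra: "\<not> ?thesis"
  have "\<exists>\<mu> u. weak_solution \<mu> u \<and> \<not> (AE x in lebesgue. u x = 0) \<and> \<bar>\<mu> - first_eig\<bar> < 1 / real (Suc k) \<and> \<mu> \<noteq> first_eig" for k
  proof -
    have "0 < 1 / real (Suc k)" by simp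
    with contra show ?thesis by blast
  qed
  then obtain \<mu> u where w: "\<And>k. weak_solution (\<mu> k) (u k)" and nt: "\<And>k. \<not> (AE x in lebesgue. u k x = 0)"
    and close: "\<And>k. \<bar>\<mu> k - first_eig\<bar> < 1 / real (Suc k)" and ne: "\<And>k. \<mu> k \<noteq> first_eig"
    by metis
  have gt: "first_eig < \<mu> k" for k
    using weak_solution_ge_first[OF w nt, of k] ne[of k] by simp
  have \<mu>: "\<mu> \<longlonglongrightarrow> first_eig"
  proof (rule tendsto_sandwich[of "\<lambda>_. first_eig" _ _ "\<lambda>k. first_eig + 1 / real (Suc k)"])
    have "\<mu> k \<le> first_eig + 1 / real (Suc k)" for k
      using close[of k] by linarith
    then show "\<forall>\<^sub>F k in sequentially. \<mu> k \<le> first_eig + 1 / real (Suc k)"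
      by simp
    show "(\<lambda>k. first_eig + 1 / real (Suc k)) \<longlonglongrightarrow> first_eig"
      using tendsto_add[OF tendsto_const[of first_eig] LIMSEQ_inverse_real_of_nat] by (simp add: inverse_eq_divide)
  qed (use gt in \<open>auto simp: less_imp_le\<close>)
  have nt': "\<not> (AE x in lebesgue. - u k x = 0)" for k
    using nt[of k] by simp
  define f where "f k x = mass (\<lambda>x. max (u k x) 0) powr (- 1 / p) * max (u k x) 0" for k x
  define g where "g k x = mass (\<lambda>x. max (- u k x) 0) powr (- 1 / p) * max (- u k x) 0" for k x
  note F = normalized_positive_part[OF w nt gt, folded f_def]
  note G = normalized_positive_part[OF weak_solution_uminus[OF w] nt' gt, folded g_def]
  have f0: "0 \<le> f k x" and g0: "0 \<le> g k x" and fg: "f k x * g k x = 0" for k x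
    by (auto simp: f_def g_def max_def)
  have Ef: "(\<lambda>k. energy (f k)) \<longlonglongrightarrow> first_eig"
    by (rule tendsto_sandwich[OF _ _ tendsto_const \<mu>]) (use F in auto)
  have Eg: "(\<lambda>k. energy (g k)) \<longlonglongrightarrow> first_eig"
    by (rule tendsto_sandwich[OF _ _ tendsto_const \<mu>]) (use G in auto)
  obtain r :: "nat \<Rightarrow> nat" and f' where r: "strict_mono r" and f': "f' \<in> W0" "mass f' = 1" "energy f' = first_eig"
    and fl: "AE x in lebesgue. (\<lambda>k. f (r k) x) \<longlonglongrightarrow> f' x"
    by (rule minimizing_sequence[where u = f, OF F(1,2) Ef]) blast
  have "(\<lambda>k. energy (g (r k))) \<longlonglongrightarrow> first_eig"
    using LIMSEQ_subseq_LIMSEQ[OF Eg r] by (simp add: o_def)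
  then obtain r' :: "nat \<Rightarrow> nat" and g' where r': "strict_mono r'" and g': "g' \<in> W0" "mass g' = 1" "energy g' = first_eig"
    and gl: "AE x in lebesgue. (\<lambda>k. g (r (r' k)) x) \<longlonglongrightarrow> g' x"
    by (rule minimizing_sequence[where u = "\<lambda>k. g (r k)", OF G(1,2)]) blast
  have fl': "AE x in lebesgue. (\<lambda>k. f (r (r' k)) x) \<longlonglongrightarrow> f' x"
    using fl by eventually_elim (use LIMSEQ_subseq_LIMSEQ[OF _ r'] in \<open>auto simp: o_def\<close>)
  have 1: "AE x in lebesgue. 0 \<le> f' x"
    using fl by eventually_elim (use f0 in \<open>auto intro: LIMSEQ_le_const\<close>)
  have 2: "AE x in lebesgue. 0 \<le> g' x"
    using gl by eventually_elim (use g0 in \<open>auto intro: LIMSEQ_le_const\<close>)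
  have 3: "AE x in lebesgue. f' x * g' x = 0"
    using fl' gl
  proof eventually_elim
    case (elim x)
    from tendsto_mult[OF elim] show ?case
      by (simp add: fg LIMSEQ_const_iff)
  qed
  show False
    by (rule no_disjoint_minimizers[OF f' 1 g' 2 3])
qed

lemma first_eig_solution: "\<exists>u. weak_solution first_eig u \<and> \<not> (AE x in lebesgue. u x = 0)"
proof -
  obtain f where f: "f \<in> W0" "mass f = 1" "energy f = first_eig"
    using minimizer_exists by blast
  then have "weak_solution first_eig f"
    by (intro minimizer_weak_solution) auto
  moreover have "\<not> (AE x in lebesgue. f x = 0)"
    using mass_eq_0_iff[OF f(1)] f(2) by simp
  ultimately show ?thesis by blast
qed

end

section \<open>Translation to eigenvalues and eigenfunctions\<close>

lemma gagliardo_integrand_eq: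
  "gagliardo_integrand s p u z = \<bar>u (fst z) - u (snd z)\<bar> powr p * frac_kernel (s * p) z"
  by (simp add: gagliardo_integrand_def frac_kernel_def split_def)

lemma Wsp_UNIV_iff:
  "u \<in> Wsp s p UNIV \<longleftrightarrow> u \<in> borel_measurable lebesgue \<and> integrable lebesgue (\<lambda>x. \<bar>u x\<bar> powr p) \<and>
     integrable leb2 (\<lambda>z. \<bar>u (fst z) - u (snd z)\<bar> powr p * frac_kernel (s * p) z)"
  by (simp add: Wsp_def Lp_def lebesgue_on_UNIV_eq gagliardo_integrand_eq[abs_def])

text \<open>Restriction of the double integral to a measurable subset.\<close>

lemma Wsp_restrict:
  fixes \<Omega> :: "(real^'n) set"
  assumes u: "u \<in> Wsp s p UNIV" and \<Omega>: "\<Omega> \<in> sets lebesgue"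
  shows "u \<in> Wsp s p \<Omega>"
proof -
  have [measurable]: "u \<in> borel_measurable lebesgue" and i1: "integrable lebesgue (\<lambda>x. \<bar>u x\<bar> powr p)"
    and i2: "integrable leb2 (\<lambda>z. \<bar>u (fst z) - u (snd z)\<bar> powr p * frac_kernel (s * p) z)"
    using u by (auto simp: Wsp_UNIV_iff)
  let ?L = "lebesgue_on \<Omega>"
  let ?F = "\<lambda>z. \<bar>u (fst z) - u (snd z)\<bar> powr p * frac_kernel (s * p) z"
  interpret R: sigma_finite_measure ?L
    using \<Omega> by (intro sigma_finite_measure_restrict_space sigma_finite_lebesgue)
  have id: "(\<lambda>x. x) \<in> measurable ?L lebesgue"
    by (rule measurable_restrict_space1) simp
  have pair: "(\<lambda>z. z) \<in> measurable (?L \<Otimes>\<^sub>M ?L) leb2"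
    using measurable_Pair[OF measurable_compose[OF measurable_fst id] measurable_compose[OF measurable_snd id]] by simp
  have F [measurable]: "?F \<in> borel_measurable leb2" by measurable
  have F': "?F \<in> borel_measurable (?L \<Otimes>\<^sub>M ?L)"
    using measurable_compose[OF pair F] by simp
  have restrict: "(\<integral>\<^sup>+x. f x \<partial>?L) \<le> (\<integral>\<^sup>+x. f x \<partial>lebesgue)" for f :: "real^'n \<Rightarrow> ennreal"
    using \<Omega> by (subst nn_integral_restrict_space) (auto intro!: nn_integral_mono simp: indicator_def)
  have "(\<integral>\<^sup>+z. ennreal (?F z) \<partial>(?L \<Otimes>\<^sub>M ?L)) = (\<integral>\<^sup>+x. \<integral>\<^sup>+y. ennreal (?F (x, y)) \<partial>?L \<partial>?L)"
    using F' by (subst R.nn_integral_fst[symmetric]) auto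
  also have "\<dots> \<le> (\<integral>\<^sup>+x. \<integral>\<^sup>+y. ennreal (?F (x, y)) \<partial>lebesgue \<partial>lebesgue)"
    by (rule order_trans[OF restrict]) (intro nn_integral_mono restrict)
  also have "\<dots> = (\<integral>\<^sup>+z. ennreal (?F z) \<partial>leb2)"
    by (subst leb.nn_integral_fst[symmetric]) auto
  also have "\<dots> < \<infinity>"
    using nn_integral_eq_integral[OF i2] by simp
  finally have "integrable (?L \<Otimes>\<^sub>M ?L) ?F"
    using F' by (intro integrableI_nonneg) auto
  moreover have "u \<in> borel_measurable ?L"
    by (rule measurable_restrict_space1) simp
  moreover have "integrable ?L (\<lambda>x. \<bar>u x\<bar> powr p)"
    using \<Omega> integrable_mult_indicator[OF \<Omega> i1] by (subst integrable_restrict_space) simp_all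
  ultimately show ?thesis
    by (simp add: Wsp_def Lp_def gagliardo_integrand_eq[abs_def])
qed

context frac_schroedinger
begin

lemma Wsp0_eq_W0: "Wsp0 s p \<Omega> = W0"
proof (intro equalityI subsetI)
  fix w assume "w \<in> Wsp0 s p \<Omega>"
  then show "w \<in> W0"
    by (auto simp: Wsp0_def W0_def Wsp_UNIV_iff) (auto simp: zero_ext_def)
next
  fix w assume w: "w \<in> W0"
  then have "w \<in> Wsp s p UNIV"
    by (simp add: W0_def Wsp_UNIV_iff)
  moreover have "zero_ext \<Omega> w = w"
    using W0_outside[OF w] by (auto simp: zero_ext_def)
  ultimately show "w \<in> Wsp0 s p \<Omega>"
    unfolding Wsp0_def using Wsp_restrict[OF _ Omega_sets] by (intro image_eqI[of _ _ w]) auto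
qed

text \<open>The potential vanishes outside \<open>\<Omega>\<close>, so that integration over \<open>\<Omega>\<close> and over the whole space agree.\<close>

lemma potential_restrict: "(LINT x|lebesgue_on \<Omega>. V x * f x) = (LINT x|lebesgue. f x * V x)"
proof -
  have "(LINT x|lebesgue_on \<Omega>. V x * f x) = (LINT x|lebesgue. indicat_real \<Omega> x *\<^sub>R (V x * f x))"
    by (rule integral_restrict_space) simp
  also have "\<dots> = (LINT x|lebesgue. f x * V x)"
    by (rule Bochner_Integration.integral_cong) (use V_out in \<open>auto simp: indicator_def\<close>)
  finally show ?thesis .
qed

lemma gagliardo_powr: "gagliardo s p UNIV u powr p = seminorm u"
  using seminorm_nonneg[of u] p
  by (simp add: gagliardo_def seminorm_def gagliardo_integrand_eq[abs_def] lebesgue_on_UNIV_eq powr_powr)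

lemma Lp_norm_eq_1_iff: "Lp_norm p UNIV u = 1 \<longleftrightarrow> mass u = 1"
proof -
  have "(mass u powr (1 / p)) powr p = mass u"
    using mass_nonneg[of u] p by (simp add: powr_powr)
  moreover have "Lp_norm p UNIV u = mass u powr (1 / p)"
    by (simp add: Lp_norm_def mass_def lebesgue_on_UNIV_eq)
  ultimately show ?thesis by (metis powr_one_eq_one)
qed

lemma H_form_eq_form: "H_form s p u v = form u v"
  by (simp add: H_form_def form_def frac_kernel_def split_def)

end

text \<open>The potential \<open>V'\<close> is arbitrary outside \<open>\<Omega>\<close>.\<close>

lemma (in frac_schroedinger) first_eigenvalue_eq:
  assumes "\<And>x. x \<in> \<Omega> \<Longrightarrow> V' x = V x"
  shows "first_eigenvalue s p \<Omega> V' = first_eig"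
proof -
  have "(LINT x|lebesgue_on \<Omega>. V' x * \<bar>u x\<bar> powr p) = potential u" for u
  proof -
    have "(LINT x|lebesgue_on \<Omega>. V' x * \<bar>u x\<bar> powr p) = (LINT x|lebesgue_on \<Omega>. V x * \<bar>u x\<bar> powr p)"
      by (rule Bochner_Integration.integral_cong) (use assms in auto)
    then show ?thesis by (simp add: potential_restrict potential_def)
  qed
  then show ?thesis
    unfolding first_eigenvalue_def first_eig_def
    by (simp add: gagliardo_powr Lp_norm_eq_1_iff Wsp0_eq_W0 energy_def)
qed

lemma (in frac_schroedinger) is_eigenfunction_iff:
  assumes "\<And>x. x \<in> \<Omega> \<Longrightarrow> V' x = V x"
  shows "is_eigenfunction s p \<Omega> V' \<mu> u \<longleftrightarrow> weak_solution \<mu> u \<and> \<not> (AE x in lebesgue. u x = 0)"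
proof -
  have "(LINT x|lebesgue_on \<Omega>. V' x * \<bar>u x\<bar> powr (p - 2) * u x * v x)
      = (LINT x|lebesgue. \<bar>u x\<bar> powr (p - 2) * u x * v x * V x)" for v
  proof -
    have "(LINT x|lebesgue_on \<Omega>. V' x * \<bar>u x\<bar> powr (p - 2) * u x * v x)
      = (LINT x|lebesgue_on \<Omega>. V x * (\<bar>u x\<bar> powr (p - 2) * u x * v x))"
      by (rule Bochner_Integration.integral_cong) (use assms in auto)
    then show ?thesis by (simp add: potential_restrict)
  qed
  then show ?thesis
    unfolding is_eigenfunction_def weak_solution_def Wsp0_eq_W0 H_form_eq_form by auto
qed

theorem theorem3p9:
  fixes \<Omega> :: "(real^'n) set" and V :: "(real^'n) \<Rightarrow> real" and s p q :: real
  assumes "0 < s" and "s < 1" and "1 < p"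
    and "\<Omega> \<noteq> {}" and "connected \<Omega>" and "bounded \<Omega>"
    and "extension_domain s p \<Omega>"
    and "q \<in> {1<..} \<inter> {real CARD('n) / (s * p)<..}"
    and "V \<in> Lp q \<Omega>"
  shows "\<exists>\<epsilon>>0. {\<mu>. is_eigenvalue s p \<Omega> V \<mu>} \<inter>
           {first_eigenvalue s p \<Omega> V - \<epsilon> <..< first_eigenvalue s p \<Omega> V + \<epsilon>}
         = {first_eigenvalue s p \<Omega> V}"
proof -
  have "open \<Omega>" using assms(7) by (simp add: extension_domain_def)
  then have \<Omega> [measurable]: "\<Omega> \<in> sets lebesgue" by (simp add: borel_open sets_completionI_sets)
  have V_meas: "V \<in> borel_measurable (lebesgue_on \<Omega>)"
    and V_int: "integrable (lebesgue_on \<Omega>) (\<lambda>x. \<bar>V x\<bar> powr q)"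
    using assms(9) by (auto simp: Lp_def)
  let ?V = "zero_ext \<Omega> V"
  interpret frac_schroedinger \<Omega> ?V s p q
  proof
    have "(\<lambda>x. indicat_real \<Omega> x *\<^sub>R V x) \<in> borel_measurable lebesgue"
      using V_meas by (subst (asm) borel_measurable_restrict_space_iff) auto
    moreover have "(\<lambda>x. indicat_real \<Omega> x *\<^sub>R V x) = ?V"
      by (auto simp: zero_ext_def indicator_def)
    ultimately show "?V \<in> borel_measurable lebesgue" by simp
    have "integrable lebesgue (\<lambda>x. indicat_real \<Omega> x *\<^sub>R \<bar>V x\<bar> powr q)"
      using V_int by (subst (asm) integrable_restrict_space) auto
    moreover have "(\<lambda>x. indicat_real \<Omega> x *\<^sub>R \<bar>V x\<bar> powr q) = (\<lambda>x. \<bar>?V x\<bar> powr q)"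
      by (auto simp: zero_ext_def indicator_def)
    ultimately show "integrable lebesgue (\<lambda>x. \<bar>?V x\<bar> powr q)" by simp
  qed (use assms \<open>open \<Omega>\<close> in \<open>auto simp: zero_ext_def\<close>)
  have VV: "V x = ?V x" if "x \<in> \<Omega>" for x
    using that by (simp add: zero_ext_def)
  have fe: "first_eigenvalue s p \<Omega> V = first_eig"
    by (rule first_eigenvalue_eq[OF VV])
  have ev: "is_eigenvalue s p \<Omega> V \<mu> \<longleftrightarrow> (\<exists>u. weak_solution \<mu> u \<and> \<not> (AE x in lebesgue. u x = 0))" for \<mu>
    unfolding is_eigenvalue_def using is_eigenfunction_iff[OF VV] by blast
  obtain \<epsilon> where \<epsilon>: "0 < \<epsilon>" "\<And>\<mu> u. weak_solution \<mu> u \<Longrightarrow> \<not> (AE x in lebesgue. u x = 0) \<Longrightarrow>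
      \<bar>\<mu> - first_eig\<bar> < \<epsilon> \<Longrightarrow> \<mu> = first_eig"
    using first_eig_isolated by blast
  show ?thesis
  proof (intro exI[of _ \<epsilon>] conjI equalityI subsetI)
    fix \<mu> assume "\<mu> \<in> {\<mu>. is_eigenvalue s p \<Omega> V \<mu>} \<inter>
      {first_eigenvalue s p \<Omega> V - \<epsilon> <..< first_eigenvalue s p \<Omega> V + \<epsilon>}"
    then obtain u where "weak_solution \<mu> u" "\<not> (AE x in lebesgue. u x = 0)" "\<bar>\<mu> - first_eig\<bar> < \<epsilon>"
      unfolding fe ev by (auto simp: abs_less_iff)
    then have "\<mu> = first_eig"
      by (rule \<epsilon>(2))
    then show "\<mu> \<in> {first_eigenvalue s p \<Omega> V}" by (simp add: fe)
  next
    fix \<mu> assume "\<mu> \<in> {first_eigenvalue s p \<Omega> V}"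
    then show "\<mu> \<in> {\<mu>. is_eigenvalue s p \<Omega> V \<mu>} \<inter>
      {first_eigenvalue s p \<Omega> V - \<epsilon> <..< first_eigenvalue s p \<Omega> V + \<epsilon>}"
      using first_eig_solution \<epsilon>(1) unfolding fe by (auto simp: ev)
  qed (rule \<epsilon>(1))
qed

end
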